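(* Let $K=\mathbb{F}_q$ be a finite field of characteristic $p$, let $N\ge 1$ with $p\ge N$, let $\mathfrak{g}$ be a Lie subalgebra (over $K$) of $\mathfrak{ut}(N,K)$, and let $G=\exp(\mathfrak{g})$. Let $\mathfrak{h}$ be a Lie subalgebra of $\mathfrak{g}$, $H=\exp(\mathfrak{h})$, and $\pi:\mathfrak{g}^*\to\mathfrak{h}^*$ the natural projection (restriction of linear forms to $\mathfrak{h}$). Let $\Omega\subset\mathfrak{g}^*$ be a coadjoint orbit of $G$ and $\omega\subset\mathfrak{h}^*$ a coadjoint orbit of $H$, with corresponding irreducible complex representations $T^\Omega$ of $G$ and $t^\omega$ of $H$. Then $T^\Omega$ occurs in the decomposition of the induced representation $\mathrm{ind}(t^\omega,G)$ if and only if $\Omega\cap\pi^{-1}(\omega)\neq\emptyset$.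
   Context: $\mathfrak{ut}(N,K)$ is the Lie algebra of all $N\times N$ upper triangular matrices over $K$ with zeros on the diagonal. Since $p\ge N$, the exponential map $\exp$ is defined on $\mathfrak{ut}(N,K)$ and maps each Lie subalgebra $\mathfrak{g}$ bijectively onto a subgroup $G=\exp(\mathfrak{g})$ of the unitriangular group $\mathrm{UT}(N,K)$. $\mathfrak{g}^*$ is the dual $K$-vector space. The coadjoint action of $G$ on $\mathfrak{g}^*$ is $(\mathrm{Ad}^*_g\lambda)(x)=\lambda(g^{-1}xg)$; its orbits are the coadjoint orbits. Fix a nontrivial additive character $K\to\mathbb{C}^*$, written $x\mapsto e^{x}$ (the same character is used for all groups). For $\lambda\in\mathfrak{g}^*$, a polarization of $\lambda$ is a subalgebra $\mathfrak{p}$ of $\mathfrak{g}$ that is a maximal isotropic subspace for the skew-symmetric form $B_\lambda(x,y)=\lambda([x,y])$ on $\mathfrak{g}$; polarizations always exist. Put $P=\exp(\mathfrak{p})$, let $\xi_\lambda:P\to\mathbb{C}^*$ be the one-dimensional representation $\xi_\lambda(\exp(x))=e^{\lambda(x)}$, and let $T^\lambda=\mathrm{ind}(\xi_\lambda,P,G)$ be the induced complex representation. Up to equivalence, $T^\lambda$ is irreducible, does not depend on the choice of $\mathfrak{p}$, and depends only on the coadjoint orbit $\Omega$ of $\lambda$; its equivalence class is denoted $T^\Omega$. The representation $t^\omega$ of $H$ attached to a coadjoint orbit $\omega\subset\mathfrak{h}^*$ is defined in the same way, with $(\mathfrak{h},H)$ in place of $(\mathfrak{g},G)$. *)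

theory Defs
  imports
    "HOL-Analysis.Analysis"
    "HOL-Algebra.Group"
    "HOL-Library.Function_Algebras"
    "HOL-Library.FuncSet"
begin

section \<open>Complex representations of groups\<close>

text \<open>
  A representation is given by its space, a subspace of an additive type with an explicit scalar
  multiplication by complex numbers, and the action of the group elements. Only the values of
  the action on the carrier of the group and on the space matter.
\<close>

record ('g, 'v) rep =
  rep_space :: "'v set"
  rep_scale :: "complex \<Rightarrow> 'v \<Rightarrow> 'v"
  rep_act :: "'g \<Rightarrow> 'v \<Rightarrow> 'v"

definition representation :: "('g, 'm) monoid_scheme \<Rightarrow> ('g, 'v::ab_group_add) rep \<Rightarrow> bool" where
  "representation G R \<longleftrightarrow>
     vector_space (rep_scale R) \<and> module.subspace (rep_scale R) (rep_space R) \<and>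
     (\<forall>g\<in>carrier G. \<forall>v\<in>rep_space R. rep_act R g v \<in> rep_space R) \<and>
     (\<forall>g\<in>carrier G. \<forall>v\<in>rep_space R. \<forall>w\<in>rep_space R. rep_act R g (v + w) = rep_act R g v + rep_act R g w) \<and>
     (\<forall>g\<in>carrier G. \<forall>c. \<forall>v\<in>rep_space R. rep_act R g (rep_scale R c v) = rep_scale R c (rep_act R g v)) \<and>
     (\<forall>v\<in>rep_space R. rep_act R \<one>\<^bsub>G\<^esub> v = v) \<and>
     (\<forall>g\<in>carrier G. \<forall>h\<in>carrier G. \<forall>v\<in>rep_space R. rep_act R (g \<otimes>\<^bsub>G\<^esub> h) v = rep_act R g (rep_act R h v))"

definition invariant_subspace ::
  "('g, 'm) monoid_scheme \<Rightarrow> ('g, 'v::ab_group_add) rep \<Rightarrow> 'v set \<Rightarrow> bool" where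
  "invariant_subspace G R W \<longleftrightarrow>
     module.subspace (rep_scale R) W \<and> W \<subseteq> rep_space R \<and> (\<forall>g\<in>carrier G. \<forall>w\<in>W. rep_act R g w \<in> W)"

abbreviation subrep :: "('g, 'v) rep \<Rightarrow> 'v set \<Rightarrow> ('g, 'v) rep" where
  "subrep R W \<equiv> R\<lparr>rep_space := W\<rparr>"

definition irreducible_rep :: "('g, 'm) monoid_scheme \<Rightarrow> ('g, 'v::ab_group_add) rep \<Rightarrow> bool" where
  "irreducible_rep G R \<longleftrightarrow>
     representation G R \<and> rep_space R \<noteq> {0} \<and>
     (\<forall>W. invariant_subspace G R W \<longrightarrow> W = {0} \<or> W = rep_space R)"

definition equivalent_reps ::
  "('g, 'm) monoid_scheme \<Rightarrow> ('g, 'v::ab_group_add) rep \<Rightarrow> ('g, 'w::ab_group_add) rep \<Rightarrow> bool" where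
  "equivalent_reps G R S \<longleftrightarrow>
     (\<exists>\<phi>. bij_betw \<phi> (rep_space R) (rep_space S) \<and>
        (\<forall>v\<in>rep_space R. \<forall>w\<in>rep_space R. \<phi> (v + w) = \<phi> v + \<phi> w) \<and>
        (\<forall>c. \<forall>v\<in>rep_space R. \<phi> (rep_scale R c v) = rep_scale S c (\<phi> v)) \<and>
        (\<forall>g\<in>carrier G. \<forall>v\<in>rep_space R. \<phi> (rep_act R g v) = rep_act S g (\<phi> v)))"

text \<open>
  \<open>\<W>\<close> is a decomposition of \<open>R\<close> into an internal direct sum of finitely many irreducible
  subrepresentations. A set of subspaces is enough, also for constituents of higher multiplicity:
  nonzero summands of a direct sum are pairwise distinct as subspaces.
\<close>

definition irreducible_decomposition ::
  "('g, 'm) monoid_scheme \<Rightarrow> ('g, 'v::ab_group_add) rep \<Rightarrow> 'v set set \<Rightarrow> bool" where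
  "irreducible_decomposition G R \<W> \<longleftrightarrow>
     finite \<W> \<and>
     (\<forall>W\<in>\<W>. invariant_subspace G R W \<and> irreducible_rep G (subrep R W)) \<and>
     (\<forall>v\<in>rep_space R. \<exists>!f. f \<in> (\<Pi>\<^sub>E W\<in>\<W>. W) \<and> v = (\<Sum>W\<in>\<W>. f W))"

definition occurs_in ::
  "('g, 'm) monoid_scheme \<Rightarrow> ('g, 'v::ab_group_add) rep \<Rightarrow> ('g, 'w::ab_group_add) rep \<Rightarrow> bool" where
  "occurs_in G T R \<longleftrightarrow>
     (\<exists>\<W>. irreducible_decomposition G R \<W> \<and> (\<exists>W\<in>\<W>. equivalent_reps G T (subrep R W)))"

text \<open>
  The induced representation: functions on \<open>G\<close> that transform under left translations by
  elements of the subgroup \<open>H\<close> through \<open>R\<close>, with \<open>G\<close> acting by right translations. Functions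
  on the carrier of \<open>G\<close> are represented by their extension by zero.
\<close>

definition ind :: "('g, 'v::ab_group_add) rep \<Rightarrow> 'g set \<Rightarrow> ('g, 'm) monoid_scheme \<Rightarrow> ('g, 'g \<Rightarrow> 'v) rep" where
  "ind R H G =
     \<lparr>rep_space = {f. (\<forall>g\<in>carrier G. f g \<in> rep_space R) \<and> (\<forall>g. g \<notin> carrier G \<longrightarrow> f g = 0) \<and>
                  (\<forall>h\<in>H. \<forall>g\<in>carrier G. f (h \<otimes>\<^bsub>G\<^esub> g) = rep_act R h (f g))},
      rep_scale = (\<lambda>c f x. rep_scale R c (f x)),
      rep_act = (\<lambda>g f x. if x \<in> carrier G then f (x \<otimes>\<^bsub>G\<^esub> g) else 0)\<rparr>"

definition one_dim_rep :: "('g \<Rightarrow> complex) \<Rightarrow> ('g, complex) rep" where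
  "one_dim_rep \<xi> = \<lparr>rep_space = UNIV, rep_scale = (*), rep_act = (\<lambda>g z. \<xi> g * z)\<rparr>"


section \<open>Lie algebras of nilpotent matrices and their exponential groups\<close>

text \<open>Square matrices with entries in \<open>'k\<close>, indexed by the finite type \<open>'n\<close>: the type \<open>'k^'n^'n\<close>.\<close>

type_synonym ('k, 'n) sqmat = "(('k, 'n) vec, 'n) vec"

definition mscale :: "'k::field \<Rightarrow> ('k, 'n::finite) sqmat \<Rightarrow> ('k, 'n) sqmat" where
  "mscale c A = (\<chi> i j. c * A $ i $ j)"

global_interpretation mat: vector_space mscale
  by standard (auto simp: mscale_def vec_eq_iff algebra_simps)

definition lie_bracket :: "('k::field, 'n::finite) sqmat \<Rightarrow> ('k, 'n) sqmat \<Rightarrow> ('k, 'n) sqmat" where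
  "lie_bracket x y = x ** y - y ** x"

definition lie_subalgebra :: "('k::field, 'n::finite) sqmat set \<Rightarrow> bool" where
  "lie_subalgebra \<gg> \<longleftrightarrow> mat.subspace \<gg> \<and> (\<forall>x\<in>\<gg>. \<forall>y\<in>\<gg>. lie_bracket x y \<in> \<gg>)"

text \<open>
  The index type is any finite linear order, so the matrices have size \<open>N = CARD('n)\<close>.
\<close>

definition ut :: "('k::field, 'n::{finite,linorder}) sqmat set" where
  "ut = {A. \<forall>i j. j \<le> i \<longrightarrow> A $ i $ j = 0}"

text \<open>
  On \<open>ut\<close> the powers from the \<open>N\<close>-th on vanish, so the exponential series stops there; the
  factorials below are invertible if the characteristic is at least \<open>N\<close>.
\<close>

definition mexp :: "('k::field, 'n::finite) sqmat \<Rightarrow> ('k, 'n) sqmat" where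
  "mexp x = (\<Sum>k<CARD('n). mscale (inverse (of_nat (fact k))) (((**) x ^^ k) (mat 1)))"

definition exp_group :: "('k::field, 'n::finite) sqmat set \<Rightarrow> ('k, 'n) sqmat monoid" where
  "exp_group \<gg> = \<lparr>carrier = mexp ` \<gg>, mult = (**), one = mat 1\<rparr>"


section \<open>Coadjoint orbits\<close>

text \<open>
  Linear forms on \<open>\<gg>\<close> are taken as extensional functions, so that they are determined by their
  values on \<open>\<gg>\<close>.
\<close>

definition dual_space :: "('k::field, 'n::finite) sqmat set \<Rightarrow> (('k, 'n) sqmat \<Rightarrow> 'k) set" where
  "dual_space \<gg> = {l \<in> extensional \<gg>.
     (\<forall>x\<in>\<gg>. \<forall>y\<in>\<gg>. l (x + y) = l x + l y) \<and> (\<forall>c. \<forall>x\<in>\<gg>. l (mscale c x) = c * l x)}"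

definition dual_proj :: "('k::field, 'n::finite) sqmat set \<Rightarrow> (('k, 'n) sqmat \<Rightarrow> 'k) \<Rightarrow> (('k, 'n) sqmat \<Rightarrow> 'k)" where
  "dual_proj \<hh> l = restrict l \<hh>"

definition coadjoint ::
  "('k::field, 'n::finite) sqmat set \<Rightarrow> ('k, 'n) sqmat \<Rightarrow> (('k, 'n) sqmat \<Rightarrow> 'k) \<Rightarrow> (('k, 'n) sqmat \<Rightarrow> 'k)" where
  "coadjoint \<gg> g l = (\<lambda>x\<in>\<gg>. l (matrix_inv g ** x ** g))"

definition coadjoint_orbit ::
  "('k::field, 'n::finite) sqmat set \<Rightarrow> (('k, 'n) sqmat \<Rightarrow> 'k) \<Rightarrow> (('k, 'n) sqmat \<Rightarrow> 'k) set" where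
  "coadjoint_orbit \<gg> l = {coadjoint \<gg> g l | g. g \<in> carrier (exp_group \<gg>)}"

definition coadjoint_orbits :: "('k::field, 'n::finite) sqmat set \<Rightarrow> (('k, 'n) sqmat \<Rightarrow> 'k) set set" where
  "coadjoint_orbits \<gg> = coadjoint_orbit \<gg> ` dual_space \<gg>"


section \<open>Polarizations and the representations attached to linear forms\<close>

definition isotropic_subspace ::
  "('k::field, 'n::finite) sqmat set \<Rightarrow> (('k, 'n) sqmat \<Rightarrow> 'k) \<Rightarrow> ('k, 'n) sqmat set \<Rightarrow> bool" where
  "isotropic_subspace \<gg> l V \<longleftrightarrow>
     mat.subspace V \<and> V \<subseteq> \<gg> \<and> (\<forall>x\<in>V. \<forall>y\<in>V. l (lie_bracket x y) = 0)"

definition polarization ::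
  "('k::field, 'n::finite) sqmat set \<Rightarrow> (('k, 'n) sqmat \<Rightarrow> 'k) \<Rightarrow> ('k, 'n) sqmat set \<Rightarrow> bool" where
  "polarization \<gg> l \<pp> \<longleftrightarrow>
     lie_subalgebra \<pp> \<and> isotropic_subspace \<gg> l \<pp> \<and>
     (\<forall>V. isotropic_subspace \<gg> l V \<longrightarrow> \<pp> \<subseteq> V \<longrightarrow> V = \<pp>)"

definition nontrivial_additive_character :: "('k::field \<Rightarrow> complex) \<Rightarrow> bool" where
  "nontrivial_additive_character e \<longleftrightarrow>
     (\<forall>x. e x \<noteq> 0) \<and> (\<forall>x y. e (x + y) = e x * e y) \<and> (\<exists>x. e x \<noteq> 1)"

definition polarization_character ::
  "('k::field \<Rightarrow> complex) \<Rightarrow> (('k, 'n::finite) sqmat \<Rightarrow> 'k) \<Rightarrow> ('k, 'n) sqmat set \<Rightarrow> ('k, 'n) sqmat \<Rightarrow> complex" where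
  "polarization_character e l \<pp> u = e (l (inv_into \<pp> mexp u))"

definition kirillov_rep ::
  "('k::field \<Rightarrow> complex) \<Rightarrow> ('k, 'n::finite) sqmat set \<Rightarrow> (('k, 'n) sqmat \<Rightarrow> 'k) \<Rightarrow> ('k, 'n) sqmat set \<Rightarrow>
     (('k, 'n) sqmat, ('k, 'n) sqmat \<Rightarrow> complex) rep" where
  "kirillov_rep e \<gg> l \<pp> =
     ind (one_dim_rep (polarization_character e l \<pp>)) (mexp ` \<pp>) (exp_group \<gg>)"

text \<open>
  The representations attached to the orbit \<open>\<Omega>\<close>, for all choices of a form in \<open>\<Omega>\<close> and of a
  polarization; they are equivalent to each other.
\<close>

definition orbit_reps ::
  "('k::field \<Rightarrow> complex) \<Rightarrow> ('k, 'n::finite) sqmat set \<Rightarrow> (('k, 'n) sqmat \<Rightarrow> 'k) set \<Rightarrow>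
     (('k, 'n) sqmat, ('k, 'n) sqmat \<Rightarrow> complex) rep set" where
  "orbit_reps e \<gg> \<Omega> = {kirillov_rep e \<gg> l \<pp> | l \<pp>. l \<in> \<Omega> \<and> polarization \<gg> l \<pp>}"

end

theory Submission
  imports Defs
begin

text \<open>
  Let \<open>T\<close> and \<open>t\<close> be induced from the characters \<open>\<xi>\<^sub>l\<close> of \<open>P\<close> and \<open>\<xi>\<^sub>m\<close> of \<open>Q\<close>. By induction in
  stages and Mackey's double coset argument, there is a nonzero homomorphism from \<open>T\<close> to the
  representation induced by \<open>t\<close> iff for some \<open>u \<in> G\<close> the forms \<open>u l\<close> on \<open>u \<pp> u\<^sup>-\<^sup>1\<close> and \<open>m\<close> on
  \<open>\<qq>\<close> agree on the intersection of these subspaces. In this case they have a common extension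
  \<open>n \<in> \<gg>\<^sup>*\<close>. The orbit of \<open>l\<close> under \<open>P\<close> consists of all forms that agree with \<open>l\<close> on \<open>\<pp>\<close>, and
  similarly for \<open>m\<close>; so \<open>n\<close> is in \<open>\<Omega>\<close> and its restriction to \<open>\<hh>\<close> is in \<open>\<omega>\<close>. Conversely,
  such an \<open>n\<close> gives a suitable \<open>u\<close>. The case \<open>\<hh> = \<gg>\<close>, \<open>m = l\<close> also shows that the endomorphisms
  of \<open>T\<close> are the scalars, since the stabilizer of \<open>l\<close> lies in \<open>P\<close>; hence \<open>T\<close> is irreducible, and
  a nonzero homomorphism makes it a direct summand by Maschke's theorem.
\<close>

section \<open>Matrix algebra and the filtration by diagonals\<close>

text \<open>Three devices carry the steps. The filtration by superdiagonals: \<open>exp\<close>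
  differs from the identity only by terms deeper in it, so statements about \<open>exp\<close>
  become inductions that end at zero after \<open>N\<close> steps. Interpolation: the elements 0,
  ..., N - 1 of the prime field are distinct because p >= N, so a curve of degree below
  \<open>N\<close> is controlled by integer powers of group elements; this is how a product of
  exponentials is brought back into a Lie subalgebra. Counting: the orbit of \<open>l\<close> under
  \<open>P\<close> is identified by comparing cardinalities. Maximality of \<open>\<pp>\<close>
  enters as the equality of \<open>\<pp>\<close> with its orthogonal under B_l. It places the
  stabilizer of \<open>l\<close> in \<open>P\<close> and also makes the \<open>P\<close>-orbit as
  large as the affine space of forms agreeing with \<open>l\<close> on \<open>\<pp>\<close>. The
  character \<open>e\<close> need not be injective, since \<open>K\<close> may be larger than its
  prime field. Mackey's condition on characters still yields an equality of forms, because the sets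
  compared contain with each vector its whole \<open>K\<close>-line.\<close>

lemma matrix_add_rdistrib:
  fixes A B :: "('k::field, 'n::finite) sqmat"
  shows "(A + B) ** C = A ** C + B ** C"
  by (simp add: matrix_matrix_mult_def vec_eq_iff sum.distrib distrib_right)

lemma matrix_minus_left: "(- A) ** B = - (A ** B :: ('k::field, 'n::finite) sqmat)"
  by (simp add: matrix_matrix_mult_def vec_eq_iff sum_negf)

lemma matrix_minus_right: "A ** (- B) = - (A ** B :: ('k::field, 'n::finite) sqmat)"
  by (simp add: matrix_matrix_mult_def vec_eq_iff sum_negf)

lemma matrix_diff_ldistrib: "A ** (B - C) = A ** B - (A ** C :: ('k::field, 'n::finite) sqmat)"
  by (simp only: diff_conv_add_uminus matrix_add_ldistrib matrix_minus_right)

lemma matrix_diff_rdistrib: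
  fixes A B C :: "('k::field, 'n::finite) sqmat"
  shows "(A - B) ** C = A ** C - B ** C"
  by (simp only: diff_conv_add_uminus matrix_add_rdistrib matrix_minus_left)

lemmas matrix_distribs = matrix_add_ldistrib matrix_add_rdistrib matrix_diff_ldistrib
  matrix_diff_rdistrib matrix_minus_left matrix_minus_right

lemma matrix_zero_left [simp]: "0 ** A = (0 :: ('k::field, 'n::finite) sqmat)"
  by (simp add: matrix_matrix_mult_def vec_eq_iff)

lemma matrix_sum_left:
  fixes f :: "'i \<Rightarrow> ('k::field, 'n::finite) sqmat"
  shows "sum f S ** B = (\<Sum>i\<in>S. f i ** B)"
  by (induction S rule: infinite_finite_induct) (simp_all add: matrix_add_rdistrib)

lemma matrix_sum_right: "B ** sum f S = (\<Sum>i\<in>S. B ** f i :: ('k::field, 'n::finite) sqmat)"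
  by (induction S rule: infinite_finite_induct) (simp_all add: matrix_add_ldistrib)

lemma mscale_mult_left: "mscale c A ** B = mscale c (A ** B)"
  by (simp add: mscale_def matrix_matrix_mult_def vec_eq_iff sum_distrib_left mult.assoc)

lemma mscale_mult_right: "A ** mscale c B = mscale c (A ** B)"
  by (simp add: mscale_def matrix_matrix_mult_def vec_eq_iff sum_distrib_left ac_simps)

lemma matrix_inv_eqI:
  fixes A B :: "('k::field, 'n::finite) sqmat"
  assumes "A ** B = mat 1"
  shows "matrix_inv A = B"
proof -
  have BA: "B ** A = mat 1"
    using assms by (simp add: matrix_left_right_inverse)
  define C where "C = matrix_inv A"
  have "A ** C = mat 1 \<and> C ** A = mat 1"
    unfolding C_def matrix_inv_def by (rule someI[of _ B]) (use assms BA in auto)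
  then have "C = C ** (A ** B)" "C ** A = mat 1" by (auto simp: assms)
  then show ?thesis by (simp add: matrix_mul_assoc C_def)
qed

lemma lie_bracket_lin:
  "lie_bracket (x + y) z = lie_bracket x z + lie_bracket y z"
  "lie_bracket x (y + z) = lie_bracket x y + lie_bracket x z"
  "lie_bracket (mscale c x) z = mscale c (lie_bracket x z)"
  "lie_bracket x (mscale c z) = mscale c (lie_bracket x z)"
  "lie_bracket (- x) z = - lie_bracket x z"
  "lie_bracket x x = 0"
  "lie_bracket x z = - lie_bracket z x"
  by (simp_all add: lie_bracket_def matrix_distribs mscale_mult_left mscale_mult_right
      mat.scale_right_diff_distrib)

text \<open>\<open>'n\<close> is only a finite linear order; the position number turns the distance
  from the diagonal into arithmetic.\<close>

definition rk :: "'n::{finite,linorder} \<Rightarrow> nat" where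
  "rk i = card {j. j < i}"

lemma rk_less: "rk (i::'n::{finite,linorder}) < CARD('n)"
  unfolding rk_def by (rule psubset_card_mono) auto

lemma rk_mono: "i < j \<Longrightarrow> rk i < rk (j::'n::{finite,linorder})"
  unfolding rk_def by (rule psubset_card_mono) auto

lemma rk_less_iff: "rk i < rk j \<longleftrightarrow> i < (j::'n::{finite,linorder})"
  by (metis less_asym' linorder_neqE rk_mono less_irrefl)

text \<open>The matrices supported on the \<open>d\<close>-th superdiagonal and beyond:
  \<open>fil 0\<close> is upper triangular, and \<open>fil d\<close> is zero from
  \<open>d = N\<close> on. Adding \<open>d\<close> on the left avoids truncated subtraction.\<close>

definition fil :: "nat \<Rightarrow> ('k::field, 'n::{finite,linorder}) sqmat set" where
  "fil d = {A. \<forall>i j. A $ i $ j \<noteq> 0 \<longrightarrow> rk i + d \<le> rk j}"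

lemma ut_eq_fil: "ut = fil 1"
  unfolding ut_def fil_def by (auto simp: Suc_le_eq rk_less_iff) (meson not_le)+

lemma subspace_fil: "mat.subspace (fil d)"
  unfolding mat.subspace_def fil_def mscale_def
  by auto (metis add.right_neutral)

lemmas fil_zero = mat.subspace_0[OF subspace_fil]
  and fil_add = mat.subspace_add[OF subspace_fil]
  and fil_diff = mat.subspace_diff[OF subspace_fil]
  and fil_neg = mat.subspace_neg[OF subspace_fil]
  and fil_scale = mat.subspace_scale[OF subspace_fil]
  and fil_sum = mat.subspace_sum[OF subspace_fil]

lemma fil_antimono: "d \<le> e \<Longrightarrow> A \<in> fil e \<Longrightarrow> A \<in> fil d"
  unfolding fil_def by force

lemma fil_mult:
  assumes "A \<in> fil d" "B \<in> fil e"
  shows "A ** B \<in> fil (d + e)"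
  unfolding fil_def
proof (clarify)
  fix i j assume "(A ** B) $ i $ j \<noteq> 0"
  then obtain k where "A $ i $ k * B $ k $ j \<noteq> 0"
    unfolding matrix_matrix_mult_def by (auto elim: sum.not_neutral_contains_not_neutral)
  then have "rk i + d \<le> rk k" "rk k + e \<le> rk j" using assms by (auto simp: fil_def)
  then show "rk i + (d + e) \<le> rk j" by simp
qed

lemma mat_1_fil: "mat 1 \<in> fil 0"
  unfolding fil_def mat_def by auto

lemma fil_top:
  fixes A :: "('k::field, 'n::{finite,linorder}) sqmat"
  assumes "A \<in> fil d" "CARD('n) \<le> d"
  shows "A = 0"
proof -
  have "A $ i $ j = 0" for i j
    using assms rk_less[of j] unfolding fil_def by fastforce
  then show ?thesis by (simp add: vec_eq_iff)
qed

section \<open>The exponential map\<close>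

definition mpow :: "('k::field, 'n::finite) sqmat \<Rightarrow> nat \<Rightarrow> ('k, 'n) sqmat" where
  "mpow x k = ((**) x ^^ k) (mat 1)"

text \<open>Divided powers. If the characteristic divides \<open>fact k\<close>, the coefficient is
  \<open>inverse 0 = 0\<close>; when p >= N nothing is lost on \<open>ut\<close>, where
  \<open>mpow x k\<close> vanishes from \<open>k = N\<close> on.\<close>

definition dpow :: "('k::field, 'n::finite) sqmat \<Rightarrow> nat \<Rightarrow> ('k, 'n) sqmat" where
  "dpow x k = mscale (inverse (of_nat (fact k))) (mpow x k)"

lemma mpow_simps [simp]: "mpow x 0 = mat 1" "mpow x (Suc k) = x ** mpow x k"
  by (simp_all add: mpow_def)

lemma mpow_add: "mpow x (i + j) = mpow x i ** mpow x j"
  by (induction i) (simp_all add: matrix_mul_assoc)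

lemma mpow_scale: "mpow (mscale c x) k = mscale (c ^ k) (mpow x k)"
  by (induction k) (simp_all add: mscale_mult_left mscale_mult_right)

lemma mpow_fil: "x \<in> fil d \<Longrightarrow> mpow x k \<in> fil (k * d)"
  by (induction k) (auto simp: mat_1_fil intro: fil_mult)

text \<open>Telescoping: the difference of the next powers is \<open>x\<close> times the previous
  difference plus \<open>x - y\<close> times a power of \<open>y\<close>, and every extra factor
  from \<open>fil 1\<close> gains one step.\<close>

lemma mpow_diff_fil:
  assumes "x \<in> fil 1" "y \<in> fil 1" "x - y \<in> fil m"
  shows "mpow x (Suc k) - mpow y (Suc k) \<in> fil (m + k)"
proof (induction k)
  case 0
  then show ?case using assms by simp
next
  case (Suc k)
  have "mpow x (Suc (Suc k)) - mpow y (Suc (Suc k))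
      = x ** (mpow x (Suc k) - mpow y (Suc k)) + (x - y) ** mpow y (Suc k)"
    by (simp add: matrix_distribs del: mpow_simps) (simp add: matrix_distribs)
  moreover have "x ** (mpow x (Suc k) - mpow y (Suc k)) \<in> fil (m + Suc k)"
    using fil_mult[OF assms(1) Suc] by simp
  moreover have "(x - y) ** mpow y (Suc k) \<in> fil (m + Suc k)"
    using fil_mult[OF assms(3) mpow_fil[OF assms(2), of "Suc k"]] by (simp del: mpow_simps)
  ultimately show ?case by (simp add: fil_add del: mpow_simps)
qed

lemma dpow_0 [simp]: "dpow x 0 = mat 1"
  by (simp add: dpow_def)

lemma dpow_1 [simp]: "dpow x (Suc 0) = x"
  by (simp add: dpow_def)

lemma dpow_scale: "dpow (mscale c x) k = mscale (c ^ k) (dpow x k)"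
  by (simp add: dpow_def mpow_scale mult.commute)

lemma dpow_fil: "x \<in> fil 1 \<Longrightarrow> dpow x k \<in> fil k"
  using mpow_fil[of x 1 k] by (simp add: dpow_def fil_scale)

lemma mexp_eq_dpow: "mexp (x :: ('k::field, 'n::finite) sqmat) = (\<Sum>k<CARD('n). dpow x k)"
  by (simp add: mexp_def dpow_def mpow_def)

lemma mexp_expand:
  fixes x :: "('k::field, 'n::{finite,linorder}) sqmat"
  assumes "x \<in> fil 1"
  shows "mexp x = mat 1 + x + (\<Sum>k<CARD('n) - 1. dpow x (Suc (Suc k)))"
proof -
  obtain M where M: "CARD('n) = Suc M" using zero_less_card_finite gr0_implies_Suc by blast
  \<comment> \<open>The vanishing term of degree \<open>N\<close> is added so that two terms can be
    split off even when \<open>N = 1\<close>.\<close>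
  have "mexp x = (\<Sum>k<Suc (CARD('n)). dpow x k)"
    using fil_top[OF dpow_fil[OF assms], of "CARD('n)"] by (simp add: mexp_eq_dpow)
  also have "\<dots> = dpow x 0 + (dpow x (Suc 0) + (\<Sum>k<M. dpow x (Suc (Suc k))))"
    unfolding M by (simp only: sum.lessThan_Suc_shift)
  finally show ?thesis by (simp add: M add.assoc)
qed

lemma mexp_0 [simp]: "mexp 0 = (mat 1 :: ('k::field, 'n::{finite,linorder}) sqmat)"
proof -
  have "dpow (0 :: ('k, 'n) sqmat) (Suc k) = 0" for k by (simp add: dpow_def)
  then show ?thesis by (subst mexp_expand) (simp_all add: fil_zero)
qed

text \<open>Terms of degree two or more gain a step, so \<open>exp\<close> is the identity to first
  order at every level of the filtration. Injectivity and the iteration for the logarithm both rest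
  on this.\<close>

lemma mexp_diff_fil:
  fixes x y :: "('k::field, 'n::{finite,linorder}) sqmat"
  assumes "x \<in> fil 1" "y \<in> fil 1" "x - y \<in> fil m"
  shows "mexp x - mexp y - (x - y) \<in> fil (Suc m)"
proof -
  have eq: "mexp x - mexp y - (x - y)
      = (\<Sum>k<CARD('n) - 1. dpow x (Suc (Suc k)) - dpow y (Suc (Suc k)))"
    by (simp only: mexp_expand[OF assms(1)] mexp_expand[OF assms(2)] sum_subtractf) (simp add: algebra_simps)
  show ?thesis unfolding eq
  proof (rule fil_sum)
    fix k
    have "mpow x (Suc (Suc k)) - mpow y (Suc (Suc k)) \<in> fil (Suc m)"
      using mpow_diff_fil[OF assms, of "Suc k"] by (rule fil_antimono[rotated]) simp
    from fil_scale[OF this, of "inverse (of_nat (fact (Suc (Suc k))))"]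
    show "dpow x (Suc (Suc k)) - dpow y (Suc (Suc k)) \<in> fil (Suc m)"
      unfolding dpow_def by (simp only: mat.scale_right_diff_distrib)
  qed
qed

text \<open>If \<open>x - y\<close> lies in \<open>fil m\<close>, the first-order estimate puts it
  into \<open>fil (Suc m)\<close>, and finally into \<open>fil N\<close>, which is zero.\<close>

lemma mexp_inj:
  fixes x y :: "('k::field, 'n::{finite,linorder}) sqmat"
  assumes "x \<in> ut" "y \<in> ut" "mexp x = mexp y"
  shows "x = y"
proof -
  have xy: "x \<in> fil 1" "y \<in> fil 1" using assms by (auto simp: ut_eq_fil)
  have "x - y \<in> fil m" for m
  proof (induction m)
    case 0
    have "x - y \<in> fil 1" using xy by (rule fil_diff)
    then show ?case by (rule fil_antimono[rotated]) simp
  next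
    case (Suc m)
    from mexp_diff_fil[OF xy this] have "- (x - y) \<in> fil (Suc m)" using assms(3) by simp
    from fil_neg[OF this] show ?case by simp
  qed
  from fil_top[OF this[of "CARD('n)"]] show ?thesis by simp
qed

text \<open>For Cauchy products of truncated series, whose terms of total degree at least
  \<open>n\<close> vanish by nilpotency.\<close>

lemma sum_triangle:
  fixes h :: "nat \<Rightarrow> nat \<Rightarrow> 'a::comm_monoid_add"
  assumes "\<And>i j. n \<le> i + j \<Longrightarrow> h i j = 0"
  shows "(\<Sum>i<n. \<Sum>j<n. h i j) = (\<Sum>k<n. \<Sum>i\<le>k. h i (k - i))"
proof -
  have "(\<Sum>i<n. \<Sum>j<n. h i j) = (\<Sum>(i,j)\<in>{..<n} \<times> {..<n}. h i j)"
    by (rule sum.cartesian_product)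
  also have "\<dots> = (\<Sum>(i,j)\<in>{(i,j). i + j < n}. h i j)"
    by (rule sum.mono_neutral_right) (auto simp: not_less[symmetric] intro: ccontr assms)
  finally show ?thesis by (simp add: sum.triangle_reindex)
qed

section \<open>Invertible factorials and one-parameter subgroups\<close>

context
  assumes char_ge: "CHAR('k::{field,finite}) \<ge> CARD('n::{finite,linorder})"
begin

lemma CHAR_pos: "CHAR('k) > 0"
  using char_ge zero_less_card_finite[where 'a='n] by linarith

lemma of_nat_fact_neq_0: "k < CARD('n) \<Longrightarrow> (of_nat (fact k) :: 'k) \<noteq> 0"
  using char_ge CHAR_pos prime_dvd_fact_iff[OF prime_CHAR_semidom[where 'a='k], of k]
  by (simp add: of_nat_eq_0_iff_char_dvd)

lemma of_nat_neq_0: "0 < k \<Longrightarrow> k < CARD('n) \<Longrightarrow> (of_nat k :: 'k) \<noteq> 0"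
  using of_nat_fact_neq_0[of k] fact_reduce[of k, where 'a = nat] by (auto simp del: of_nat_fact)

text \<open>Supplies the \<open>N\<close> interpolation points in the prime field: differences of
  two indices lie strictly between 0 and p.\<close>

lemma of_nat_inj_on: "inj_on (of_nat :: nat \<Rightarrow> 'k) {..<CARD('n)}"
proof (rule linorder_inj_onI')
  fix i j assume ij: "i \<in> {..<CARD('n)}" "j \<in> {..<CARD('n)}" "i < j"
  then have "(of_nat (j - i) :: 'k) \<noteq> 0" by (intro of_nat_neq_0) auto
  with ij show "(of_nat i :: 'k) \<noteq> of_nat j" by (simp add: of_nat_diff)
qed

text \<open>Below total degree \<open>N\<close> the factorials are invertible and this is the
  binomial coefficient formula; from \<open>N\<close> on, where division may fail, both sides vanish
  by nilpotency.\<close>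

lemma dpow_mult:
  fixes x :: "('k, 'n) sqmat"
  assumes "x \<in> fil 1"
  shows "dpow x i ** dpow x j = mscale (of_nat ((i + j) choose i)) (dpow x (i + j))"
proof (cases "i + j < CARD('n)")
  case True
  have "of_nat (fact i * fact j * ((i + j) choose i)) = (of_nat (fact (i + j)) :: 'k)"
    using binomial_fact_lemma[of i "i + j"] by simp
  then have "inverse (of_nat (fact i)) * inverse (of_nat (fact j))
      = (of_nat ((i + j) choose i) * inverse (of_nat (fact (i + j))) :: 'k)"
    using of_nat_fact_neq_0[of i] of_nat_fact_neq_0[of j] of_nat_fact_neq_0[of "i + j"] True
    by (simp add: field_simps del: of_nat_fact)
  then show ?thesis
    by (simp add: dpow_def mscale_mult_left mscale_mult_right mpow_add mult.commute
        del: of_nat_fact)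
next
  case False
  then have "dpow x i ** dpow x j = 0" "dpow x (i + j) = 0"
    using fil_top[OF fil_mult[OF dpow_fil[OF assms] dpow_fil[OF assms]], of i j]
      fil_top[OF dpow_fil[OF assms], of "i + j"] by simp_all
  then show ?thesis by simp
qed

lemma dpow_Suc:
  fixes x :: "('k, 'n) sqmat"
  assumes "x \<in> fil 1"
  shows "x ** dpow x k = mscale (of_nat (Suc k)) (dpow x (Suc k))"
    and "dpow x k ** x = mscale (of_nat (Suc k)) (dpow x (Suc k))"
  using dpow_mult[OF assms, of 1 k] dpow_mult[OF assms, of k 1] by simp_all

text \<open>Divided powers of a single matrix multiply by binomial coefficients, so the Cauchy
  product is summed by the binomial theorem.\<close>

lemma mexp_add_scale:
  fixes x :: "('k, 'n) sqmat"
  assumes "x \<in> ut"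
  shows "mexp (mscale s x) ** mexp (mscale t x) = mexp (mscale (s + t) x)"
proof -
  have x: "x \<in> fil 1" using assms by (simp add: ut_eq_fil)
  let ?N = "CARD('n)"
  define h where "h i j = mscale (s ^ i * t ^ j) (dpow x i ** dpow x j)" for i j
  have "h i j = 0" if "?N \<le> i + j" for i j
    using fil_top[OF fil_mult[OF dpow_fil[OF x] dpow_fil[OF x]] that] by (simp add: h_def)
  note tri = sum_triangle[of ?N h, OF this]
  have "mexp (mscale s x) ** mexp (mscale t x) = (\<Sum>i<?N. \<Sum>j<?N. h i j)"
    by (subst sum.swap) (simp add: mexp_eq_dpow matrix_sum_left matrix_sum_right dpow_scale h_def
        mscale_mult_left mscale_mult_right mat.scale_sum_right mult.commute)
  also have "\<dots> = (\<Sum>k<?N. \<Sum>i\<le>k. h i (k - i))" by (rule tri)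
  also have "\<dots> = (\<Sum>k<?N. mscale ((s + t) ^ k) (dpow x k))"
    by (intro sum.cong refl)
      (simp add: h_def dpow_mult[OF x] binomial_ring mat.scale_sum_left ac_simps)
  finally show ?thesis by (simp add: mexp_eq_dpow dpow_scale)
qed

lemma mexp_minus:
  fixes x :: "('k, 'n) sqmat"
  assumes "x \<in> ut"
  shows "mexp x ** mexp (- x) = mat 1" "mexp (- x) ** mexp x = mat 1"
    "matrix_inv (mexp x) = mexp (- x)" "matrix_inv (mexp (- x)) = mexp x"
  using mexp_add_scale[OF assms, of 1 "- 1"] mexp_add_scale[OF assms, of "- 1" 1]
  by (auto intro: matrix_inv_eqI)

end

section \<open>Conjugation by \<open>exp x\<close> as the exponential series of
  \<open>ad x\<close>\<close>

context
  assumes char_ge: "CHAR('k::{field,finite}) \<ge> CARD('n::{finite,linorder})"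
begin

text \<open>The homogeneous components of \<open>exp x y exp (-x)\<close>, i.e. \<open>(ad x)\<^sup>k y / k!\<close>.\<close>

definition ad_term :: "('k, 'n) sqmat \<Rightarrow> ('k, 'n) sqmat \<Rightarrow> nat \<Rightarrow> ('k, 'n) sqmat" where
  "ad_term x y k = (\<Sum>i\<le>k. dpow x i ** y ** dpow (- x) (k - i))"

lemma ad_term_0 [simp]: "ad_term x y 0 = y"
  by (simp add: ad_term_def)

text \<open>Left multiplication by \<open>x\<close> and right multiplication by \<open>- x\<close>
  each raise one of the two divided powers. The term with left exponent \<open>i\<close> thereby
  receives the weights \<open>i\<close> and \<open>k + 1 - i\<close>, whose sum is
  \<open>k + 1\<close> for all terms.\<close>

lemma ad_term_Suc:
  assumes x: "x \<in> fil 1"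
  shows "mscale (of_nat (Suc k)) (ad_term x y (Suc k)) = lie_bracket x (ad_term x y k)"
proof -
  have x': "- x \<in> fil 1" using x by (rule fil_neg)
  define f where "f i j = dpow x i ** y ** dpow (- x) j" for i j
  have f1: "x ** f i j = mscale (of_nat (Suc i)) (f (Suc i) j)" for i j
    using dpow_Suc(1)[OF char_ge x, of i]
    by (simp add: f_def matrix_mul_assoc mscale_mult_left del: of_nat_Suc)
  have f2: "- (f i j ** x) = mscale (of_nat (Suc j)) (f i (Suc j))" for i j
    using dpow_Suc(2)[OF char_ge x', of j]
    by (simp add: f_def matrix_mul_assoc[symmetric] mscale_mult_right matrix_minus_right
        flip: matrix_minus_right del: of_nat_Suc)
  have "lie_bracket x (ad_term x y k)
      = (\<Sum>i\<le>k. mscale (of_nat (Suc i)) (f (Suc i) (k - i)))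
        + (\<Sum>i\<le>k. mscale (of_nat (Suc (k - i))) (f i (Suc (k - i))))"
    unfolding f1[symmetric] f2[symmetric] lie_bracket_def ad_term_def
    by (simp add: matrix_sum_left matrix_sum_right f_def sum_negf)
  also have "(\<Sum>i\<le>k. mscale (of_nat (Suc i)) (f (Suc i) (k - i)))
      = (\<Sum>i\<le>Suc k. mscale (of_nat i) (f i (Suc k - i)))"
    by (simp only: sum.atMost_Suc_shift) simp
  also have "(\<Sum>i\<le>k. mscale (of_nat (Suc (k - i))) (f i (Suc (k - i))))
      = (\<Sum>i\<le>Suc k. mscale (of_nat (Suc k - i)) (f i (Suc k - i)))"
    by (simp add: Suc_diff_le del: of_nat_Suc of_nat_diff)
  also have "(\<Sum>i\<le>Suc k. mscale (of_nat i) (f i (Suc k - i)))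
        + (\<Sum>i\<le>Suc k. mscale (of_nat (Suc k - i)) (f i (Suc k - i)))
      = (\<Sum>i\<le>Suc k. mscale (of_nat (Suc k)) (f i (Suc k - i)))"
    unfolding sum.distrib[symmetric]
    by (intro sum.cong refl)
      (simp only: mat.scale_left_distrib[symmetric] of_nat_add[symmetric] atMost_iff le_add_diff_inverse)
  finally show ?thesis
    by (simp add: ad_term_def f_def mat.scale_sum_right del: of_nat_Suc sum.atMost_Suc)
qed

lemma ad_term_fil: "x \<in> fil 1 \<Longrightarrow> y \<in> fil m \<Longrightarrow> ad_term x y k \<in> fil (m + k)"
  unfolding ad_term_def
proof (rule fil_sum)
  fix i assume "x \<in> fil 1" "y \<in> fil m" "i \<in> {..k}"
  then show "dpow x i ** y ** dpow (- x) (k - i) \<in> fil (m + k)"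
    using fil_mult[OF fil_mult[OF dpow_fil[of x i], of y m] dpow_fil[of "- x" "k - i"]] fil_neg[of x 1]
    by (simp add: ac_simps)
qed

lemma ad_term_bracket:
  assumes "x \<in> fil 1" "Suc k < CARD('n)"
  shows "ad_term x y (Suc k) = mscale (inverse (of_nat (Suc k))) (lie_bracket x (ad_term x y k))"
  using of_nat_neq_0[OF char_ge, of "Suc k"] assms
  by (simp add: ad_term_Suc[symmetric] del: of_nat_Suc)

text \<open>A factor in \<open>fil 0\<close> does not lower the filtration degree, so products of
  total degree at least \<open>N\<close> drop out of the double sum.\<close>

lemma conj_mexp:
  assumes x: "x \<in> fil 1" and y: "y \<in> fil 0"
  shows "mexp x ** y ** mexp (- x) = (\<Sum>k<CARD('n). ad_term x y k)"
proof -
  have "dpow x i ** y ** dpow (- x) j = 0" if "CARD('n) \<le> i + j" for i j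
    using fil_top[OF fil_mult[OF fil_mult[OF dpow_fil[OF x] y] dpow_fil[OF fil_neg[OF x]]], of i j] that
    by simp
  from sum_triangle[of "CARD('n)" "\<lambda>i j. dpow x i ** y ** dpow (- x) j", OF this]
  show ?thesis
    by (simp add: mexp_eq_dpow matrix_sum_left matrix_sum_right ad_term_def) (subst sum.swap, simp)
qed

lemma ad_term_mem:
  assumes x: "x \<in> fil 1" and V: "mat.subspace V" "V \<subseteq> fil 0"
    and br: "\<And>v. v \<in> V \<Longrightarrow> lie_bracket x v \<in> V" and y: "y \<in> V"
  shows "ad_term x y k \<in> V"
proof (induction k)
  case (Suc k)
  show ?case
  proof (cases "Suc k < CARD('n)")
    case True
    then show ?thesis
      using Suc by (simp add: ad_term_bracket[OF x] mat.subspace_scale[OF V(1)] br del: of_nat_Suc)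
  next
    case False
    \<comment> \<open>Here \<open>k + 1\<close> may fail to be invertible, but the component has
      left the filtration.\<close>
    have "ad_term x y (Suc k) = 0"
      by (rule fil_top[OF ad_term_fil[OF x, of y 0]]) (use y V False in auto)
    then show ?thesis by (simp add: mat.subspace_0[OF V(1)])
  qed
qed (simp add: y)

text \<open>Conjugation by \<open>exp x\<close> acts as a polynomial in \<open>ad x\<close>, hence
  preserves every subspace stable under \<open>ad x\<close>.\<close>

lemma conj_mexp_mem:
  fixes x y :: "('k, 'n) sqmat"
  assumes "x \<in> ut" "mat.subspace V" "V \<subseteq> ut"
    and "\<And>v. v \<in> V \<Longrightarrow> lie_bracket x v \<in> V" "y \<in> V"
  shows "mexp x ** y ** mexp (- x) \<in> V"
proof -
  have x: "x \<in> fil 1" and V: "V \<subseteq> fil 0"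
    using assms(1,3) fil_antimono[of 0 "Suc 0"] by (auto simp: ut_eq_fil)
  show ?thesis
    using V assms by (subst conj_mexp[OF x])
      (auto intro!: mat.subspace_sum ad_term_mem[OF x])
qed

lemma mpow_conj:
  fixes g h y :: "('k, 'n) sqmat"
  assumes "h ** g = mat 1"
  shows "mpow (g ** y ** h) k = g ** mpow y k ** h"
proof (induction k)
  case 0
  show ?case using assms matrix_left_right_inverse[of h g] by simp
next
  case (Suc k)
  have "mpow (g ** y ** h) (Suc k) = g ** y ** (h ** g) ** mpow y k ** h"
    by (simp add: Suc matrix_mul_assoc)
  then show ?case by (simp add: assms matrix_mul_assoc)
qed

lemma mexp_conj:
  fixes g h y :: "('k, 'n) sqmat"
  assumes "h ** g = mat 1"
  shows "mexp (g ** y ** h) = g ** mexp y ** h"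
  by (simp add: mexp_eq_dpow dpow_def mpow_conj[OF assms] matrix_sum_left matrix_sum_right
      mscale_mult_left mscale_mult_right)

section \<open>Graded polynomial curves and the logarithm\<close>

text \<open>The filtration keeps the degree below \<open>N\<close>, hence below \<open>p\<close>, so that these polynomial
  curves of order at least \<open>m\<close> are determined by their values on the prime field.\<close>

definition gpol :: "nat \<Rightarrow> ('k \<Rightarrow> ('k, 'n) sqmat) set" where
  "gpol m = {f. \<exists>c. (\<forall>k. c k \<in> fil k) \<and> (\<forall>k<m. c k = 0) \<and>
     (\<forall>t. f t = (\<Sum>k<CARD('n). mscale (t ^ k) (c k)))}"

lemma gpolI:
  "(\<And>k. c k \<in> fil k) \<Longrightarrow> (\<And>k. k < m \<Longrightarrow> c k = 0) \<Longrightarrow>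
    (\<And>t. f t = (\<Sum>k<CARD('n). mscale (t ^ k) (c k))) \<Longrightarrow> f \<in> gpol m"
  unfolding gpol_def by blast

lemma gpolE:
  assumes "f \<in> gpol m"
  obtains c where "\<And>k. c k \<in> fil k" "\<And>k. k < m \<Longrightarrow> c k = 0"
    "\<And>t. f t = (\<Sum>k<CARD('n). mscale (t ^ k) (c k))"
  using assms unfolding gpol_def by blast

lemma gpol_antimono: "m \<le> n \<Longrightarrow> f \<in> gpol n \<Longrightarrow> f \<in> gpol m"
  unfolding gpol_def by force

lemma gpol_zero: "(\<lambda>t. 0) \<in> gpol m"
  by (rule gpolI[of "\<lambda>_. 0"]) (auto simp: fil_zero)

lemma gpol_add:
  assumes "f \<in> gpol m" "g \<in> gpol m"
  shows "(\<lambda>t. f t + g t) \<in> gpol m"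
proof -
  from assms(1) obtain c where c: "\<And>k. c k \<in> fil k" "\<And>k. k < m \<Longrightarrow> c k = 0"
    "\<And>t. f t = (\<Sum>k<CARD('n). mscale (t ^ k) (c k))" by (rule gpolE) blast
  from assms(2) obtain d where d: "\<And>k. d k \<in> fil k" "\<And>k. k < m \<Longrightarrow> d k = 0"
    "\<And>t. g t = (\<Sum>k<CARD('n). mscale (t ^ k) (d k))" by (rule gpolE) blast
  show ?thesis
    by (rule gpolI[of "\<lambda>k. c k + d k"])
      (simp_all add: c d fil_add mat.scale_right_distrib sum.distrib)
qed

lemma gpol_scale:
  assumes "f \<in> gpol m"
  shows "(\<lambda>t. mscale a (f t)) \<in> gpol m"
proof -
  from assms obtain c where c: "\<And>k. c k \<in> fil k" "\<And>k. k < m \<Longrightarrow> c k = 0"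
    "\<And>t. f t = (\<Sum>k<CARD('n). mscale (t ^ k) (c k))" by (rule gpolE) blast
  show ?thesis
    by (rule gpolI[of "\<lambda>k. mscale a (c k)"])
      (simp_all add: c fil_scale mat.scale_sum_right mult.commute)
qed

lemma gpol_neg: "f \<in> gpol m \<Longrightarrow> (\<lambda>t. - f t) \<in> gpol m"
  using gpol_scale[of f m "- 1"] by simp

lemma gpol_diff: "f \<in> gpol m \<Longrightarrow> g \<in> gpol m \<Longrightarrow> (\<lambda>t. f t - g t) \<in> gpol m"
  using gpol_add[of f m "\<lambda>t. - g t"] gpol_neg[of g m] by simp

lemma gpol_sum: "(\<And>i. i \<in> S \<Longrightarrow> f i \<in> gpol m) \<Longrightarrow> (\<lambda>t. \<Sum>i\<in>S. f i t) \<in> gpol m"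
  by (induction S rule: infinite_finite_induct) (auto simp: gpol_zero intro: gpol_add)

text \<open>The grading \<open>c k \<in> fil k\<close> is what keeps the degree below
  \<open>N\<close>: coefficients of the product from degree \<open>N\<close> on lie in
  \<open>fil N\<close>, which is zero.\<close>

lemma gpol_mult:
  assumes "f \<in> gpol m" "g \<in> gpol n"
  shows "(\<lambda>t. f t ** g t) \<in> gpol (m + n)"
proof -
  from assms(1) obtain c where c: "\<And>k. c k \<in> fil k" "\<And>k. k < m \<Longrightarrow> c k = 0"
    "\<And>t. f t = (\<Sum>k<CARD('n). mscale (t ^ k) (c k))" by (rule gpolE) blast
  from assms(2) obtain d where d: "\<And>k. d k \<in> fil k" "\<And>k. k < n \<Longrightarrow> d k = 0"
    "\<And>t. g t = (\<Sum>k<CARD('n). mscale (t ^ k) (d k))" by (rule gpolE) blast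
  show ?thesis
  proof (rule gpolI[of "\<lambda>k. \<Sum>i\<le>k. c i ** d (k - i)"])
    fix k
    show "(\<Sum>i\<le>k. c i ** d (k - i)) \<in> fil k"
    proof (rule fil_sum)
      fix i assume "i \<in> {..k}"
      then show "c i ** d (k - i) \<in> fil k" using fil_mult[OF c(1)[of i] d(1)[of "k - i"]] by simp
    qed
    show "(\<Sum>i\<le>k. c i ** d (k - i)) = 0" if k: "k < m + n"
    proof (rule sum.neutral, rule ballI)
      fix i assume "i \<in> {..k}"
      then have "i < m \<or> k - i < n" using k by auto
      then show "c i ** d (k - i) = 0" using c(2) d(2) by auto
    qed
  next
    fix t
    define h where "h i j = mscale (t ^ (i + j)) (c i ** d j)" for i j
    have "h i j = 0" if "CARD('n) \<le> i + j" for i j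
      using fil_top[OF fil_mult[OF c(1) d(1)] that] by (simp add: h_def)
    note tri = sum_triangle[of "CARD('n)" h, OF this]
    have "f t ** g t = (\<Sum>i<CARD('n). \<Sum>j<CARD('n). h i j)"
      by (subst sum.swap) (simp add: c(3) d(3) matrix_sum_left matrix_sum_right mscale_mult_left
          mscale_mult_right h_def mat.scale_sum_right power_add mult.commute)
    also note tri
    also have "(\<Sum>k<CARD('n). \<Sum>i\<le>k. h i (k - i))
        = (\<Sum>k<CARD('n). mscale (t ^ k) (\<Sum>i\<le>k. c i ** d (k - i)))"
      by (simp add: h_def mat.scale_sum_right)
    finally show "f t ** g t = (\<Sum>k<CARD('n). mscale (t ^ k) (\<Sum>i\<le>k. c i ** d (k - i)))" .
  qed
qed

lemma gpol_const:
  assumes "A \<in> fil 0"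
  shows "(\<lambda>t. A) \<in> gpol 0"
proof (rule gpolI[of "\<lambda>k. if k = 0 then A else 0"])
  fix t :: 'k
  show "A = (\<Sum>k<CARD('n). mscale (t ^ k) (if k = 0 then A else 0))"
    by (subst sum.remove[of _ 0]) auto
qed (use assms in \<open>auto simp: fil_zero\<close>)

lemma gpol_linear:
  assumes "A \<in> fil 1"
  shows "(\<lambda>t. mscale t A) \<in> gpol 1"
proof (rule gpolI[of "\<lambda>k. if k = 1 then A else 0"])
  fix t :: 'k
  show "mscale t A = (\<Sum>k<CARD('n). mscale (t ^ k) (if k = 1 then A else 0))"
  proof (cases "CARD('n) > 1")
    case True
    then show ?thesis by (subst sum.remove[of _ 1]) auto
  next
    case False
    \<comment> \<open>For \<open>N = 1\<close> the index 1 is outside the range of summation, but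
      there is no nonzero strictly upper triangular matrix either.\<close>
    then have "A = 0" using fil_top[OF assms] by simp
    then show ?thesis by (simp only: if_cancel mat.scale_zero_right sum.neutral_const)
  qed
qed (use assms in \<open>auto simp: fil_zero\<close>)

lemma gpol_fil: "f \<in> gpol m \<Longrightarrow> f t \<in> fil m"
proof (elim gpolE)
  fix c assume c: "\<And>k. c k \<in> fil k" "\<And>k. k < m \<Longrightarrow> c k = 0"
    "\<And>t. f t = (\<Sum>k<CARD('n). mscale (t ^ k) (c k))"
  have "c k \<in> fil m" for k
    using c(1,2)[of k] by (cases "k < m") (auto simp: fil_zero intro: fil_antimono[of m k])
  then show "f t \<in> fil m" unfolding c(3) by (intro fil_sum fil_scale)
qed

lemma gpol_dpow: "f \<in> gpol 1 \<Longrightarrow> (\<lambda>t. dpow (f t) k) \<in> gpol k"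
proof -
  assume f: "f \<in> gpol 1"
  have "(\<lambda>t. mpow (f t) k) \<in> gpol k"
    by (induction k) (use gpol_mult[OF f] in \<open>auto simp: gpol_const mat_1_fil\<close>)
  then show ?thesis unfolding dpow_def by (rule gpol_scale)
qed

lemma gpol_mexp:
  assumes f: "f \<in> gpol 1"
  shows "(\<lambda>t. mexp (f t) - mat 1 - f t) \<in> gpol 2"
proof -
  have "mexp (f t) - mat 1 - f t = (\<Sum>k<CARD('n) - 1. dpow (f t) (Suc (Suc k)))" for t
    using gpol_fil[OF f, of t] by (simp add: mexp_expand)
  moreover have "(\<lambda>t. dpow (f t) (Suc (Suc k))) \<in> gpol 2" for k
    by (rule gpol_antimono[OF _ gpol_dpow[OF f]]) simp
  ultimately show ?thesis by (simp only: gpol_sum)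
qed

text \<open>The logarithm of the curve is found by Newton-like iteration \<open>z \<mapsto> z + (f - exp z)\<close>,
  which gains one step of the filtration each time.\<close>

lemma gpol_log:
  assumes f: "(\<lambda>t. f t - mat 1) \<in> gpol 1"
  obtains z where "z \<in> gpol 1" "(\<lambda>t. f t - mat 1 - z t) \<in> gpol 2" "\<And>t. mexp (z t) = f t"
proof -
  \<comment> \<open>The middle condition records that the logarithm has the same linear coefficient
    as \<open>f - 1\<close>. It survives the iteration because every correction starts in degree
    two.\<close>
  have "\<exists>z. z \<in> gpol 1 \<and> (\<lambda>t. f t - mat 1 - z t) \<in> gpol 2 \<and> (\<forall>t. f t - mexp (z t) \<in> fil m)" for m
  proof (induction m)
    case 0
    have "f t - mexp (f t - mat 1) \<in> fil 0" for t
      using gpol_fil[OF gpol_mexp[OF f], of t]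
      by (metis (no_types, lifting) add_diff_cancel_left' diff_diff_add fil_antimono fil_neg
          minus_diff_eq zero_le)
    then show ?case using f by (intro exI[of _ "\<lambda>t. f t - mat 1"]) (auto simp: gpol_zero)
  next
    case (Suc m)
    then obtain z where z: "z \<in> gpol 1" "(\<lambda>t. f t - mat 1 - z t) \<in> gpol 2"
      "\<And>t. f t - mexp (z t) \<in> fil m" by blast
    define r where "r t = f t - mexp (z t)" for t
    have "(\<lambda>t. (f t - mat 1 - z t) - (mexp (z t) - mat 1 - z t)) \<in> gpol 2"
      by (rule gpol_diff[OF z(2) gpol_mexp[OF z(1)]])
    then have r: "r \<in> gpol 2" by (simp add: r_def[abs_def])
    have z': "(\<lambda>t. z t + r t) \<in> gpol 1"
      by (intro gpol_add z gpol_antimono[OF _ r]) simp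
    have "(\<lambda>t. f t - mat 1 - (z t + r t)) \<in> gpol 2"
      using gpol_diff[OF z(2) r] by (simp only: diff_diff_add add.assoc)
    moreover have "f t - mexp (z t + r t) \<in> fil (Suc m)" for t
    proof -
      have "(z t + r t) - z t \<in> fil m" using z(3) by (simp add: r_def)
      from mexp_diff_fil[OF gpol_fil[OF z'] gpol_fil[OF z(1)] this]
      have "mexp (z t + r t) - f t \<in> fil (Suc m)" by (simp add: r_def)
      from fil_neg[OF this] show ?thesis by simp
    qed
    ultimately show ?case using z'
      by (intro exI[of _ "\<lambda>t. z t + r t"]) blast
  qed
  then obtain z where z: "z \<in> gpol 1" "(\<lambda>t. f t - mat 1 - z t) \<in> gpol 2"
    "\<And>t. f t - mexp (z t) \<in> fil CARD('n)" by blast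
  have "mexp (z t) = f t" for t using fil_top[OF z(3)[of t]] by simp
  with z that show ?thesis by blast
qed

text \<open>\<open>A\<close> is the value at \<open>t = 1\<close> of the line
  \<open>1 + t (A - 1)\<close>, whose logarithm is a curve in \<open>ut\<close>.\<close>

lemma mexp_surj:
  assumes "A - mat 1 \<in> fil 1"
  obtains x where "x \<in> ut" "mexp x = (A :: ('k, 'n) sqmat)"
proof -
  have "(\<lambda>t. (mat 1 + mscale t (A - mat 1)) - mat 1) \<in> gpol 1"
    using gpol_linear[OF assms] by simp
  then obtain z where z: "z \<in> gpol 1" "\<And>t. mexp (z t) = mat 1 + mscale t (A - mat 1)"
    by (rule gpol_log) blast
  show ?thesis by (rule that[of "z 1"]) (use gpol_fil[OF z(1)] z(2)[of 1] in \<open>auto simp: ut_eq_fil\<close>)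
qed

end

section \<open>Linear forms on subspaces\<close>

text \<open>Linearity without the extensionality of \<open>dual_space\<close>, so that one function
  can serve as a form on several subspaces.\<close>

definition lin_on :: "('k::field, 'n::finite) sqmat set \<Rightarrow> (('k, 'n) sqmat \<Rightarrow> 'k) \<Rightarrow> bool" where
  "lin_on V l \<longleftrightarrow> (\<forall>x\<in>V. \<forall>y\<in>V. l (x + y) = l x + l y) \<and> (\<forall>c. \<forall>x\<in>V. l (mscale c x) = c * l x)"

lemma lin_onD:
  assumes "lin_on V l"
  shows "x \<in> V \<Longrightarrow> y \<in> V \<Longrightarrow> l (x + y) = l x + l y"
    and "x \<in> V \<Longrightarrow> l (mscale c x) = c * l x"
  using assms by (auto simp: lin_on_def)

lemma lin_on_more:
  assumes "lin_on V l" "mat.subspace V"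
  shows "l 0 = 0" and "x \<in> V \<Longrightarrow> l (- x) = - l x"
    and "x \<in> V \<Longrightarrow> y \<in> V \<Longrightarrow> l (x - y) = l x - l y"
proof -
  show "l 0 = 0" using lin_onD(2)[OF assms(1), of 0 0] mat.subspace_0[OF assms(2)] by simp
  show neg: "l (- x) = - l x" if "x \<in> V" for x
    using lin_onD(2)[OF assms(1) that, of "- 1"] by simp
  show "l (x - y) = l x - l y" if "x \<in> V" "y \<in> V"
    using lin_onD(1)[OF assms(1) that(1) mat.subspace_neg[OF assms(2) that(2)]] neg[OF that(2)] by simp
qed

lemma lin_on_sum:
  assumes "lin_on V l" "mat.subspace V" "\<And>i. i \<in> S \<Longrightarrow> f i \<in> V"
  shows "l (sum f S) = (\<Sum>i\<in>S. l (f i))"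
  using assms(3)
  by (induction S rule: infinite_finite_induct)
    (auto simp: lin_on_more[OF assms(1,2)] lin_onD[OF assms(1)] mat.subspace_sum[OF assms(2)])

lemma lin_on_subset: "lin_on V l \<Longrightarrow> W \<subseteq> V \<Longrightarrow> lin_on W l"
  unfolding lin_on_def by blast

lemma subspace_kernel:
  assumes "lin_on V l" "mat.subspace V"
  shows "mat.subspace {y \<in> V. l y = 0}"
  using assms lin_on_more(1)[OF assms] unfolding mat.subspace_def lin_on_def by auto

lemma separating_form:
  fixes x :: "('k::field, 'n::finite) sqmat"
  assumes W: "mat.subspace W" and x: "x \<notin> W"
  obtains l where "lin_on UNIV l" "\<And>w. w \<in> W \<Longrightarrow> l w = 0" "l x = 1"
proof -
  interpret vector_space_pair "mscale :: 'k \<Rightarrow> ('k, 'n) sqmat \<Rightarrow> _" "(*) :: 'k \<Rightarrow> 'k \<Rightarrow> 'k"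
    by unfold_locales (auto simp: algebra_simps)
  obtain B where B: "B \<subseteq> W" "mat.independent B" "W \<subseteq> mat.span B"
    by (rule mat.maximal_independent_subset)
  have sp: "mat.span B = W" using B W by (meson mat.span_minimal subset_antisym)
  then have "mat.independent (insert x B)" using x B by (simp add: mat.independent_insert)
  from linear_independent_extend[OF this, of "\<lambda>y. if y = x then 1 else 0"]
  obtain l where l: "Vector_Spaces.linear mscale (*) l"
    "\<And>y. y \<in> insert x B \<Longrightarrow> l y = (if y = x then 1 else 0)" by blast
  have "l w = 0" if "w \<in> W" for w
  proof (rule linear_eq_0_on_span[OF l(1)])
    show "w \<in> mat.span B" using that sp by simp
    show "l b = 0" if "b \<in> B" for b using l(2)[of b] that x B(1) by auto
  qed
  moreover have "lin_on UNIV l" using l(1) by (simp add: lin_on_def linear_add linear_scale)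
  ultimately show ?thesis using that l(2)[of x] by auto
qed

text \<open>\<open>l\<close> is composed with a linear projection onto \<open>W\<close>.\<close>

lemma extend_form:
  fixes l :: "('k::field, 'n::finite) sqmat \<Rightarrow> 'k"
  assumes W: "mat.subspace W" and l: "lin_on W l"
  obtains l' where "lin_on UNIV l'" "\<And>w. w \<in> W \<Longrightarrow> l' w = l w"
proof -
  interpret vector_space_pair "mscale :: 'k \<Rightarrow> ('k, 'n) sqmat \<Rightarrow> _" "mscale :: 'k \<Rightarrow> ('k, 'n) sqmat \<Rightarrow> _"
    by unfold_locales
  obtain g :: "('k, 'n) sqmat \<Rightarrow> ('k, 'n) sqmat" where g: "range g \<subseteq> W"
    "Vector_Spaces.linear mscale mscale g" "\<And>v. v \<in> W \<Longrightarrow> g v = v"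
    using linear_exists_left_inverse_on[OF mat.linear_id W] by auto
  have "lin_on UNIV (\<lambda>x. l (g x))"
    unfolding lin_on_def using g(1) lin_onD[OF l]
    by (auto simp: linear_add[OF g(2)] linear_scale[OF g(2)] image_subset_iff)
  then show ?thesis using that[of "\<lambda>x. l (g x)"] g(3) by simp
qed

section \<open>Exponentials of Lie subalgebras are groups\<close>

definition exp_closed :: "('k::field, 'n::finite) sqmat set \<Rightarrow> bool" where
  "exp_closed V \<longleftrightarrow> (\<forall>y\<in>V. \<forall>z\<in>V. \<exists>w\<in>V. mexp y ** mexp z = mexp w)"

context
  assumes char_ge: "CHAR('k::{field,finite}) \<ge> CARD('n::{finite,linorder})"
begin

text \<open>If \<open>A\<close> were outside \<open>V\<close>, a form vanishing on \<open>V\<close>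
  with value 1 at \<open>A\<close> would turn the curve into a polynomial of degree below
  \<open>N\<close>. It has the \<open>N\<close> roots 0, ..., N - 1, although its linear coefficient
  is 1.\<close>

lemma gpol_linear_coeff_mem:
  fixes A :: "('k, 'n) sqmat"
  assumes V: "mat.subspace V" and mem: "\<And>n. f (of_nat n) \<in> V"
    and A: "A \<in> fil 1" and f: "(\<lambda>t. f t - mscale t A) \<in> gpol 2"
  shows "A \<in> V"
proof (rule ccontr)
  assume notin: "A \<notin> V"
  then have "A \<noteq> 0" using mat.subspace_0[OF V] by auto
  then have N: "1 < CARD('n)" using fil_top[OF A] by (meson not_le)
  obtain l where l: "lin_on UNIV l" "\<And>v. v \<in> V \<Longrightarrow> l v = 0" "l A = 1"
    by (rule separating_form[OF V notin]) blast
  obtain d where d: "\<And>k. k < 2 \<Longrightarrow> d k = 0"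
    "\<And>t. f t - mscale t A = (\<Sum>k<CARD('n). mscale (t ^ k) (d k))"
    by (rule gpolE[OF char_ge f]) blast
  define c where "c k = l (d k) + (if k = 1 then 1 else 0)" for k
  define P where "P = (\<Sum>k<CARD('n). monom (c k) k)"
  have l_f: "l (f t) = poly P t" for t
  proof -
    have "f t = (\<Sum>k<CARD('n). mscale (t ^ k) (d k)) + mscale t A"
      using d(2)[of t] by (simp add: algebra_simps)
    then have "l (f t) = (\<Sum>k<CARD('n). t ^ k * l (d k)) + t"
      by (simp add: lin_onD[OF l(1)] lin_on_sum[OF l(1)] l(3))
    moreover have "(\<Sum>k<CARD('n). t ^ k * (if k = 1 then 1 else 0)) = t"
      using N by (subst sum.remove[of _ 1]) auto
    ultimately show ?thesis
      by (simp add: P_def poly_sum poly_monom c_def ring_distribs sum.distrib mult.commute)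
  qed
  have roots: "of_nat ` {..<CARD('n)} \<subseteq> {t. poly P t = 0}"
    using l(2)[OF mem] by (auto simp: l_f)
  have cf: "coeff P k = (if k < CARD('n) then c k else 0)" for k
    by (simp add: P_def coeff_sum)
  have deg: "degree P < CARD('n)"
    by (rule degree_lessI) (use cf in auto)
  have "P = 0"
  proof (rule ccontr)
    assume "P \<noteq> 0"
    then have "card {t. poly P t = 0} \<le> degree P" "finite {t. poly P t = 0}"
      by (auto simp: card_poly_roots_bound poly_roots_finite)
    then have "card (of_nat ` {..<CARD('n)} :: 'k set) \<le> degree P"
      using card_mono[OF _ roots] by linarith
    then show False using deg card_image[OF of_nat_inj_on[OF char_ge]] by simp
  qed
  then have "c 1 = 0" using cf[of 1] N by simp
  moreover have "l 0 = 0" by (rule lin_on_more(1)[OF l(1) mat.subspace_UNIV])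
  ultimately show False using d(1)[of 1] by (simp add: c_def)
qed

lemma mexp_minus_1_fil: "x \<in> ut \<Longrightarrow> mexp x - mat 1 \<in> (fil 1 :: ('k, 'n) sqmat set)"
proof -
  assume "x \<in> ut"
  then have x: "x \<in> fil 1" by (simp add: ut_eq_fil)
  have "mexp x - mat 1 - x \<in> fil 1"
    using mexp_diff_fil[OF x fil_zero, of 1] x by (intro fil_antimono[of 1 2]) (auto simp: numeral_2_eq_2)
  from fil_add[OF this x] show ?thesis by simp
qed

lemma mexp_mult_ut:
  fixes x y :: "('k, 'n) sqmat"
  assumes "x \<in> ut" "y \<in> ut"
  obtains a where "a \<in> ut" "mexp a = mexp x ** mexp y"
proof -
  have "mexp x ** mexp y - mat 1
      = (mexp x - mat 1) + (mexp y - mat 1) + (mexp x - mat 1) ** (mexp y - mat 1)"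
    by (simp add: matrix_distribs)
  moreover have "(mexp x - mat 1) ** (mexp y - mat 1) \<in> fil 1"
    using fil_mult[OF mexp_minus_1_fil mexp_minus_1_fil, OF assms] by (rule fil_antimono[rotated]) simp
  ultimately have "mexp x ** mexp y - mat 1 \<in> fil 1"
    using mexp_minus_1_fil[OF assms(1)] mexp_minus_1_fil[OF assms(2)] by (simp only: fil_add)
  then show ?thesis by (rule mexp_surj[OF char_ge]) (rule that)
qed

text \<open>If \<open>exp a = exp y exp x\<close>, then \<open>exp (n a) exp (- n x) \<in> exp V\<close> for all natural numbers \<open>n\<close>.
  The logarithm of the left hand side is a polynomial of degree less than \<open>p\<close> in \<open>n\<close> with values
  in \<open>V\<close>, so its linear coefficient \<open>a - x\<close> is in \<open>V\<close>. This replaces the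
  Baker-Campbell-Hausdorff formula.\<close>

lemma mexp_mult_normalizer:
  fixes x :: "('k, 'n) sqmat"
  assumes V: "mat.subspace V" "V \<subseteq> ut" "exp_closed V" and x: "x \<in> ut"
    and br: "\<And>v. v \<in> V \<Longrightarrow> lie_bracket x v \<in> V" and y: "y \<in> V"
  obtains y' where "y' \<in> V" "mexp y ** mexp x = mexp (x + y')"
proof -
  obtain a where a: "a \<in> ut" "mexp a = mexp y ** mexp x"
    using mexp_mult_ut[of y x] x y V(2) by blast
  have x': "- x \<in> ut" using x by (simp add: ut_eq_fil fil_neg)
  have fil: "a \<in> fil 1" "- x \<in> fil 1" "x \<in> fil 1" using a x x' by (simp_all add: ut_eq_fil)
  define f where "f t = mexp (mscale t a) ** mexp (mscale t (- x))" for t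
  have pow: "f (of_nat n) \<in> mexp ` V" for n
  proof (induction n)
    case 0
    show ?case using mat.subspace_0[OF V(1)] by (auto simp: f_def intro!: image_eqI[of _ _ 0])
  next
    case (Suc n)
    then obtain w where w: "w \<in> V" "f (of_nat n) = mexp w" by blast
    have "mexp (mscale (of_nat (Suc n)) a) = mexp a ** mexp (mscale (of_nat n) a)"
      and "mexp (mscale (of_nat (Suc n)) (- x)) = mexp (mscale (of_nat n) (- x)) ** mexp (- x)"
      using mexp_add_scale[OF char_ge a(1), of 1 "of_nat n"]
        mexp_add_scale[OF char_ge x', of "of_nat n" 1] by (simp_all add: add.commute)
    \<comment> \<open>One factor \<open>exp a = exp y exp x\<close> is split off on the left and one
      \<open>exp (- x)\<close> on the right. So \<open>f n\<close> gets conjugated by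
      \<open>exp x\<close>, which preserves \<open>exp V\<close>, and then multiplied by an element
      of \<open>exp V\<close>.\<close>
    then have "f (of_nat (Suc n)) = mexp y ** (mexp x ** mexp w ** mexp (- x))"
      unfolding f_def w(2)[symmetric] by (simp only: a(2) matrix_mul_assoc)
    also have "mexp x ** mexp w ** mexp (- x) = mexp (mexp x ** w ** mexp (- x))"
      by (rule mexp_conj[OF char_ge mexp_minus(2)[OF char_ge x], symmetric])
    finally show ?case
      using V(3) y conj_mexp_mem[OF char_ge x V(1,2) br w(1)] by (fastforce simp: exp_closed_def)
  qed
  define u where "u t = mexp (mscale t a) - mat 1" for t
  define v where "v t = mexp (mscale t (- x)) - mat 1" for t
  have u2: "(\<lambda>t. u t - mscale t a) \<in> gpol 2" and v2: "(\<lambda>t. v t - mscale t (- x)) \<in> gpol 2"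
    unfolding u_def v_def by (intro gpol_mexp gpol_linear char_ge fil)+
  have uv: "u \<in> gpol 1" "v \<in> gpol 1"
    using gpol_add[OF char_ge gpol_antimono[OF char_ge _ u2] gpol_linear[OF char_ge fil(1)]]
      gpol_add[OF char_ge gpol_antimono[OF char_ge _ v2] gpol_linear[OF char_ge fil(2)]] by simp_all
  have uv2: "(\<lambda>t. u t ** v t) \<in> gpol 2" using gpol_mult[OF char_ge uv] by (simp add: numeral_2_eq_2)
  have f_eq: "f t - mat 1 = u t + v t + u t ** v t" for t
    by (simp add: f_def u_def v_def matrix_distribs)
  have f1: "(\<lambda>t. f t - mat 1) \<in> gpol 1"
    unfolding f_eq by (intro gpol_add char_ge uv gpol_antimono[OF char_ge _ uv2]) simp
  \<comment> \<open>The product \<open>u v\<close> starts in degree two, so the linear coefficient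
    of \<open>f - 1\<close>, and with it that of the logarithm, is \<open>a - x\<close>.\<close>
  have "(\<lambda>t. (u t - mscale t a) + (v t - mscale t (- x)) + u t ** v t) \<in> gpol 2"
    by (intro gpol_add char_ge u2 v2 uv2)
  then have f2: "(\<lambda>t. f t - mat 1 - mscale t (a - x)) \<in> gpol 2"
    unfolding f_eq by (simp add: algebra_simps mat.scale_right_diff_distrib)
  obtain z where z: "z \<in> gpol 1" "(\<lambda>t. f t - mat 1 - z t) \<in> gpol 2" "\<And>t. mexp (z t) = f t"
    by (rule gpol_log[OF char_ge f1]) blast
  have z2: "(\<lambda>t. z t - mscale t (a - x)) \<in> gpol 2"
    using gpol_diff[OF char_ge f2 z(2)] by (simp add: algebra_simps)
  have "z (of_nat n) \<in> V" for n
  proof -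
    obtain w where "w \<in> V" "mexp w = mexp (z (of_nat n))" using pow[of n] z(3) by auto
    then show ?thesis
      using mexp_inj[of w "z (of_nat n)"] gpol_fil[OF char_ge z(1)] V(2) by (auto simp: ut_eq_fil)
  qed
  then have "a - x \<in> V"
    by (rule gpol_linear_coeff_mem[OF V(1) _ _ z2]) (use fil in \<open>simp add: fil_diff\<close>)
  then show ?thesis using a(2) by (intro that[of "a - x"]) auto
qed

text \<open>The converse factorization by finiteness: the map sending \<open>y\<close> to the
  \<open>y'\<close> of \<open>mexp_mult_normalizer\<close> is injective on the finite set
  \<open>V\<close>, hence onto \<open>V\<close>.\<close>

lemma mexp_add_normalizer:
  fixes x :: "('k, 'n) sqmat"
  assumes V: "mat.subspace V" "V \<subseteq> ut" "exp_closed V" and x: "x \<in> ut"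
    and br: "\<And>v. v \<in> V \<Longrightarrow> lie_bracket x v \<in> V" and y: "y \<in> V"
  obtains y' where "y' \<in> V" "mexp (x + y) = mexp y' ** mexp x"
proof -
  have "\<exists>y'\<in>V. mexp y ** mexp x = mexp (x + y')" if "y \<in> V" for y
    using mexp_mult_normalizer[OF V x br that] by metis
  then obtain \<phi> where \<phi>: "\<And>y. y \<in> V \<Longrightarrow> \<phi> y \<in> V \<and> mexp y ** mexp x = mexp (x + \<phi> y)" by metis
  have "inj_on \<phi> V"
  proof (rule inj_onI)
    fix y z assume yz: "y \<in> V" "z \<in> V" "\<phi> y = \<phi> z"
    then have "mexp y ** mexp x ** mexp (- x) = mexp z ** mexp x ** mexp (- x)" using \<phi> by metis
    then have "mexp y = mexp z"
      by (simp add: matrix_mul_assoc[symmetric] mexp_minus(1)[OF char_ge x])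
    with yz V(2) show "y = z" by (auto intro: mexp_inj[of y z])
  qed
  then have "\<phi> ` V = V" using \<phi> by (intro endo_inj_surj) auto
  then obtain y' where "y' \<in> V" "\<phi> y' = y" using y by (metis imageE)
  then show ?thesis using \<phi>[of y'] that by metis
qed

text \<open>The kernel \<open>V\<close> of \<open>l\<close> is normalized by \<open>\<gg>\<close>,
  as \<open>l\<close> kills brackets. With \<open>l x = 1\<close>, each \<open>exp c\<close> factors
  into an element of \<open>exp V\<close> and \<open>exp (l c x)\<close>. In a product of two such
  factorizations the middle factor from \<open>exp V\<close> is conjugated to the left, and the
  parameters on the line through \<open>x\<close> add up.\<close>

lemma exp_mult_hyperplane:
  fixes \<gg> :: "('k, 'n) sqmat set"
  assumes g: "lie_subalgebra \<gg>" "\<gg> \<subseteq> ut" and l: "lin_on \<gg> l"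
    and br: "\<And>x y. x \<in> \<gg> \<Longrightarrow> y \<in> \<gg> \<Longrightarrow> l (lie_bracket x y) = 0"
    and cl: "exp_closed {y \<in> \<gg>. l y = 0}" and ab: "a \<in> \<gg>" "b \<in> \<gg>"
  shows "\<exists>c\<in>\<gg>. mexp a ** mexp b = mexp c \<and> l c = l a + l b"
proof (cases "\<forall>x\<in>\<gg>. l x = 0")
  case True
  then have "{y \<in> \<gg>. l y = 0} = \<gg>" by auto
  then show ?thesis using cl ab True by (auto simp: exp_closed_def)
next
  case False
  have sg: "mat.subspace \<gg>" using g by (simp add: lie_subalgebra_def)
  let ?V = "{y \<in> \<gg>. l y = 0}"
  have V: "mat.subspace ?V" "?V \<subseteq> ut" "exp_closed ?V"
    using subspace_kernel[OF l sg] g(2) cl by auto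
  from False obtain x0 where x0: "x0 \<in> \<gg>" "l x0 \<noteq> 0" by blast
  \<comment> \<open>Normalized so that \<open>mscale s x\<close> has \<open>l\<close>-value exactly
    \<open>s\<close>.\<close>
  define x where "x = mscale (inverse (l x0)) x0"
  have x: "x \<in> \<gg>" "l x = 1"
    using x0 lin_onD(2)[OF l, of x0] by (simp_all add: x_def mat.subspace_scale[OF sg])
  have sx: "mscale s x \<in> \<gg>" "mscale s x \<in> ut" "l (mscale s x) = s" for s
    using x g(2) lin_onD(2)[OF l x(1)] mat.subspace_scale[OF sg x(1)] by auto
  have nrm: "lie_bracket (mscale s x) v \<in> ?V" if "v \<in> ?V" for s v
    using that sx br g(1) by (auto simp: lie_subalgebra_def)
  have dec: "\<exists>y'\<in>?V. mexp c = mexp y' ** mexp (mscale (l c) x)" if "c \<in> \<gg>" for c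
  proof -
    have "c - mscale (l c) x \<in> ?V"
      using that sx by (simp add: mat.subspace_diff[OF sg] lin_on_more[OF l sg])
    from mexp_add_normalizer[OF V sx(2) nrm this, of "l c"]
    obtain y' where "y' \<in> ?V" "mexp (mscale (l c) x + (c - mscale (l c) x)) = mexp y' ** mexp (mscale (l c) x)"
      by blast
    then show ?thesis by auto
  qed
  obtain y1 y2 where y: "y1 \<in> ?V" "mexp a = mexp y1 ** mexp (mscale (l a) x)"
    "y2 \<in> ?V" "mexp b = mexp y2 ** mexp (mscale (l b) x)"
    using dec[OF ab(1)] dec[OF ab(2)] by blast
  let ?s = "mscale (l a) x"
  have y2': "mexp ?s ** y2 ** mexp (- ?s) \<in> ?V" (is "?y \<in> _")
    by (rule conj_mexp_mem[OF char_ge sx(2) V(1,2) nrm y(3)])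
  have cancel: "mexp (- ?s) ** (mexp ?s ** Z) = Z" for Z
    by (simp add: matrix_mul_assoc mexp_minus(2)[OF char_ge sx(2)])
  have "mexp a ** mexp b = mexp y1 ** (mexp ?s ** mexp y2 ** mexp (- ?s)) ** (mexp ?s ** mexp (mscale (l b) x))"
    by (simp only: y(2,4) matrix_mul_assoc[symmetric] cancel)
  also have "mexp ?s ** mexp y2 ** mexp (- ?s) = mexp ?y"
    by (rule mexp_conj[OF char_ge mexp_minus(2)[OF char_ge sx(2)], symmetric])
  also have "mexp ?s ** mexp (mscale (l b) x) = mexp (mscale (l a + l b) x)"
    using x(1) g(2) by (intro mexp_add_scale char_ge) auto
  finally have ab: "mexp a ** mexp b = mexp y1 ** mexp ?y ** mexp (mscale (l a + l b) x)" .
  obtain y3 where y3: "y3 \<in> ?V" "mexp y1 ** mexp ?y = mexp y3"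
    using V(3) y(1) y2' unfolding exp_closed_def by blast
  obtain y4 where y4: "y4 \<in> ?V"
    "mexp y3 ** mexp (mscale (l a + l b) x) = mexp (mscale (l a + l b) x + y4)"
    by (rule mexp_mult_normalizer[OF V sx(2) nrm y3(1)])
  have "mscale (l a + l b) x + y4 \<in> \<gg> \<and> l (mscale (l a + l b) x + y4) = l a + l b"
    using y4(1) sx mat.subspace_add[OF sg] by (simp add: lin_onD(1)[OF l])
  moreover have "mexp a ** mexp b = mexp (mscale (l a + l b) x + y4)" using ab y3 y4 by simp
  ultimately show ?thesis by blast
qed

text \<open>Induction through a subalgebra of codimension one. If \<open>m\<close> is the deepest
  level containing \<open>\<gg>\<close>, brackets lie in \<open>fil (2 m)\<close>, hence in
  \<open>fil (m + 1)\<close> as \<open>m \<ge> 1\<close>. So a form vanishing on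
  \<open>fil (m + 1)\<close> but not on \<open>\<gg>\<close> kills all brackets, and its kernel is a
  smaller subalgebra.\<close>

theorem lie_subalgebra_exp_closed:
  fixes \<gg> :: "('k, 'n) sqmat set"
  shows "lie_subalgebra \<gg> \<Longrightarrow> \<gg> \<subseteq> ut \<Longrightarrow> exp_closed \<gg>"
proof (induction "card \<gg>" arbitrary: \<gg> rule: less_induct)
  case less
  have sg: "mat.subspace \<gg>" using less.prems by (simp add: lie_subalgebra_def)
  show ?case
  proof (cases "\<gg> = {0}")
    case True
    then show ?thesis by (simp add: exp_closed_def)
  next
    case False
    \<comment> \<open>The least level where the next inclusion fails is the largest \<open>m\<close>
      with \<open>\<gg> \<subseteq> fil m\<close>.\<close>
    define m where "m = (LEAST m. \<not> \<gg> \<subseteq> fil (Suc m))"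
    have ex: "\<not> \<gg> \<subseteq> fil (Suc CARD('n))"
      using False fil_top[of _ "Suc CARD('n)"] mat.subspace_0[OF sg] by fastforce
    have m: "\<not> \<gg> \<subseteq> fil (Suc m)" unfolding m_def by (rule LeastI) (rule ex)
    have m1: "\<gg> \<subseteq> fil m" "m \<ge> 1"
    proof -
      have "\<gg> \<subseteq> fil (Suc 0)" using less.prems by (simp add: ut_eq_fil)
      then have "m \<noteq> 0" using m by auto
      then show "m \<ge> 1" by simp
      then show "\<gg> \<subseteq> fil m"
        using not_less_Least[of "m - 1" "\<lambda>m. \<not> \<gg> \<subseteq> fil (Suc m)"] by (simp add: m_def)
    qed
    obtain x where x: "x \<in> \<gg>" "x \<notin> fil (Suc m)" using m by auto
    obtain l where l: "lin_on UNIV l" "\<And>w. w \<in> fil (Suc m) \<Longrightarrow> l w = 0" "l x = 1"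
      by (rule separating_form[OF subspace_fil x(2)]) blast
    have br: "l (lie_bracket a b) = 0" if "a \<in> \<gg>" "b \<in> \<gg>" for a b
    proof (rule l(2))
      have "a \<in> fil m" "b \<in> fil m" using that m1 by auto
      then have "lie_bracket a b \<in> fil (m + m)"
        unfolding lie_bracket_def by (intro fil_diff fil_mult)
      then show "lie_bracket a b \<in> fil (Suc m)" by (rule fil_antimono[rotated]) (use m1 in simp)
    qed
    have lg: "lin_on \<gg> l" using l(1) by (rule lin_on_subset) simp
    let ?V = "{y \<in> \<gg>. l y = 0}"
    have "lie_subalgebra ?V"
      using less.prems(1) subspace_kernel[OF lg sg] br by (auto simp: lie_subalgebra_def)
    moreover have "x \<in> \<gg> - ?V" using x l(3) by simp
    then have "?V \<subset> \<gg>" by blast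
    then have "card ?V < card \<gg>" by (intro psubset_card_mono) auto
    ultimately have "exp_closed ?V" using less by auto
    from exp_mult_hyperplane[OF less.prems lg br this] show ?thesis
      unfolding exp_closed_def by meson
  qed
qed

text \<open>This makes \<open>exp x \<mapsto> e (l x)\<close> a character: on an isotropic
  subalgebra the kernel of \<open>l\<close> is itself a subalgebra, so the hyperplane argument
  applies, and injectivity of \<open>exp\<close> identifies \<open>c\<close>.\<close>

lemma mexp_mult_form:
  fixes \<pp> :: "('k, 'n) sqmat set"
  assumes p: "lie_subalgebra \<pp>" "\<pp> \<subseteq> ut" and l: "lin_on \<pp> l"
    and br: "\<And>x y. x \<in> \<pp> \<Longrightarrow> y \<in> \<pp> \<Longrightarrow> l (lie_bracket x y) = 0"
    and abc: "a \<in> \<pp>" "b \<in> \<pp>" "c \<in> \<pp>" "mexp a ** mexp b = mexp c"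
  shows "l c = l a + l b"
proof -
  have "mat.subspace \<pp>" using p by (simp add: lie_subalgebra_def)
  then have "lie_subalgebra {y \<in> \<pp>. l y = 0}"
    using p(1) subspace_kernel[OF l] br by (auto simp: lie_subalgebra_def)
  then have "exp_closed {y \<in> \<pp>. l y = 0}"
    using p(2) by (intro lie_subalgebra_exp_closed) auto
  from exp_mult_hyperplane[OF p l br this abc(1,2)] show ?thesis
    using mexp_inj[of c] abc p(2) by fastforce
qed

end

section \<open>Groups, coadjoint action and polarizations\<close>

lemma dual_space_eq: "dual_space V = {l \<in> extensional V. lin_on V l}"
  by (simp add: dual_space_def lin_on_def)

lemma exp_group_simps [simp]:
  "carrier (exp_group \<gg>) = mexp ` \<gg>" "x \<otimes>\<^bsub>exp_group \<gg>\<^esub> y = x ** y" "\<one>\<^bsub>exp_group \<gg>\<^esub> = mat 1"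
  by (simp_all add: exp_group_def)

lemma coadjoint_apply: "y \<in> \<gg> \<Longrightarrow> coadjoint \<gg> u l y = l (matrix_inv u ** y ** u)"
  by (simp add: coadjoint_def)

text \<open>Orthogonality of characters: a nonzero form takes every value in \<open>K\<close>, so
  some translation multiplies the sum by a factor different from 1.\<close>

lemma character_sum:
  assumes e: "nontrivial_additive_character e" and V: "mat.subspace V" "finite V" and l: "lin_on V l"
  shows "(\<Sum>y\<in>V. e (l y)) = (if \<forall>y\<in>V. l y = 0 then of_nat (card V) else 0)"
proof (cases "\<forall>y\<in>V. l y = 0")
  case True
  have "e 0 = 1" using e unfolding nontrivial_additive_character_def
    by (metis add.right_neutral mult_cancel_left2)
  then show ?thesis using True by simp
next
  case False
  then obtain x where x: "x \<in> V" "l x \<noteq> 0" by blast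
  from e obtain c where c: "e c \<noteq> 1" by (auto simp: nontrivial_additive_character_def)
  define z where "z = mscale (c / l x) x"
  have z: "z \<in> V" "l z = c" using x lin_onD(2)[OF l x(1)]
    by (simp_all add: z_def mat.subspace_scale[OF V(1)])
  have "bij_betw ((+) z) V V"
    by (rule bij_betwI[of _ _ _ "\<lambda>y. y - z"])
      (auto simp: z mat.subspace_add[OF V(1)] mat.subspace_diff[OF V(1)])
  then have "(\<Sum>y\<in>V. e (l y)) = (\<Sum>y\<in>V. e (l (z + y)))"
    by (rule sum.reindex_bij_betw[symmetric])
  also have "\<dots> = e c * (\<Sum>y\<in>V. e (l y))"
    using e by (simp add: lin_onD(1)[OF l z(1)] z(2) nontrivial_additive_character_def sum_distrib_left)
  finally have "(1 - e c) * (\<Sum>y\<in>V. e (l y)) = 0" by (simp add: algebra_simps)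
  then show ?thesis using c False by auto
qed

text \<open>On the sum of \<open>A\<close> and \<open>B\<close> the value \<open>l a + m b\<close>
  is well defined, because two decompositions of a vector differ by an element of the intersection;
  the form is then extended further.\<close>

lemma glue_forms:
  assumes A: "mat.subspace A" "lin_on A l" and B: "mat.subspace B" "lin_on B m"
    and agree: "\<And>x. x \<in> A \<Longrightarrow> x \<in> B \<Longrightarrow> l x = m x"
  obtains k where "lin_on UNIV k" "\<And>x. x \<in> A \<Longrightarrow> k x = l x" "\<And>x. x \<in> B \<Longrightarrow> k x = m x"
proof -
  define W where "W = {a + b |a b. a \<in> A \<and> b \<in> B}"
  define k0 where "k0 v = (SOME c. \<exists>a\<in>A. \<exists>b\<in>B. v = a + b \<and> c = l a + m b)" for v
  have k0: "k0 (a + b) = l a + m b" if ab: "a \<in> A" "b \<in> B" for a b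
  proof -
    have "\<exists>a'\<in>A. \<exists>b'\<in>B. a + b = a' + b' \<and> k0 (a + b) = l a' + m b'"
      unfolding k0_def by (rule someI[of _ "l a + m b"]) (use ab in blast)
    then obtain a' b' where ab': "a' \<in> A" "b' \<in> B" "a + b = a' + b'" "k0 (a + b) = l a' + m b'" by blast
    then have eq: "a - a' = b' - b" by (simp add: algebra_simps)
    then have "l (a - a') = m (b' - b)"
      using agree[of "a - a'"] mat.subspace_diff[OF A(1) ab(1) ab'(1)]
        mat.subspace_diff[OF B(1) ab'(2) ab(2)] by simp
    then show ?thesis
      using ab ab' by (simp add: lin_on_more(3)[OF A(2,1)] lin_on_more(3)[OF B(2,1)] algebra_simps)
  qed
  have "lin_on W k0"
    unfolding lin_on_def
  proof (intro conjI ballI allI)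
    fix x y assume "x \<in> W" "y \<in> W"
    then obtain a b a' b' where *: "x = a + b" "y = a' + b'" "a \<in> A" "b \<in> B" "a' \<in> A" "b' \<in> B"
      unfolding W_def by blast
    have "x + y = (a + a') + (b + b')" using * by (simp add: algebra_simps)
    then have "k0 (x + y) = l (a + a') + m (b + b')"
      using * mat.subspace_add[OF A(1)] mat.subspace_add[OF B(1)] by (simp only: k0)
    then show "k0 (x + y) = k0 x + k0 y"
      using * by (simp add: k0 lin_onD(1)[OF A(2)] lin_onD(1)[OF B(2)])
  next
    fix c x assume "x \<in> W"
    then obtain a b where *: "x = a + b" "a \<in> A" "b \<in> B" unfolding W_def by blast
    then show "k0 (mscale c x) = c * k0 x"
      using mat.subspace_scale[OF A(1)] mat.subspace_scale[OF B(1)]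
      by (simp add: mat.scale_right_distrib k0 lin_onD(2)[OF A(2)] lin_onD(2)[OF B(2)] distrib_left)
  qed
  moreover have "mat.subspace W" unfolding W_def by (rule mat.subspace_sums[OF A(1) B(1)])
  ultimately obtain k where k: "lin_on UNIV k" "\<And>w. w \<in> W \<Longrightarrow> k w = k0 w" by (metis extend_form)
  have zero: "0 \<in> A" "0 \<in> B" using A B by (auto intro: mat.subspace_0)
  have "k x = l x" if "x \<in> A" for x
    using k0[OF that zero(2)] k(2)[of x] that zero
    by (force simp: W_def lin_on_more(1)[OF B(2,1)])
  moreover have "k x = m x" if "x \<in> B" for x
    using k0[OF zero(1) that] k(2)[of x] that zero
    by (force simp: W_def lin_on_more(1)[OF A(2,1)])
  ultimately show ?thesis using that k(1) by blast
qed

text \<open>This and the next lemma are the two halves of a fibre count. They are separate because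
  \<open>pol_orbit\<close> has an upper bound for the fibres of one map and a lower bound for those
  of another.\<close>

lemma card_le_image_fibres:
  assumes "finite A" "\<And>a. a \<in> A \<Longrightarrow> card {x \<in> A. f x = f a} \<le> r"
  shows "card A \<le> card (f ` A) * r"
proof -
  have "card A = card (\<Union>b\<in>f ` A. {x \<in> A. f x = b})" by (rule arg_cong[of _ _ card]) auto
  also have "\<dots> \<le> (\<Sum>b\<in>f ` A. card {x \<in> A. f x = b})" using assms(1) by (intro card_UN_le) auto
  also have "\<dots> \<le> of_nat (card (f ` A)) * r" by (rule sum_bounded_above) (use assms(2) in auto)
  finally show ?thesis by simp
qed

lemma card_ge_image_fibres:
  assumes "finite A" "\<And>a. a \<in> A \<Longrightarrow> r \<le> card {x \<in> A. f x = f a}"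
  shows "card (f ` A) * r \<le> card A"
proof -
  have "of_nat (card (f ` A)) * r \<le> (\<Sum>b\<in>f ` A. card {x \<in> A. f x = b})"
    by (rule sum_bounded_below) (use assms(2) in auto)
  also have "\<dots> = card (\<Union>b\<in>f ` A. {x \<in> A. f x = b})"
    using assms(1) by (intro card_UN_disjoint[symmetric]) auto
  also have "\<dots> = card A" by (rule arg_cong[of _ _ card]) auto
  finally show ?thesis by simp
qed

section \<open>The group of a fixed Lie subalgebra and its coadjoint action\<close>

context
  assumes char_ge: "CHAR('k::{field,finite}) \<ge> CARD('n::{finite,linorder})"
begin

context
  fixes \<gg> :: "('k, 'n) sqmat set"
  assumes lie: "lie_subalgebra \<gg>" and ut: "\<gg> \<subseteq> ut"
begin

lemma lie_subspace: "mat.subspace \<gg>"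
  using lie by (simp add: lie_subalgebra_def)

lemma bracket_mem: "x \<in> \<gg> \<Longrightarrow> y \<in> \<gg> \<Longrightarrow> lie_bracket x y \<in> \<gg>"
  using lie by (simp add: lie_subalgebra_def)

lemma mexp_image_mult: "u \<in> mexp ` \<gg> \<Longrightarrow> v \<in> mexp ` \<gg> \<Longrightarrow> u ** v \<in> mexp ` \<gg>"
  using lie_subalgebra_exp_closed[OF char_ge lie ut] unfolding exp_closed_def by fastforce

lemma mexp_image_one: "mat 1 \<in> mexp ` \<gg>"
  using mat.subspace_0[OF lie_subspace] by (auto intro: image_eqI[of _ _ 0])

lemma mexp_image_inv:
  assumes "u \<in> mexp ` \<gg>"
  shows "matrix_inv u \<in> mexp ` \<gg>" "u ** matrix_inv u = mat 1" "matrix_inv u ** u = mat 1"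
    "matrix_inv (matrix_inv u) = u"
  using assms mexp_minus[OF char_ge] ut mat.subspace_neg[OF lie_subspace] by auto

lemma mexp_image_conj:
  assumes "u \<in> mexp ` \<gg>" "y \<in> \<gg>"
  shows "u ** y ** matrix_inv u \<in> \<gg>" "matrix_inv u ** y ** u \<in> \<gg>"
proof -
  have *: "v ** y ** matrix_inv v \<in> \<gg>" if "v \<in> mexp ` \<gg>" for v
    using that conj_mexp_mem[OF char_ge _ lie_subspace ut bracket_mem assms(2)] mexp_minus[OF char_ge] ut
    by auto
  show "u ** y ** matrix_inv u \<in> \<gg>" "matrix_inv u ** y ** u \<in> \<gg>"
    using *[OF assms(1)] *[OF mexp_image_inv(1)[OF assms(1)]] by (simp_all add: mexp_image_inv(4)[OF assms(1)])
qed

lemma group_exp_group: "group (exp_group \<gg>)"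
proof (rule groupI)
  fix x assume "x \<in> carrier (exp_group \<gg>)"
  then show "\<exists>y\<in>carrier (exp_group \<gg>). y \<otimes>\<^bsub>exp_group \<gg>\<^esub> x = \<one>\<^bsub>exp_group \<gg>\<^esub>"
    using mexp_image_inv(1,3)[of x] by (intro bexI[of _ "matrix_inv x"]) simp_all
qed (simp_all add: mexp_image_one matrix_mul_assoc mexp_image_mult)

lemma inv_exp_group:
  assumes "u \<in> mexp ` \<gg>"
  shows "inv\<^bsub>exp_group \<gg>\<^esub> u = matrix_inv u"
  using group.inv_equality[OF group_exp_group, of "matrix_inv u" u] mexp_image_inv[OF assms] assms by simp

lemma coadjoint_dual:
  assumes "u \<in> mexp ` \<gg>" "l \<in> dual_space \<gg>"
  shows "coadjoint \<gg> u l \<in> dual_space \<gg>"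
  using assms(2) mexp_image_conj(2)[OF assms(1)] mat.subspace_add[OF lie_subspace] mat.subspace_scale[OF lie_subspace]
  by (auto simp: dual_space_eq lin_on_def coadjoint_def matrix_distribs mscale_mult_left
      mscale_mult_right)

lemma coadjoint_mult:
  assumes "u \<in> mexp ` \<gg>" "v \<in> mexp ` \<gg>"
  shows "coadjoint \<gg> (u ** v) l = coadjoint \<gg> u (coadjoint \<gg> v l)"
proof -
  have "(u ** v) ** (matrix_inv v ** matrix_inv u) = u ** (v ** matrix_inv v) ** matrix_inv u"
    by (simp only: matrix_mul_assoc)
  then have "matrix_inv (u ** v) = matrix_inv v ** matrix_inv u"
    by (intro matrix_inv_eqI) (simp add: mexp_image_inv assms)
  then show ?thesis
    using mexp_image_conj(2)[OF assms(1)] by (auto simp: coadjoint_def matrix_mul_assoc)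
qed

lemma coadjoint_one: "l \<in> dual_space \<gg> \<Longrightarrow> coadjoint \<gg> (mat 1) l = l"
  using matrix_inv_eqI[of "mat 1 :: ('k, 'n) sqmat" "mat 1"]
  by (auto simp: coadjoint_def dual_space_eq extensional_def)

lemma coadjoint_inv:
  assumes "u \<in> mexp ` \<gg>" "l \<in> dual_space \<gg>"
  shows "coadjoint \<gg> (matrix_inv u) (coadjoint \<gg> u l) = l"
    and "coadjoint \<gg> u (coadjoint \<gg> (matrix_inv u) l) = l"
  using coadjoint_mult[OF mexp_image_inv(1)[OF assms(1)] assms(1)] coadjoint_mult[OF assms(1) mexp_image_inv(1)[OF assms(1)]]
    mexp_image_inv[OF assms(1)] coadjoint_one[OF assms(2)] by metis+

text \<open>Every term of the series after \<open>y\<close> itself is a multiple of some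
  \<open>[x, v]\<close> with \<open>v \<in> V\<close>, which \<open>l\<close> kills.\<close>

lemma form_conj_eq:
  assumes l: "lin_on \<gg> l" and x: "x \<in> \<gg>" and V: "mat.subspace V" "V \<subseteq> \<gg>"
    and br: "\<And>v. v \<in> V \<Longrightarrow> lie_bracket x v \<in> V" and zero: "\<And>v. v \<in> V \<Longrightarrow> l (lie_bracket x v) = 0"
    and y: "y \<in> V"
  shows "l (mexp x ** y ** mexp (- x)) = l y"
proof -
  have fil: "x \<in> fil 1" "V \<subseteq> fil 0" using x V ut fil_antimono[of 0 "Suc 0"] by (auto simp: ut_eq_fil)
  have mem: "ad_term x y k \<in> V" for k by (rule ad_term_mem[OF char_ge fil(1) V(1) fil(2) br y])
  have lz: "l (ad_term x y (Suc k)) = 0" if "Suc k < CARD('n)" for k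
    using lin_onD(2)[OF l bracket_mem[OF x subsetD[OF V(2) mem]]] zero[OF mem]
    by (simp add: ad_term_bracket[OF char_ge fil(1) that] del: of_nat_Suc)
  have "mexp x ** y ** mexp (- x) = (\<Sum>k<CARD('n). ad_term x y k)"
    using fil y by (intro conj_mexp char_ge) auto
  then have "l (mexp x ** y ** mexp (- x)) = (\<Sum>k<CARD('n). l (ad_term x y k))"
    using lin_on_sum[OF l lie_subspace, of "{..<CARD('n)}" "ad_term x y"] mem V(2) by auto
  also obtain M where M: "CARD('n) = Suc M" using zero_less_card_finite gr0_implies_Suc by blast
  have "(\<Sum>k<CARD('n). l (ad_term x y k)) = l (ad_term x y 0)"
    using lz unfolding M by (simp add: sum.lessThan_Suc_shift del: sum.lessThan_Suc)
  finally show ?thesis by (simp add: ad_term_0[OF char_ge])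
qed

lemma coadjoint_mexp:
  assumes "x \<in> \<gg>" "y \<in> \<gg>"
  shows "coadjoint \<gg> (mexp x) l y = l (mexp (- x) ** y ** mexp (- (- x)))"
  using assms ut mexp_minus[OF char_ge, of x] by (auto simp: coadjoint_apply)

text \<open>Invariance gives \<open>l y = l (exp (- ad x) y)\<close>, so the linear term
  \<open>l [- x, y]\<close> cancels against the higher ones. Those have the same shape with
  \<open>y\<close> replaced by elements deeper in the filtration, so they vanish by induction from
  the deepest level upwards.\<close>

lemma stabilizer_radical:
  assumes l: "l \<in> dual_space \<gg>" and x: "x \<in> \<gg>" and st: "coadjoint \<gg> (mexp x) l = l" and y: "y \<in> \<gg>"
  shows "l (lie_bracket x y) = 0"
proof -
  have lin: "lin_on \<gg> l" using l by (simp add: dual_space_eq)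
  have x': "- x \<in> \<gg>" using x by (rule mat.subspace_neg[OF lie_subspace])
  have fil: "- x \<in> fil 1" "\<gg> \<subseteq> fil 0" using x' ut fil_antimono[of 0 "Suc 0"] by (auto simp: ut_eq_fil)
  \<comment> \<open>The level \<open>N - d\<close> runs from \<open>fil N\<close>, which is zero, to
    \<open>fil 0\<close>, which contains \<open>\<gg>\<close>.\<close>
  have "\<forall>y\<in>\<gg>. y \<in> fil (CARD('n) - d) \<longrightarrow> l (lie_bracket (- x) y) = 0" if "d \<le> CARD('n)" for d
    using that
  proof (induction d)
    case 0
    then show ?case using fil_top lin_on_more(1)[OF lin lie_subspace] by (force simp: lie_bracket_def)
  next
    case (Suc d)
    show ?case
    proof (intro ballI impI)
      fix y assume y: "y \<in> \<gg>" "y \<in> fil (CARD('n) - Suc d)"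
      let ?c = "ad_term (- x) y"
      have mem: "?c k \<in> \<gg>" for k
        by (rule ad_term_mem[OF char_ge fil(1) lie_subspace fil(2) bracket_mem[OF x'] y(1)])
      \<comment> \<open>For \<open>N = 1\<close> the truncated series has no linear term. Otherwise
        its degrees split into 0, 1 and \<open>M = N - 2\<close> higher ones.\<close>
      show "l (lie_bracket (- x) y) = 0"
      proof (cases "CARD('n) = 1")
        case True
        then have "y = 0" using y(1) ut fil_top[of y 1] by (auto simp: ut_eq_fil)
        then show ?thesis using lin_on_more(1)[OF lin lie_subspace] by (simp add: lie_bracket_def)
      next
        case False
        then obtain M where M: "CARD('n) = Suc (Suc M)"
          by (metis One_nat_def old.nat.exhaust zero_less_card_finite less_irrefl)
        have c1: "?c (Suc 0) = lie_bracket (- x) y"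
          using ad_term_bracket[OF char_ge fil(1), of 0 y] M by (simp add: ad_term_0[OF char_ge])
        have high: "l (?c (Suc (Suc k))) = 0" if "k < M" for k
        proof -
          have "?c (Suc k) \<in> fil (CARD('n) - Suc d + Suc k)"
            by (rule ad_term_fil[OF char_ge fil(1) y(2)])
          then have "?c (Suc k) \<in> fil (CARD('n) - d)" by (rule fil_antimono[rotated]) simp
          then have "l (lie_bracket (- x) (?c (Suc k))) = 0" using Suc mem by auto
          then show ?thesis
            using lin_onD(2)[OF lin bracket_mem[OF x' mem]] that M
            by (subst ad_term_bracket[OF char_ge fil(1)]) (simp_all del: of_nat_Suc)
        qed
        have "l y = l (mexp (- x) ** y ** mexp (- (- x)))"
          using coadjoint_mexp[OF x y(1), of l] st by simp
        also have "mexp (- x) ** y ** mexp (- (- x)) = (\<Sum>k<CARD('n). ?c k)"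
          using fil y(1) by (intro conj_mexp char_ge) auto
        also have "l \<dots> = (\<Sum>k<CARD('n). l (?c k))"
          by (rule lin_on_sum[OF lin lie_subspace mem])
        also have "\<dots> = l (?c 0) + (l (?c (Suc 0)) + (\<Sum>k<M. l (?c (Suc (Suc k)))))"
          unfolding M by (simp only: sum.lessThan_Suc_shift)
        also have "(\<Sum>k<M. l (?c (Suc (Suc k)))) = 0" using high by simp
        finally show ?thesis using c1 by (simp add: ad_term_0[OF char_ge])
      qed
    qed
  qed
  from this[of "CARD('n)"] have "l (lie_bracket (- x) y) = 0" using fil(2) y by auto
  then show ?thesis
    using lin_on_more(2)[OF lin lie_subspace bracket_mem[OF x y]] by (simp add: lie_bracket_lin(5))
qed


section \<open>A linear form with a polarization\<close>

context
  fixes l :: "('k, 'n) sqmat \<Rightarrow> 'k" and \<pp> :: "('k, 'n) sqmat set"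
  assumes l: "l \<in> dual_space \<gg>" and pol: "polarization \<gg> l \<pp>"
begin

lemma form_lin: "lin_on \<gg> l"
  using l by (simp add: dual_space_eq)

lemma pol_lie: "lie_subalgebra \<pp>" "mat.subspace \<pp>" "\<pp> \<subseteq> \<gg>" "\<pp> \<subseteq> ut"
  using pol ut by (auto simp: polarization_def isotropic_subspace_def)

lemma pol_isotropic: "x \<in> \<pp> \<Longrightarrow> y \<in> \<pp> \<Longrightarrow> l (lie_bracket x y) = 0"
  using pol by (auto simp: polarization_def isotropic_subspace_def)

lemma pol_bracket: "x \<in> \<pp> \<Longrightarrow> y \<in> \<pp> \<Longrightarrow> lie_bracket x y \<in> \<pp>"
  using pol_lie(1) by (simp add: lie_subalgebra_def)

text \<open>A polarization is its own orthogonal: since the form is alternating, adjoining a line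
  orthogonal to \<open>\<pp>\<close> keeps the space isotropic, so maximality applies.\<close>

lemma pol_maximal:
  assumes y: "y \<in> \<gg>" and perp: "\<And>x. x \<in> \<pp> \<Longrightarrow> l (lie_bracket x y) = 0"
  shows "y \<in> \<pp>"
proof -
  define V where "V = {a + mscale c y |a c. a \<in> \<pp>}"
  have "V = {a + b |a b. a \<in> \<pp> \<and> b \<in> {mscale c y |c. True}}" unfolding V_def by blast
  moreover have "mat.subspace {mscale c y |c. True}"
    using mat.subspace_span[of "{y}"] by (simp add: mat.span_singleton full_SetCompr_eq)
  ultimately have sV: "mat.subspace V" using mat.subspace_sums[OF pol_lie(2)] by (simp only:)
  have V: "V \<subseteq> \<gg>"
    using y pol_lie(3) mat.subspace_add[OF lie_subspace] mat.subspace_scale[OF lie_subspace] by (auto simp: V_def)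
  have "l (lie_bracket v w) = 0" if vw: "v \<in> V" "w \<in> V" for v w
  proof -
    obtain a b c d where vw: "v = a + mscale c y" "w = b + mscale d y" "a \<in> \<pp>" "b \<in> \<pp>"
      using vw unfolding V_def by blast
    have "lie_bracket v w = lie_bracket a b + mscale d (lie_bracket a y) + mscale (- c) (lie_bracket b y)"
      using lie_bracket_lin(7)[of y b] by (simp add: vw lie_bracket_lin(1-6))
    moreover have "lie_bracket a b \<in> \<gg>" "lie_bracket a y \<in> \<gg>" "lie_bracket b y \<in> \<gg>"
      using vw y pol_lie(3) by (auto intro: bracket_mem)
    ultimately show ?thesis
      using mat.subspace_add[OF lie_subspace] mat.subspace_scale[OF lie_subspace] pol_isotropic[OF vw(3,4)]
        perp[OF vw(3)] perp[OF vw(4)]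
      by (simp add: lin_onD[OF form_lin] lin_on_more(3)[OF form_lin lie_subspace])
  qed
  then have "isotropic_subspace \<gg> l V" using sV V by (simp add: isotropic_subspace_def)
  moreover have "\<pp> \<subseteq> V"
  proof
    fix a assume "a \<in> \<pp>"
    then have "a + mscale 0 y \<in> V" unfolding V_def by blast
    then show "a \<in> V" by simp
  qed
  ultimately have "V = \<pp>" using pol by (auto simp: polarization_def)
  moreover have "0 + mscale 1 y \<in> V" unfolding V_def using mat.subspace_0[OF pol_lie(2)] by blast
  ultimately show ?thesis by simp
qed

text \<open>The logarithm of a stabilizing element lies in the radical, which is orthogonal to
  \<open>\<pp>\<close> and hence contained in it.\<close>

lemma stabilizer_mem:
  assumes "u \<in> mexp ` \<gg>" "coadjoint \<gg> u l = l"
  shows "u \<in> mexp ` \<pp>"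
proof -
  obtain x where x: "x \<in> \<gg>" "u = mexp x" using assms by auto
  have "l (lie_bracket y x) = 0" if "y \<in> \<pp>" for y
  proof -
    have "y \<in> \<gg>" using that pol_lie(3) by auto
    then show ?thesis
      using stabilizer_radical[OF l x(1) assms(2)[unfolded x(2)], of y]
        lin_on_more(2)[OF form_lin lie_subspace bracket_mem[OF x(1)], of y]
      by (subst lie_bracket_lin(7)) simp
  qed
  then show ?thesis using pol_maximal[OF x(1)] x(2) by auto
qed

text \<open>\<open>form_conj_eq\<close> with \<open>V = \<pp>\<close>: the subalgebra is stable
  under its own \<open>ad\<close>, and isotropy kills the brackets.\<close>

lemma coadjoint_pol:
  assumes u: "u \<in> mexp ` \<pp>" and y: "y \<in> \<pp>"
  shows "coadjoint \<gg> u l y = l y"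
proof -
  obtain x where x: "x \<in> \<pp>" "u = mexp x" using u by auto
  then have x': "x \<in> \<gg>" "- x \<in> \<gg>" "- x \<in> \<pp>" "y \<in> \<gg>"
    using y pol_lie(3) mat.subspace_neg[OF pol_lie(2)] by auto
  show ?thesis
    unfolding x(2) coadjoint_mexp[OF x'(1,4)]
    by (rule form_conj_eq[OF form_lin x'(2) pol_lie(2,3) pol_bracket[OF x'(3)] pol_isotropic[OF x'(3)] y])
qed

text \<open>If \<open>d\<close> were not of the form \<open>l [x, -]\<close>, then all sums over \<open>\<gg>\<close> of
  \<open>e (l [x, y] - d y)\<close> would vanish; but summing over \<open>x \<in> \<pp>\<close> first gives \<open>(card \<pp>)\<^sup>2\<close>.\<close>

lemma pol_form_surj:
  assumes e: "nontrivial_additive_character (e :: 'k \<Rightarrow> complex)"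
    and d: "lin_on \<gg> d" "\<And>y. y \<in> \<pp> \<Longrightarrow> d y = 0"
  obtains x where "x \<in> \<pp>" "\<And>y. y \<in> \<gg> \<Longrightarrow> l (lie_bracket x y) = d y"
proof (rule ccontr)
  assume "\<not> thesis"
  with that have no: "\<exists>y\<in>\<gg>. l (lie_bracket x y) \<noteq> d y" if "x \<in> \<pp>" for x using \<open>x \<in> \<pp>\<close> by blast
  have e_add: "e (a - b) = e a * e (- b)" for a b
    using e unfolding nontrivial_additive_character_def by (metis diff_conv_add_uminus)
  have "(\<Sum>x\<in>\<pp>. \<Sum>y\<in>\<gg>. e (l (lie_bracket x y) - d y)) = 0"
  proof (rule sum.neutral, rule ballI)
    fix x assume x: "x \<in> \<pp>"
    then have "lin_on \<gg> (\<lambda>y. l (lie_bracket x y) - d y)"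
      unfolding lin_on_def using pol_lie(3) bracket_mem[of x]
      by (auto simp: lie_bracket_lin(2,4) lin_onD[OF form_lin] lin_onD[OF d(1)] algebra_simps)
    from character_sum[OF e lie_subspace _ this] show "(\<Sum>y\<in>\<gg>. e (l (lie_bracket x y) - d y)) = 0"
      using no[OF x] by auto
  qed
  moreover have "(\<Sum>x\<in>\<pp>. \<Sum>y\<in>\<gg>. e (l (lie_bracket x y) - d y))
      = (\<Sum>y\<in>\<gg>. e (- d y) * (\<Sum>x\<in>\<pp>. e (l (lie_bracket x y))))"
    by (subst sum.swap) (simp add: e_add sum_distrib_left mult.commute)
  moreover have "(\<Sum>y\<in>\<gg>. e (- d y) * (\<Sum>x\<in>\<pp>. e (l (lie_bracket x y))))
      = (\<Sum>y\<in>\<gg>. if y \<in> \<pp> then of_nat (card \<pp>) else 0)"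
  proof (rule sum.cong[OF refl])
    fix y assume y: "y \<in> \<gg>"
    have "lin_on \<pp> (\<lambda>x. l (lie_bracket x y))"
      unfolding lin_on_def using pol_lie(3) bracket_mem[OF _ y]
      by (auto simp: lie_bracket_lin(1,3) lin_onD[OF form_lin] subset_iff)
    note cs = character_sum[OF e pol_lie(2) finite this]
    have "e 0 = 1" using e unfolding nontrivial_additive_character_def
      by (metis add.right_neutral mult_cancel_left2)
    \<comment> \<open>By self-orthogonality the inner sum survives exactly for
      \<open>y \<in> \<pp>\<close>, and there also \<open>d y = 0\<close>.\<close>
    moreover have "(\<forall>x\<in>\<pp>. l (lie_bracket x y) = 0) \<longleftrightarrow> y \<in> \<pp>"
      using pol_isotropic[of _ y] pol_maximal[OF y] by blast
    ultimately show "e (- d y) * (\<Sum>x\<in>\<pp>. e (l (lie_bracket x y)))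
        = (if y \<in> \<pp> then of_nat (card \<pp>) else 0)"
      using cs d(2)[of y] by simp
  qed
  moreover have "(\<Sum>y\<in>\<gg>. if y \<in> \<pp> then of_nat (card \<pp>) else 0) = (of_nat (card \<pp>) * of_nat (card \<pp>) :: complex)"
    using pol_lie(3) by (simp add: sum.If_cases Int_absorb1)
  ultimately have "card \<pp> = 0" by simp
  then show False using mat.subspace_0[OF pol_lie(2)] by auto
qed

definition radical :: "('k, 'n) sqmat set" where
  "radical = {x \<in> \<gg>. \<forall>y\<in>\<gg>. l (lie_bracket x y) = 0}"

text \<open>If \<open>exp x'\<close> and \<open>exp x\<close> move \<open>l\<close> to the same
  form, the quotient \<open>exp (- x) exp x'\<close> stabilizes \<open>l\<close> and is the
  exponential of an element of the radical, which determines \<open>x'\<close>.\<close>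

lemma card_coset_fibre: "card {x' \<in> \<pp>. coadjoint \<gg> (mexp x') l = coadjoint \<gg> (mexp x) l} \<le> card radical"
  if x: "x \<in> \<pp>"
proof -
  let ?F = "{x' \<in> \<pp>. coadjoint \<gg> (mexp x') l = coadjoint \<gg> (mexp x) l}"
  have xg: "mexp x \<in> mexp ` \<gg>" using x pol_lie(3) by auto
  have ex: "\<exists>r\<in>radical. mexp r = matrix_inv (mexp x) ** mexp x'" if "x' \<in> ?F" for x'
  proof -
    have x'g: "mexp x' \<in> mexp ` \<gg>" using that pol_lie(3) by auto
    have prod: "matrix_inv (mexp x) ** mexp x' \<in> mexp ` \<gg>"
      by (rule mexp_image_mult[OF mexp_image_inv(1)[OF xg] x'g])
    then obtain r where r: "r \<in> \<gg>" "mexp r = matrix_inv (mexp x) ** mexp x'" by (metis imageE)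
    have "coadjoint \<gg> (mexp r) l = coadjoint \<gg> (matrix_inv (mexp x)) (coadjoint \<gg> (mexp x') l)"
      unfolding r(2) by (rule coadjoint_mult[OF mexp_image_inv(1)[OF xg] x'g])
    also have "\<dots> = l" using that coadjoint_inv(1)[OF xg l] by simp
    finally have "r \<in> radical" using stabilizer_radical[OF l r(1)] r(1) by (simp add: radical_def)
    then show ?thesis using r(2) by auto
  qed
  define \<psi> where "\<psi> x' = (SOME r. r \<in> radical \<and> mexp r = matrix_inv (mexp x) ** mexp x')" for x'
  have \<psi>: "\<psi> x' \<in> radical \<and> mexp (\<psi> x') = matrix_inv (mexp x) ** mexp x'" if "x' \<in> ?F" for x'
    unfolding \<psi>_def by (rule someI_ex) (use ex[OF that] in blast)
  have "inj_on \<psi> ?F"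
  proof (rule inj_onI)
    fix a b assume ab: "a \<in> ?F" "b \<in> ?F" "\<psi> a = \<psi> b"
    then have "mexp x ** (matrix_inv (mexp x) ** mexp a) = mexp x ** (matrix_inv (mexp x) ** mexp b)"
      using \<psi>[OF ab(1)] \<psi>[OF ab(2)] ab(3) by simp
    then have "mexp a = mexp b" by (simp add: matrix_mul_assoc mexp_image_inv(2)[OF xg])
    then show "a = b" using ab pol_lie(4) mexp_inj[of a b] by auto
  qed
  then show ?thesis using \<psi> by (intro card_inj_on_le) auto
qed

text \<open>The orbit of \<open>l\<close> under \<open>exp \<pp>\<close> lies in the set of forms that agree with \<open>l\<close> on \<open>\<pp>\<close>, and
  both have \<open>card \<pp> / card radical\<close> elements.\<close>

lemma pol_orbit:
  assumes e: "nontrivial_additive_character (e :: 'k \<Rightarrow> complex)"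
    and m: "m \<in> dual_space \<gg>" "\<And>y. y \<in> \<pp> \<Longrightarrow> m y = l y"
  obtains u where "u \<in> mexp ` \<pp>" "m = coadjoint \<gg> u l"
proof -
  define S where "S = {m \<in> dual_space \<gg>. \<forall>y\<in>\<pp>. m y = l y}"
  define f where "f x = coadjoint \<gg> (mexp x) l" for x
  \<comment> \<open>The first-order version of the orbit map \<open>f\<close>. Unlike
    \<open>f\<close> it is affine in \<open>x\<close>: it covers \<open>S\<close> by
    \<open>pol_form_surj\<close>, and its fibres contain translates of the radical.\<close>
  define L where "L x = (\<lambda>y\<in>\<gg>. l y + l (lie_bracket x y))" for x
  have fS: "f ` \<pp> \<subseteq> S"
  proof safe
    fix x assume x: "x \<in> \<pp>"
    then have "mexp x \<in> mexp ` \<gg>" using pol_lie(3) by auto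
    then show "f x \<in> S" unfolding S_def f_def using coadjoint_dual[OF _ l] coadjoint_pol x by auto
  qed
  have SL: "S \<subseteq> L ` \<pp>"
  proof
    fix m assume m: "m \<in> S"
    then have linm: "lin_on \<gg> m" and ext: "m \<in> extensional \<gg>" by (auto simp: S_def dual_space_eq)
    have "lin_on \<gg> (\<lambda>y. m y - l y)"
      unfolding lin_on_def by (auto simp: lin_onD[OF form_lin] lin_onD[OF linm] algebra_simps)
    then obtain x where x: "x \<in> \<pp>" "\<And>y. y \<in> \<gg> \<Longrightarrow> l (lie_bracket x y) = m y - l y"
      by (rule pol_form_surj[OF e]) (use m in \<open>auto simp: S_def\<close>)
    then have "L x = m" using ext by (auto simp: L_def extensional_def)
    then show "m \<in> L ` \<pp>" using x(1) by auto
  qed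
  have fib_L: "card radical \<le> card {x' \<in> \<pp>. L x' = L x}" if x: "x \<in> \<pp>" for x
  proof (rule card_inj_on_le[of "(+) x"])
    show "(+) x ` radical \<subseteq> {x' \<in> \<pp>. L x' = L x}"
    proof safe
      fix r assume r: "r \<in> radical"
      have "l (lie_bracket y r) = 0" if "y \<in> \<pp>" for y
      proof -
        have y: "y \<in> \<gg>" and rg: "r \<in> \<gg>" using that r pol_lie(3) by (auto simp: radical_def)
        have "l (lie_bracket r y) = 0" using r y by (auto simp: radical_def)
        then show ?thesis
          using lin_on_more(2)[OF form_lin lie_subspace bracket_mem[OF rg y]] by (subst lie_bracket_lin(7)) simp
      qed
      then have "r \<in> \<pp>" using r pol_maximal by (auto simp: radical_def)
      then show "x + r \<in> \<pp>" using x mat.subspace_add[OF pol_lie(2)] by auto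
      have "l (lie_bracket (x + r) y) = l (lie_bracket x y)" if "y \<in> \<gg>" for y
      proof -
        have "lie_bracket x y \<in> \<gg>" "lie_bracket r y \<in> \<gg>" "l (lie_bracket r y) = 0"
          using that r x pol_lie(3) by (auto simp: radical_def intro: bracket_mem)
        then show ?thesis by (simp add: lie_bracket_lin(1) lin_onD(1)[OF form_lin])
      qed
      then show "L (x + r) = L x" by (auto simp: L_def)
    qed
  qed auto
  \<comment> \<open>The count runs card S \<le> card (L image) \<le> card p / card radical \<le>
    card (f image). Since the image of \<open>f\<close> lies in \<open>S\<close>, it must be all of
    \<open>S\<close>.\<close>
  have "card (L ` \<pp>) * card radical \<le> card \<pp>" by (rule card_ge_image_fibres) (use fib_L in auto)
  also have "\<dots> \<le> card (f ` \<pp>) * card radical"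
    unfolding f_def by (rule card_le_image_fibres) (use card_coset_fibre in auto)
  finally have "card (L ` \<pp>) * card radical \<le> card (f ` \<pp>) * card radical" .
  moreover have "0 \<in> radical"
    using mat.subspace_0[OF lie_subspace] lin_on_more(1)[OF form_lin lie_subspace] by (simp add: radical_def lie_bracket_def)
  then have "card radical > 0" by (auto simp: card_gt_0_iff)
  ultimately have "card (L ` \<pp>) \<le> card (f ` \<pp>)" by simp
  moreover have "card S \<le> card (L ` \<pp>)" by (rule card_mono[OF _ SL]) auto
  ultimately have "f ` \<pp> = S" by (intro card_seteq fS) auto
  moreover have "m \<in> S" using m by (simp add: S_def)
  ultimately show ?thesis using that unfolding f_def by blast
qed

lemma polarization_character_mexp:
  "a \<in> \<pp> \<Longrightarrow> polarization_character e l \<pp> (mexp a) = e (l a)"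
proof -
  assume a: "a \<in> \<pp>"
  have "inj_on mexp \<pp>" using pol_lie(4) mexp_inj by (auto simp: inj_on_def)
  then show ?thesis using a by (simp add: polarization_character_def)
qed

lemma polarization_character_mult:
  assumes e: "nontrivial_additive_character e" and uv: "u \<in> mexp ` \<pp>" "v \<in> mexp ` \<pp>"
  shows "polarization_character e l \<pp> (u ** v)
    = polarization_character e l \<pp> u * polarization_character e l \<pp> v"
proof -
  obtain a b where ab: "a \<in> \<pp>" "b \<in> \<pp>" "u = mexp a" "v = mexp b" using uv by blast
  obtain c where c: "c \<in> \<pp>" "mexp a ** mexp b = mexp c"
    using lie_subalgebra_exp_closed[OF char_ge pol_lie(1,4)] ab(1,2) unfolding exp_closed_def by blast
  have "l c = l a + l b"
    by (rule mexp_mult_form[OF char_ge pol_lie(1,4) lin_on_subset[OF form_lin pol_lie(3)] pol_isotropic ab(1,2) c])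
  then show ?thesis
    using e ab c by (simp add: polarization_character_mexp nontrivial_additive_character_def)
qed

end
end
end

section \<open>Compatible forms and intersections of orbits\<close>

text \<open>Mackey's condition: the characters of \<open>u (exp \<pp>) u\<^sup>-\<^sup>1\<close> and \<open>exp \<qq>\<close> given by \<open>l\<close> and \<open>m\<close>
  agree on the intersection of these groups.\<close>

definition compatible_at ::
  "('k::field, 'n::finite) sqmat \<Rightarrow> (('k, 'n) sqmat \<Rightarrow> 'k) \<Rightarrow> ('k, 'n) sqmat set \<Rightarrow>
     (('k, 'n) sqmat \<Rightarrow> 'k) \<Rightarrow> ('k, 'n) sqmat set \<Rightarrow> bool" where
  "compatible_at u l \<pp> m \<qq> \<longleftrightarrow>
     (\<forall>a\<in>\<pp>. u ** a ** matrix_inv u \<in> \<qq> \<longrightarrow> m (u ** a ** matrix_inv u) = l a)"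

context
  assumes char_ge: "CHAR('k::{field,finite}) \<ge> CARD('n::{finite,linorder})"
begin

context
  fixes \<gg> \<hh> :: "('k, 'n) sqmat set"
    and l m :: "('k, 'n) sqmat \<Rightarrow> 'k" and \<pp> \<qq> :: "('k, 'n) sqmat set"
    and e :: "'k \<Rightarrow> complex"
  assumes e: "nontrivial_additive_character e"
    and g: "lie_subalgebra \<gg>" "\<gg> \<subseteq> ut" and h: "lie_subalgebra \<hh>" "\<hh> \<subseteq> \<gg>"
    and l: "l \<in> dual_space \<gg>" "polarization \<gg> l \<pp>"
    and m: "m \<in> dual_space \<hh>" "polarization \<hh> m \<qq>"
begin

lemma h_ut: "\<hh> \<subseteq> ut"
  using g h by auto

lemmas p_lie = pol_lie[OF char_ge g l] and q_lie = pol_lie[OF char_ge h(1) h_ut m]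

lemma mexp_q_h: "mexp ` \<qq> \<subseteq> mexp ` \<hh>" and mexp_h_g: "mexp ` \<hh> \<subseteq> mexp ` \<gg>"
  and mexp_p_g: "mexp ` \<pp> \<subseteq> mexp ` \<gg>"
  using p_lie(3) q_lie(3) h(2) by auto

lemma compatible_glue:
  assumes u: "u \<in> mexp ` \<gg>" and comp: "compatible_at u l \<pp> m \<qq>"
  obtains n w v where "n \<in> dual_space \<gg>" "w \<in> mexp ` \<pp>" "v \<in> mexp ` \<qq>"
    "n = coadjoint \<gg> (u ** w) l" "restrict n \<hh> = coadjoint \<hh> v m"
proof -
  note inv = mexp_image_inv[OF char_ge g u]
  have lin: "lin_on \<gg> l" "lin_on \<hh> m" using l m by (auto simp: dual_space_eq)
  define A where "A = (\<lambda>a. u ** a ** matrix_inv u) ` \<pp>"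
  have cancel: "matrix_inv u ** (u ** a ** matrix_inv u) ** u = a" for a
  proof -
    have "matrix_inv u ** (u ** a ** matrix_inv u) ** u = (matrix_inv u ** u) ** a ** (matrix_inv u ** u)"
      by (simp only: matrix_mul_assoc)
    then show ?thesis by (simp add: inv)
  qed
  have A: "mat.subspace A"
    unfolding A_def mat.subspace_def
  proof (intro conjI ballI allI)
    show "0 \<in> (\<lambda>a. u ** a ** matrix_inv u) ` \<pp>"
      using mat.subspace_0[OF p_lie(2)] by (auto intro!: image_eqI[of _ _ 0])
    fix x y c assume "x \<in> (\<lambda>a. u ** a ** matrix_inv u) ` \<pp>" "y \<in> (\<lambda>a. u ** a ** matrix_inv u) ` \<pp>"
    then obtain a b where ab: "x = u ** a ** matrix_inv u" "y = u ** b ** matrix_inv u" "a \<in> \<pp>" "b \<in> \<pp>"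
      by blast
    then show "x + y \<in> (\<lambda>a. u ** a ** matrix_inv u) ` \<pp>"
      using mat.subspace_add[OF p_lie(2) ab(3,4)]
      by (intro image_eqI[of _ _ "a + b"]) (simp_all add: matrix_distribs)
  next
    fix x c assume "x \<in> (\<lambda>a. u ** a ** matrix_inv u) ` \<pp>"
    then obtain a where a: "x = u ** a ** matrix_inv u" "a \<in> \<pp>" by blast
    then show "mscale c x \<in> (\<lambda>a. u ** a ** matrix_inv u) ` \<pp>"
      using mat.subspace_scale[OF p_lie(2) a(2)]
      by (intro image_eqI[of _ _ "mscale c a"]) (simp_all add: mscale_mult_left mscale_mult_right)
  qed
  have linA: "lin_on A (\<lambda>y. l (matrix_inv u ** y ** u))"
    unfolding lin_on_def A_def using p_lie(3)
    by (auto simp: matrix_add_ldistrib matrix_add_rdistrib mscale_mult_left mscale_mult_right cancel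
        lin_onD[OF lin(1)] subset_iff)
  have linq: "lin_on \<qq> m" using lin(2) q_lie(3) by (rule lin_on_subset)
  have "l (matrix_inv u ** x ** u) = m x" if "x \<in> A" "x \<in> \<qq>" for x
    using comp that by (auto simp: A_def compatible_at_def cancel)
  from glue_forms[OF A linA q_lie(2) linq this]
  obtain k where k: "lin_on UNIV k" "\<And>x. x \<in> A \<Longrightarrow> k x = l (matrix_inv u ** x ** u)"
    "\<And>x. x \<in> \<qq> \<Longrightarrow> k x = m x" by blast
  define n where "n = restrict k \<gg>"
  have dual: "restrict k V \<in> dual_space V" if "mat.subspace V" for V
    using lin_onD[OF k(1)] mat.subspace_add[OF that] mat.subspace_scale[OF that]
    by (auto simp: dual_space_eq lin_on_def)
  have sub: "mat.subspace \<gg>" "mat.subspace \<hh>" using g h by (auto simp: lie_subalgebra_def)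
  have n: "n \<in> dual_space \<gg>" unfolding n_def by (rule dual[OF sub(1)])
  have n': "coadjoint \<gg> (matrix_inv u) n \<in> dual_space \<gg>"
    by (rule coadjoint_dual[OF char_ge g inv(1) n])
  \<comment> \<open>Moved back by the inverse of \<open>u\<close>, the glued form agrees with
    \<open>l\<close> on \<open>\<pp>\<close> itself, so \<open>pol_orbit\<close> applies
    directly.\<close>
  have "coadjoint \<gg> (matrix_inv u) n a = l a" if "a \<in> \<pp>" for a
  proof -
    have "a \<in> \<gg>" using that p_lie(3) by auto
    then show ?thesis
      using mexp_image_conj(1)[OF char_ge g u] k(2)[of "u ** a ** matrix_inv u"] that
      by (simp add: coadjoint_apply inv(4) n_def cancel A_def)
  qed
  from pol_orbit[OF char_ge g l e n' this]
  obtain w where w: "w \<in> mexp ` \<pp>" "coadjoint \<gg> (matrix_inv u) n = coadjoint \<gg> w l" by blast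
  then have wg: "w \<in> mexp ` \<gg>" using mexp_p_g by auto
  have "n = coadjoint \<gg> u (coadjoint \<gg> (matrix_inv u) n)"
    by (rule coadjoint_inv(2)[OF char_ge g u n, symmetric])
  then have nw: "n = coadjoint \<gg> (u ** w) l"
    by (simp add: w(2) coadjoint_mult[OF char_ge g u wg])
  have res: "restrict n \<hh> = restrict k \<hh>" using h(2) by (simp add: n_def Int_absorb1)
  have "restrict k \<hh> a = m a" if "a \<in> \<qq>" for a using that q_lie(3) k(3) by auto
  from pol_orbit[OF char_ge h(1) h_ut m e dual[OF sub(2)] this]
  obtain v where "v \<in> mexp ` \<qq>" "restrict k \<hh> = coadjoint \<hh> v m" by blast
  then show ?thesis using that n w(1) nw res by metis
qed

text \<open>On \<open>\<hh>\<close> the common form is \<open>v m\<close>. Translating by the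
  inverse of \<open>v\<close> turns it into \<open>m\<close>, whose polarization is
  \<open>\<qq>\<close>; hence the witness \<open>matrix_inv v ** u\<close>.\<close>

lemma compatible_of_intersection:
  assumes u: "u \<in> mexp ` \<gg>" and v: "v \<in> mexp ` \<hh>"
    and eq: "restrict (coadjoint \<gg> u l) \<hh> = coadjoint \<hh> v m"
  shows "compatible_at (matrix_inv v ** u) l \<pp> m \<qq>"
  unfolding compatible_at_def
proof (intro ballI impI)
  have vg: "v \<in> mexp ` \<gg>" using v mexp_h_g by auto
  note inv = mexp_image_inv[OF char_ge g u] mexp_image_inv[OF char_ge h(1) h_ut v]
  fix a assume a: "a \<in> \<pp>"
  have ag: "a \<in> \<gg>" using a p_lie(3) by auto
  have "(matrix_inv v ** u) ** (matrix_inv u ** v) = matrix_inv v ** (u ** matrix_inv u) ** v"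
    by (simp only: matrix_mul_assoc)
  then have invu: "matrix_inv (matrix_inv v ** u) = matrix_inv u ** v"
    by (intro matrix_inv_eqI) (simp add: inv)
  define y where "y = u ** a ** matrix_inv u"
  have eqy: "(matrix_inv v ** u) ** a ** matrix_inv (matrix_inv v ** u) = matrix_inv v ** y ** v"
    unfolding invu y_def by (simp only: matrix_mul_assoc)
  assume "(matrix_inv v ** u) ** a ** matrix_inv (matrix_inv v ** u) \<in> \<qq>"
  then have q: "matrix_inv v ** y ** v \<in> \<qq>" by (simp only: eqy)
  then have "v ** (matrix_inv v ** y ** v) ** matrix_inv v \<in> \<hh>"
    using mexp_image_conj(1)[OF char_ge h(1) h_ut v] q_lie(3) by auto
  moreover have "v ** (matrix_inv v ** y ** v) ** matrix_inv v = (v ** matrix_inv v) ** y ** (v ** matrix_inv v)"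
    by (simp only: matrix_mul_assoc)
  ultimately have yh: "y \<in> \<hh>" by (simp add: inv)
  have "m (matrix_inv v ** y ** v) = coadjoint \<hh> v m y" using yh by (simp add: coadjoint_apply)
  also have "\<dots> = coadjoint \<gg> u l y" using eq yh by (metis restrict_apply')
  also have "\<dots> = l (matrix_inv u ** y ** u)" using yh h(2) by (auto simp: coadjoint_apply)
  also have "matrix_inv u ** y ** u = (matrix_inv u ** u) ** a ** (matrix_inv u ** u)"
    unfolding y_def by (simp only: matrix_mul_assoc)
  also have "\<dots> = a" by (simp add: inv)
  finally show "m ((matrix_inv v ** u) ** a ** matrix_inv (matrix_inv v ** u)) = l a"
    by (simp only: eqy)
qed

text \<open>Injectivity of \<open>exp\<close> on \<open>ut\<close> turns \<open>r u = u s\<close>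
  into a relation between logarithms. Equality of characters only compares values of
  \<open>e\<close>; testing it on all scalar multiples of a vector recovers the forms, because
  \<open>e\<close> is nontrivial.\<close>

lemma compatible_characters_iff:
  assumes u: "u \<in> mexp ` \<gg>"
  shows "(\<forall>s\<in>mexp ` \<pp>. \<forall>r\<in>mexp ` \<qq>. r ** u = u ** s \<longrightarrow>
      polarization_character e m \<qq> r = polarization_character e l \<pp> s) \<longleftrightarrow> compatible_at u l \<pp> m \<qq>"
    (is "?L \<longleftrightarrow> ?R")
proof
  note inv = mexp_image_inv[OF char_ge g u]
  have conj: "mexp b ** u = u ** mexp a \<longleftrightarrow> b = u ** a ** matrix_inv u" if "a \<in> \<pp>" "b \<in> \<qq>" for a b
  proof -
    have ag: "a \<in> \<gg>" using that p_lie(3) by auto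
    have *: "mexp (u ** a ** matrix_inv u) = u ** mexp a ** matrix_inv u"
      by (rule mexp_conj[OF char_ge inv(3)])
    have "mexp b ** u = u ** mexp a \<longleftrightarrow> mexp b = u ** mexp a ** matrix_inv u"
      by (metis inv(2,3) matrix_mul_assoc matrix_mul_rid)
    also have "\<dots> \<longleftrightarrow> b = u ** a ** matrix_inv u"
      using mexp_inj[of b "u ** a ** matrix_inv u"] mexp_image_conj(1)[OF char_ge g u ag] that q_lie(4) g(2)
      unfolding *[symmetric] by auto
    finally show ?thesis .
  qed
  note pc = polarization_character_mexp[OF char_ge g l]
    polarization_character_mexp[OF char_ge h(1) h_ut m]
  {
    assume R: ?R
    show ?L
    proof (intro ballI impI)
      fix s r assume "s \<in> mexp ` \<pp>" "r \<in> mexp ` \<qq>" and eq: "r ** u = u ** s"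
      then obtain a b where ab: "a \<in> \<pp>" "b \<in> \<qq>" "s = mexp a" "r = mexp b" by blast
      then have "b = u ** a ** matrix_inv u" using conj eq by simp
      then show "polarization_character e m \<qq> r = polarization_character e l \<pp> s"
        using R ab by (auto simp: pc compatible_at_def)
    qed
  next
    assume L: ?L
    show ?R
      unfolding compatible_at_def
    proof (intro ballI impI)
      fix a assume a: "a \<in> \<pp>" "u ** a ** matrix_inv u \<in> \<qq>"
      define b where "b = u ** a ** matrix_inv u"
      have bq: "b \<in> \<qq>" using a by (simp add: b_def)
      have *: "e (m (mscale c b)) = e (l (mscale c a))" for c
      proof -
        have ca: "mscale c a \<in> \<pp>" "mscale c b \<in> \<qq>"
          using a(1) bq mat.subspace_scale p_lie(2) q_lie(2) by auto
        have "mscale c b = u ** mscale c a ** matrix_inv u"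
          by (simp add: b_def mscale_mult_left mscale_mult_right)
        then have "mexp (mscale c b) ** u = u ** mexp (mscale c a)" using conj[OF ca] by simp
        then show ?thesis using L ca by (auto simp: pc)
      qed
      have lin: "lin_on \<gg> l" "lin_on \<hh> m" using l m by (auto simp: dual_space_eq)
      have mem: "a \<in> \<gg>" "b \<in> \<hh>" using a bq p_lie(3) q_lie(3) by auto
      show "m (u ** a ** matrix_inv u) = l a"
      proof (rule ccontr)
        assume neq: "m (u ** a ** matrix_inv u) \<noteq> l a"
        define d where "d = m b - l a"
        have d: "d \<noteq> 0" using neq by (simp add: d_def b_def)
        from e obtain c0 where c0: "e c0 \<noteq> 1" by (auto simp: nontrivial_additive_character_def)
        have "e (c * m b) = e (c * l a)" for c
          using *[of c] mem by (simp add: lin_onD(2)[OF lin(1)] lin_onD(2)[OF lin(2)])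
        \<comment> \<open>At this scalar the two arguments of \<open>e\<close> differ by exactly
          \<open>c0\<close>, where \<open>e c0 \<noteq> 1\<close>.\<close>
        from this[of "c0 / d"] have "e (c0 / d * (d + l a)) = e (c0 / d * l a)" by (simp add: d_def)
        moreover have "c0 / d * (d + l a) = c0 + c0 / d * l a" using d by (simp add: field_simps)
        ultimately have "e c0 * e (c0 / d * l a) = e (c0 / d * l a)"
          using e by (simp add: nontrivial_additive_character_def)
        then show False using c0 e by (simp add: nontrivial_additive_character_def)
      qed
    qed
  }
qed

lemma compatible_orbits_iff:
  assumes \<Omega>: "\<Omega> \<in> coadjoint_orbits \<gg>" "l \<in> \<Omega>" and \<omega>: "\<omega> \<in> coadjoint_orbits \<hh>" "m \<in> \<omega>"
  shows "(\<exists>u\<in>mexp ` \<gg>. compatible_at u l \<pp> m \<qq>) \<longleftrightarrow> \<Omega> \<inter> dual_proj \<hh> -` \<omega> \<noteq> {}"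
proof -
  \<comment> \<open>An orbit is rebased at an arbitrary element, because \<open>l\<close> and
    \<open>m\<close> need not be the forms by which the orbits are given.\<close>
  have orbit: "\<Theta> = (\<lambda>u. coadjoint V u k) ` mexp ` V"
    if V: "lie_subalgebra V" "V \<subseteq> ut" and T: "\<Theta> \<in> coadjoint_orbits V" "k \<in> \<Theta>" for V \<Theta> and k :: "('k, 'n) sqmat \<Rightarrow> 'k"
  proof -
    obtain k0 where k0: "k0 \<in> dual_space V" "\<Theta> = (\<lambda>u. coadjoint V u k0) ` mexp ` V"
      using T(1) by (auto simp: coadjoint_orbits_def coadjoint_orbit_def)
    obtain v where v: "v \<in> mexp ` V" "k = coadjoint V v k0" using T(2) k0(2) by blast
    note iv = mexp_image_inv[OF char_ge V v(1)]
    show ?thesis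
      unfolding k0(2)
    proof (intro subset_antisym image_subsetI)
      fix u assume u: "u \<in> mexp ` V"
      have "coadjoint V u k0 = coadjoint V (u ** matrix_inv v) k"
        by (simp only: v(2) coadjoint_mult[OF char_ge V u iv(1)] coadjoint_inv(1)[OF char_ge V v(1) k0(1)])
      then show "coadjoint V u k0 \<in> (\<lambda>u. coadjoint V u k) ` mexp ` V"
        using mexp_image_mult[OF char_ge V u iv(1)] by (rule image_eqI)
      have "coadjoint V u k = coadjoint V (u ** v) k0"
        by (simp only: v(2) coadjoint_mult[OF char_ge V u v(1)])
      then show "coadjoint V u k \<in> (\<lambda>u. coadjoint V u k0) ` mexp ` V"
        using mexp_image_mult[OF char_ge V u v(1)] by (rule image_eqI)
    qed
  qed
  note O = orbit[OF g \<Omega>] orbit[OF h(1) h_ut \<omega>]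
  show ?thesis
  proof
    assume "\<exists>u\<in>mexp ` \<gg>. compatible_at u l \<pp> m \<qq>"
    then obtain u where u: "u \<in> mexp ` \<gg>" "compatible_at u l \<pp> m \<qq>" by blast
    obtain n w v where n: "w \<in> mexp ` \<pp>" "v \<in> mexp ` \<qq>"
      "n = coadjoint \<gg> (u ** w) l" "restrict n \<hh> = coadjoint \<hh> v m"
      by (rule compatible_glue[OF u])
    have "u ** w \<in> mexp ` \<gg>" using u(1) n(1) mexp_p_g by (intro mexp_image_mult char_ge g) auto
    then have "n \<in> \<Omega>" by (subst O(1)) (use n(3) in auto)
    moreover have "dual_proj \<hh> n \<in> \<omega>"
      by (subst O(2)) (use n(2,4) mexp_q_h in \<open>auto simp: dual_proj_def\<close>)
    ultimately show "\<Omega> \<inter> dual_proj \<hh> -` \<omega> \<noteq> {}" by auto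
  next
    assume "\<Omega> \<inter> dual_proj \<hh> -` \<omega> \<noteq> {}"
    then obtain n where n: "n \<in> \<Omega>" "restrict n \<hh> \<in> \<omega>" by (auto simp: dual_proj_def)
    obtain u where u: "u \<in> mexp ` \<gg>" "n = coadjoint \<gg> u l" using n(1) O(1) by blast
    obtain v where v: "v \<in> mexp ` \<hh>" "restrict n \<hh> = coadjoint \<hh> v m" using n(2) O(2) by blast
    have "matrix_inv v ** u \<in> mexp ` \<gg>"
      using u(1) mexp_image_inv(1)[OF char_ge h(1) h_ut v(1)] mexp_h_g by (intro mexp_image_mult char_ge g) auto
    moreover have "compatible_at (matrix_inv v ** u) l \<pp> m \<qq>"
      by (rule compatible_of_intersection[OF u(1) v(1)]) (use u v in simp)
    ultimately show "\<exists>u\<in>mexp ` \<gg>. compatible_at u l \<pp> m \<qq>" by blast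
  qed
qed

end

text \<open>Gluing \<open>l\<close> with itself gives \<open>u w l = v l\<close> with
  \<open>w\<close> and \<open>v\<close> in \<open>P\<close>. So the inverse of \<open>v\<close>
  times \<open>u w\<close> stabilizes \<open>l\<close>, lies in \<open>P\<close>, and forces
  \<open>u\<close> into \<open>P\<close>.\<close>

lemma compatible_self:
  fixes \<gg> \<pp> :: "('k, 'n) sqmat set" and e :: "'k \<Rightarrow> complex"
  assumes e: "nontrivial_additive_character e"
    and g: "lie_subalgebra \<gg>" "\<gg> \<subseteq> ut"
    and l: "l \<in> dual_space \<gg>" "polarization \<gg> l \<pp>"
    and u: "u \<in> mexp ` \<gg>" "compatible_at u l \<pp> l \<pp>"
  shows "u \<in> mexp ` \<pp>"
proof -
  note p = pol_lie[OF char_ge g l]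
  obtain n w v where n: "n \<in> dual_space \<gg>" "w \<in> mexp ` \<pp>" "v \<in> mexp ` \<pp>"
    "n = coadjoint \<gg> (u ** w) l" "restrict n \<gg> = coadjoint \<gg> v l"
    by (rule compatible_glue[OF e g g(1) order_refl l l u])
  have wv: "w \<in> mexp ` \<gg>" "v \<in> mexp ` \<gg>" using n(2,3) p(3) by auto
  note iv = mexp_image_inv[OF char_ge p(1,4) n(3)] and iw = mexp_image_inv[OF char_ge p(1,4) n(2)]
  have uw: "u ** w \<in> mexp ` \<gg>" by (rule mexp_image_mult[OF char_ge g u(1) wv(1)])
  have ivg: "matrix_inv v \<in> mexp ` \<gg>" by (rule mexp_image_inv(1)[OF char_ge g wv(2)])
  have "restrict n \<gg> = n" using n(1) by (auto simp: dual_space_eq extensional_restrict)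
  then have "coadjoint \<gg> (u ** w) l = coadjoint \<gg> v l" using n(4,5) by simp
  then have "coadjoint \<gg> (matrix_inv v ** (u ** w)) l = l"
    by (simp add: coadjoint_mult[OF char_ge g ivg uw] coadjoint_inv(1)[OF char_ge g wv(2) l(1)])
  from stabilizer_mem[OF char_ge g l mexp_image_mult[OF char_ge g ivg uw] this]
  have st: "matrix_inv v ** (u ** w) \<in> mexp ` \<pp>" .
  have "v ** (matrix_inv v ** (u ** w)) ** matrix_inv w \<in> mexp ` \<pp>"
    by (intro mexp_image_mult[OF char_ge p(1,4)] n(3) st iw(1))
  moreover have "v ** (matrix_inv v ** (u ** w)) ** matrix_inv w = (v ** matrix_inv v) ** u ** (w ** matrix_inv w)"
    by (simp only: matrix_mul_assoc)
  ultimately show ?thesis by (simp add: iv iw)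
qed

end

section \<open>Homomorphisms of representations and complete reducibility\<close>

definition rep_hom ::
  "('g, 'm) monoid_scheme \<Rightarrow> ('g, 'v::ab_group_add) rep \<Rightarrow> ('g, 'w::ab_group_add) rep \<Rightarrow> ('v \<Rightarrow> 'w) \<Rightarrow> bool" where
  "rep_hom G R S \<phi> \<longleftrightarrow>
     (\<forall>v\<in>rep_space R. \<phi> v \<in> rep_space S) \<and>
     (\<forall>v\<in>rep_space R. \<forall>w\<in>rep_space R. \<phi> (v + w) = \<phi> v + \<phi> w) \<and>
     (\<forall>c. \<forall>v\<in>rep_space R. \<phi> (rep_scale R c v) = rep_scale S c (\<phi> v)) \<and>
     (\<forall>g\<in>carrier G. \<forall>v\<in>rep_space R. \<phi> (rep_act R g v) = rep_act S g (\<phi> v))"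

lemma rep_homD:
  assumes "rep_hom G R S \<phi>"
  shows "v \<in> rep_space R \<Longrightarrow> \<phi> v \<in> rep_space S"
    and "v \<in> rep_space R \<Longrightarrow> w \<in> rep_space R \<Longrightarrow> \<phi> (v + w) = \<phi> v + \<phi> w"
    and "v \<in> rep_space R \<Longrightarrow> \<phi> (rep_scale R c v) = rep_scale S c (\<phi> v)"
    and "g \<in> carrier G \<Longrightarrow> v \<in> rep_space R \<Longrightarrow> \<phi> (rep_act R g v) = rep_act S g (\<phi> v)"
  using assms by (auto simp: rep_hom_def)

lemma representationD:
  assumes "representation G R"
  shows "vector_space (rep_scale R)" and "module.subspace (rep_scale R) (rep_space R)"
    and "g \<in> carrier G \<Longrightarrow> v \<in> rep_space R \<Longrightarrow> rep_act R g v \<in> rep_space R"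
    and "g \<in> carrier G \<Longrightarrow> v \<in> rep_space R \<Longrightarrow> w \<in> rep_space R \<Longrightarrow>
      rep_act R g (v + w) = rep_act R g v + rep_act R g w"
    and "g \<in> carrier G \<Longrightarrow> v \<in> rep_space R \<Longrightarrow>
      rep_act R g (rep_scale R c v) = rep_scale R c (rep_act R g v)"
    and "v \<in> rep_space R \<Longrightarrow> rep_act R \<one>\<^bsub>G\<^esub> v = v"
    and "g \<in> carrier G \<Longrightarrow> h \<in> carrier G \<Longrightarrow> v \<in> rep_space R \<Longrightarrow>
      rep_act R (g \<otimes>\<^bsub>G\<^esub> h) v = rep_act R g (rep_act R h v)"
  using assms by (auto simp: representation_def)

lemma rep_hom_zero:
  assumes R: "representation G R" and S: "representation G S" and \<phi>: "rep_hom G R S \<phi>"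
  shows "\<phi> 0 = 0"
proof -
  interpret R: vector_space "rep_scale R" by (rule representationD(1)[OF R])
  have "0 \<in> rep_space R" using R.subspace_0[OF representationD(2)[OF R]] .
  from rep_homD(2)[OF \<phi> this this] show ?thesis by simp
qed

lemma rep_hom_sum:
  assumes R: "representation G R" and S: "representation G S" and \<phi>: "rep_hom G R S \<phi>"
    and f: "\<And>i. i \<in> A \<Longrightarrow> f i \<in> rep_space R"
  shows "\<phi> (sum f A) = (\<Sum>i\<in>A. \<phi> (f i))"
proof -
  interpret R: vector_space "rep_scale R" by (rule representationD(1)[OF R])
  show ?thesis using f
    by (induction A rule: infinite_finite_induct)
      (auto simp: rep_hom_zero[OF R S \<phi>] rep_homD(2)[OF \<phi>] R.subspace_sum[OF representationD(2)[OF R]])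
qed

lemma rep_act_sum:
  assumes R: "representation G R" and g: "g \<in> carrier G"
    and f: "\<And>i. i \<in> A \<Longrightarrow> f i \<in> rep_space R"
  shows "rep_act R g (sum f A) = (\<Sum>i\<in>A. rep_act R g (f i))"
proof -
  interpret R: vector_space "rep_scale R" by (rule representationD(1)[OF R])
  have "0 \<in> rep_space R" by (rule R.subspace_0[OF representationD(2)[OF R]])
  then have "rep_act R g 0 = 0" using representationD(4)[OF R g, of 0 0] by simp
  then show ?thesis using f
    by (induction A rule: infinite_finite_induct)
      (auto simp: representationD(4)[OF R g] R.subspace_sum[OF representationD(2)[OF R]])
qed

lemma representation_subrep:
  assumes "representation G R" "invariant_subspace G R W"
  shows "representation G (subrep R W)"
  using assms by (auto simp: representation_def invariant_subspace_def subset_iff)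

lemma invariant_subspace_subrep:
  "invariant_subspace G (subrep R U) W \<longleftrightarrow> W \<subseteq> U \<and> module.subspace (rep_scale R) W \<and>
     (\<forall>g\<in>carrier G. \<forall>w\<in>W. rep_act R g w \<in> W)"
  by (auto simp: invariant_subspace_def)

text \<open>Maschke's averaging: the conjugates of a linear projection onto \<open>W\<close> all fix
  \<open>W\<close> and map into it, and so does their mean, which is moreover equivariant.\<close>

lemma averaged_projection:
  assumes G: "group G" "finite (carrier G)" and R: "representation G R"
    and W: "invariant_subspace G R W"
  obtains \<pi> where "rep_hom G R R \<pi>" "\<And>v. v \<in> rep_space R \<Longrightarrow> \<pi> v \<in> W" "\<And>w. w \<in> W \<Longrightarrow> \<pi> w = w"
proof -
  interpret G: group G by fact
  interpret R: vector_space "rep_scale R" by (rule representationD(1)[OF R])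
  interpret vector_space_pair "rep_scale R" "rep_scale R" ..
  note [simp] = representationD(3-7)[OF R]
  have sW: "R.subspace W" "W \<subseteq> rep_space R" "\<And>g w. g \<in> carrier G \<Longrightarrow> w \<in> W \<Longrightarrow> rep_act R g w \<in> W"
    using W by (auto simp: invariant_subspace_def)
  obtain p where p: "range p \<subseteq> W" "Vector_Spaces.linear (rep_scale R) (rep_scale R) p"
    "\<And>v. v \<in> W \<Longrightarrow> p v = v"
    using linear_exists_left_inverse_on[OF R.linear_id sW(1)] by auto
  have pW: "p v \<in> W" for v using p(1) by auto
  have pR: "p v \<in> rep_space R" for v using pW sW(2) by auto
  define n where "n = inverse (of_nat (card (carrier G)) :: complex)"
  have card: "card (carrier G) > 0" using G by (auto simp: card_gt_0_iff)
  define t where "t a v = rep_act R a (p (rep_act R (inv\<^bsub>G\<^esub> a) v))" for a v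
  have tW: "t a v \<in> W" if "a \<in> carrier G" for a v using that pW sW(3) by (simp add: t_def)
  have tR: "t a v \<in> rep_space R" if "a \<in> carrier G" for a v using tW[OF that] sW(2) by auto
  define \<pi> where "\<pi> v = rep_scale R n (\<Sum>a\<in>carrier G. t a v)" for v
  have "\<pi> v \<in> W" for v
    unfolding \<pi>_def by (intro R.subspace_scale R.subspace_sum sW(1) tW)
  moreover have "\<pi> w = w" if "w \<in> W" for w
  proof -
    have "t a w = w" if a: "a \<in> carrier G" for a
    proof -
      have wR: "w \<in> rep_space R" using \<open>w \<in> W\<close> sW(2) by auto
      have "t a w = rep_act R a (rep_act R (inv\<^bsub>G\<^esub> a) w)"
        using a \<open>w \<in> W\<close> sW(3) p(3) by (simp add: t_def)
      also have "\<dots> = rep_act R (a \<otimes>\<^bsub>G\<^esub> inv\<^bsub>G\<^esub> a) w"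
        by (rule representationD(7)[OF R, symmetric]) (use a wR in auto)
      finally show ?thesis using a wR by simp
    qed
    then show ?thesis
      using card by (simp add: \<pi>_def R.sum_constant_scale n_def)
  qed
  moreover have "rep_hom G R R \<pi>"
    unfolding rep_hom_def
  proof (intro conjI ballI allI)
    fix v assume v: "v \<in> rep_space R"
    show "\<pi> v \<in> rep_space R" using calculation(1) sW(2) by auto
    fix w assume w: "w \<in> rep_space R"
    have "t a (v + w) = t a v + t a w" if "a \<in> carrier G" for a
      using that v w pR by (simp add: t_def linear_add[OF p(2)])
    then show "\<pi> (v + w) = \<pi> v + \<pi> w"
      by (simp add: \<pi>_def sum.distrib R.scale_right_distrib)
  next
    fix c v assume v: "v \<in> rep_space R"
    have "t a (rep_scale R c v) = rep_scale R c (t a v)" if "a \<in> carrier G" for a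
      using that v pR by (simp add: t_def linear_scale[OF p(2)])
    then show "\<pi> (rep_scale R c v) = rep_scale R c (\<pi> v)"
      by (simp add: \<pi>_def R.scale_sum_right[symmetric] mult.commute)
  next
    fix h v assume h: "h \<in> carrier G" and v: "v \<in> rep_space R"
    have "bij_betw ((\<otimes>\<^bsub>G\<^esub>) h) (carrier G) (carrier G)"
      by (rule bij_betwI[of _ _ _ "(\<otimes>\<^bsub>G\<^esub>) (inv\<^bsub>G\<^esub> h)"])
        (use h in \<open>auto simp: G.m_assoc[symmetric]\<close>)
    then have "(\<Sum>a\<in>carrier G. t a (rep_act R h v)) = (\<Sum>b\<in>carrier G. t (h \<otimes>\<^bsub>G\<^esub> b) (rep_act R h v))"
      by (rule sum.reindex_bij_betw[symmetric])
    also have "\<dots> = (\<Sum>b\<in>carrier G. rep_act R h (t b v))"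
    proof (rule sum.cong[OF refl])
      fix b assume b: "b \<in> carrier G"
      have "rep_act R (inv\<^bsub>G\<^esub> (h \<otimes>\<^bsub>G\<^esub> b)) (rep_act R h v) = rep_act R (inv\<^bsub>G\<^esub> (h \<otimes>\<^bsub>G\<^esub> b) \<otimes>\<^bsub>G\<^esub> h) v"
        using h v b by simp
      also have "inv\<^bsub>G\<^esub> (h \<otimes>\<^bsub>G\<^esub> b) \<otimes>\<^bsub>G\<^esub> h = inv\<^bsub>G\<^esub> b"
        using h b by (simp add: G.inv_mult_group G.m_assoc)
      finally show "t (h \<otimes>\<^bsub>G\<^esub> b) (rep_act R h v) = rep_act R h (t b v)"
        using h b pR by (simp add: t_def)
    qed
    also have "\<dots> = rep_act R h (\<Sum>b\<in>carrier G. t b v)"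
      by (rule rep_act_sum[OF R h tR, symmetric])
    finally have "(\<Sum>a\<in>carrier G. t a (rep_act R h v)) = rep_act R h (\<Sum>b\<in>carrier G. t b v)" .
    moreover have "(\<Sum>b\<in>carrier G. t b v) \<in> rep_space R"
      by (intro R.subspace_sum[OF representationD(2)[OF R]] tR)
    ultimately show "\<pi> (rep_act R h v) = rep_act R h (\<pi> v)"
      using h by (simp add: \<pi>_def)
  qed
  ultimately show ?thesis using that by blast
qed

text \<open>The complement is the kernel of the averaged projection.\<close>

lemma invariant_complement:
  assumes G: "group G" "finite (carrier G)" and R: "representation G R"
    and W: "invariant_subspace G R W"
  obtains W' where "invariant_subspace G R W'" "W \<inter> W' = {0}"
    "\<And>v. v \<in> rep_space R \<Longrightarrow> \<exists>w\<in>W. \<exists>w'\<in>W'. v = w + w'"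
proof -
  interpret R: vector_space "rep_scale R" by (rule representationD(1)[OF R])
  obtain \<pi> where \<pi>: "rep_hom G R R \<pi>" "\<And>v. v \<in> rep_space R \<Longrightarrow> \<pi> v \<in> W" "\<And>w. w \<in> W \<Longrightarrow> \<pi> w = w"
    by (rule averaged_projection[OF G R W]) blast
  note sR = representationD(2)[OF R]
  have sW: "R.subspace W" "W \<subseteq> rep_space R" using W by (auto simp: invariant_subspace_def)
  define W' where "W' = {v \<in> rep_space R. \<pi> v = 0}"
  have act0: "rep_act R g 0 = 0" if "g \<in> carrier G" for g
    using rep_act_sum[OF R that, of "{}"] by simp
  have "invariant_subspace G R W'"
    unfolding invariant_subspace_def R.subspace_def W'_def
    using R.subspace_0[OF sR] R.subspace_add[OF sR] R.subspace_scale[OF sR]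
      rep_homD[OF \<pi>(1)] rep_hom_zero[OF R R \<pi>(1)] representationD(3)[OF R] act0
    by auto
  moreover have "W \<inter> W' = {0}"
    using \<pi>(3) R.subspace_0[OF sW(1)] R.subspace_0[OF sR] rep_hom_zero[OF R R \<pi>(1)]
    by (auto simp: W'_def)
  moreover have "\<exists>w\<in>W. \<exists>w'\<in>W'. v = w + w'" if v: "v \<in> rep_space R" for v
  proof (intro bexI)
    show w: "\<pi> v \<in> W" using \<pi>(2) v .
    have d: "v - \<pi> v \<in> rep_space R" using v w sW(2) by (intro R.subspace_diff[OF sR]) auto
    have "\<pi> (v - \<pi> v + \<pi> v) = \<pi> (v - \<pi> v) + \<pi> (\<pi> v)"
      using d w sW(2) by (intro rep_homD(2)[OF \<pi>(1)]) auto
    then have "\<pi> (v - \<pi> v) = 0" using \<pi>(3)[OF w] by simp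
    then show "v - \<pi> v \<in> W'" using d by (simp add: W'_def)
  qed simp
  ultimately show ?thesis using that by blast
qed

lemma irreducible_decomposition_insert:
  assumes R: "representation G R" and U: "invariant_subspace G R U"
    and W: "invariant_subspace G R W" "W \<subseteq> U" "irreducible_rep G (subrep R W)"
    and W': "invariant_subspace G R W'" "W' \<subseteq> U" "irreducible_decomposition G (subrep R W') \<W>"
    and int: "W \<inter> W' = {0}" and sum: "\<And>v. v \<in> U \<Longrightarrow> \<exists>w\<in>W. \<exists>w'\<in>W'. v = w + w'"
  shows "irreducible_decomposition G (subrep R U) (insert W \<W>)"
proof -
  interpret R: vector_space "rep_scale R" by (rule representationD(1)[OF R])
  have sub: "R.subspace W" "R.subspace W'" using W W' by (auto simp: invariant_subspace_def)
  have fin: "finite \<W>" and dec: "\<And>v. v \<in> W' \<Longrightarrow> \<exists>!f. f \<in> (\<Pi>\<^sub>E W\<in>\<W>. W) \<and> v = (\<Sum>W\<in>\<W>. f W)"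
    and mem: "\<And>X. X \<in> \<W> \<Longrightarrow> X \<subseteq> W'"
    using W'(3) by (auto simp: irreducible_decomposition_def invariant_subspace_subrep)
  have "W \<noteq> {0}" using W(3) by (auto simp: irreducible_rep_def)
  \<comment> \<open>A decomposition is a set of subspaces, so the new summand must differ from the
    old ones: otherwise it would lie in \<open>W'\<close> and be zero.\<close>
  then have notin: "W \<notin> \<W>" using mem[of W] int R.subspace_0[OF sub(1)] by auto
  have "\<exists>!f. f \<in> (\<Pi>\<^sub>E W\<in>insert W \<W>. W) \<and> v = (\<Sum>W\<in>insert W \<W>. f W)" if v: "v \<in> U" for v
  proof -
    obtain w w' where w: "w \<in> W" "w' \<in> W'" "v = w + w'" using sum[OF v] by blast
    obtain f where f: "f \<in> (\<Pi>\<^sub>E W\<in>\<W>. W)" "w' = (\<Sum>W\<in>\<W>. f W)"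
      and uniq: "\<And>g. g \<in> (\<Pi>\<^sub>E W\<in>\<W>. W) \<Longrightarrow> w' = (\<Sum>W\<in>\<W>. g W) \<Longrightarrow> g = f"
      using dec[OF w(2)] by blast
    show ?thesis
    proof (rule ex1I[of _ "f(W := w)"])
      have "(\<Sum>X\<in>\<W>. (f(W := w)) X) = w'" unfolding f(2) using notin by (intro sum.cong) auto
      then show "f(W := w) \<in> (\<Pi>\<^sub>E W\<in>insert W \<W>. W) \<and> v = (\<Sum>X\<in>insert W \<W>. (f(W := w)) X)"
        using f(1) w fin notin by (auto simp: PiE_insert_eq intro!: image_eqI[of _ _ "(w, f)"])
    next
      fix g assume g: "g \<in> (\<Pi>\<^sub>E W\<in>insert W \<W>. W) \<and> v = (\<Sum>W\<in>insert W \<W>. g W)"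
      then have gW: "g W \<in> W" and g\<W>: "\<And>X. X \<in> \<W> \<Longrightarrow> g X \<in> X" by auto
      have s: "(\<Sum>X\<in>\<W>. g X) \<in> W'" using g\<W> mem by (intro R.subspace_sum[OF sub(2)]) auto
      have "w + w' = g W + (\<Sum>X\<in>\<W>. g X)" using g w fin notin by simp
      then have eq: "w - g W = (\<Sum>X\<in>\<W>. g X) - w'" by (simp add: algebra_simps)
      have "w - g W \<in> W" using R.subspace_diff[OF sub(1) w(1) gW] .
      moreover have "w - g W \<in> W'" unfolding eq using R.subspace_diff[OF sub(2) s w(2)] .
      ultimately have "w - g W = 0" using int by blast
      then have gw: "g W = w" "(\<Sum>X\<in>\<W>. g X) = w'" using eq by auto
      have fg: "restrict g \<W> = f" by (rule uniq) (use g\<W> gw in auto)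
      have "g X = (f(W := w)) X" for X
      proof (cases "X \<in> insert W \<W>")
        case True
        then show ?thesis using gw(1) by (auto simp flip: fg)
      next
        case False
        then have "g X = undefined" "f X = undefined"
          using PiE_arb[OF conjunct1[OF g], of X] PiE_arb[OF f(1), of X] by simp_all
        then show ?thesis using False by auto
      qed
      then show "g = f(W := w)" by blast
    qed
  qed
  moreover have "invariant_subspace G (subrep R U) X \<and> irreducible_rep G (subrep R X)" if "X \<in> \<W>" for X
    using W'(3) that subset_trans[OF mem[OF that] W'(2)]
    by (simp add: irreducible_decomposition_def invariant_subspace_subrep)
  ultimately show ?thesis
    using W fin by (auto simp: irreducible_decomposition_def invariant_subspace_def)
qed

text \<open>A nonzero invariant subspace of least dimension is irreducible, and its invariant
  complement has smaller dimension.\<close>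

lemma irreducible_decomposition_exists:
  assumes G: "group G" "finite (carrier G)" and R: "representation G R"
    and B: "finite B" "module.span (rep_scale R) B = UNIV"
  shows "invariant_subspace G R U \<Longrightarrow> \<exists>\<W>. irreducible_decomposition G (subrep R U) \<W>"
proof -
  interpret V: vector_space "rep_scale R" by (rule representationD(1)[OF R])
  obtain C where C: "C \<subseteq> B" "V.independent C" "B \<subseteq> V.span C" by (rule V.maximal_independent_subset)
  have "V.span C = UNIV" using C(3) B(2) V.span_minimal[OF C(3) V.subspace_span] by auto
  then interpret V: finite_dimensional_vector_space "rep_scale R" C
    using C B(1) by unfold_locales (auto intro: finite_subset)
  have spanI: "V.span X = X" if "invariant_subspace G R X" for X
    using that by (simp add: invariant_subspace_def)
  show "invariant_subspace G R U \<Longrightarrow> \<exists>\<W>. irreducible_decomposition G (subrep R U) \<W>"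
  proof (induction "V.dim U" arbitrary: U rule: less_induct)
    case less
    note U = less.prems
    have sU: "V.subspace U" using U by (simp add: invariant_subspace_def)
    show ?case
    proof (cases "U = {0}")
      case True
      then have "irreducible_decomposition G (subrep R U) {}"
        by (auto simp: irreducible_decomposition_def)
      then show ?thesis by blast
    next
      case False
      define I where "I X \<longleftrightarrow> invariant_subspace G R X \<and> X \<subseteq> U \<and> X \<noteq> {0}" for X
      have "I U" using U False by (simp add: I_def)
      then obtain W where W: "I W" "\<And>X. I X \<Longrightarrow> V.dim W \<le> V.dim X"
        using ex_has_least_nat[of I U V.dim] by blast
      have invW: "invariant_subspace G R W" "W \<subseteq> U" "W \<noteq> {0}" using W(1) by (auto simp: I_def)
      have irr: "irreducible_rep G (subrep R W)"
        unfolding irreducible_rep_def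
      proof (intro conjI allI impI)
        show "representation G (subrep R W)" by (rule representation_subrep[OF R invW(1)])
        show "rep_space (subrep R W) \<noteq> {0}" using invW by simp
        fix X assume X: "invariant_subspace G (subrep R W) X"
        then have invX: "invariant_subspace G R X" "X \<subseteq> W"
          using invW by (auto simp: invariant_subspace_def)
        show "X = {0} \<or> X = rep_space (subrep R W)"
        proof (cases "X = {0}")
          case False
          then have "I X" using invX invW by (auto simp: I_def)
          then have "V.dim W \<le> V.dim X" by (rule W(2))
          then show ?thesis
            using V.subspace_dim_equal[of X W] invX invW(1) by (auto simp: invariant_subspace_def)
        qed simp
      qed
      have repU: "representation G (subrep R U)" by (rule representation_subrep[OF R U])
      have "invariant_subspace G (subrep R U) W" using invW by (auto simp: invariant_subspace_def)
      then obtain W' where W': "invariant_subspace G (subrep R U) W'" "W \<inter> W' = {0}"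
        "\<And>v. v \<in> U \<Longrightarrow> \<exists>w\<in>W. \<exists>w'\<in>W'. v = w + w'"
        using invariant_complement[OF G repU] by (metis rep.select_convs(1) rep.update_convs(1) rep.surjective)
      have invW': "invariant_subspace G R W'" "W' \<subseteq> U"
        using W'(1) U by (auto simp: invariant_subspace_def)
      have "W' \<noteq> U" using W'(2) invW by blast
      then have "V.span W' \<subset> V.span U" using invW' U by (auto simp: spanI)
      then have "V.dim W' < V.dim U" by (rule V.dim_psubset)
      then obtain \<W> where "irreducible_decomposition G (subrep R W') \<W>" using less invW' by blast
      from irreducible_decomposition_insert[OF R U invW(1,2) irr invW' this W'(2,3)]
      show ?thesis by blast
    qed
  qed
qed

text \<open>Irreducibility of \<open>T\<close> makes a nonzero homomorphism injective with
  irreducible image. Decomposing an invariant complement of the image completes it to a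
  decomposition that contains a copy of \<open>T\<close>.\<close>

theorem occurs_in_iff_rep_hom:
  assumes G: "group G" "finite (carrier G)" and R: "representation G R"
    and B: "finite B" "module.span (rep_scale R) B = UNIV" and T: "irreducible_rep G T"
  shows "occurs_in G T R \<longleftrightarrow> (\<exists>\<phi>. rep_hom G T R \<phi> \<and> (\<exists>v\<in>rep_space T. \<phi> v \<noteq> 0))"
proof
  have rT: "representation G T" using T by (simp add: irreducible_rep_def)
  interpret V: vector_space "rep_scale R" by (rule representationD(1)[OF R])
  interpret T: vector_space "rep_scale T" by (rule representationD(1)[OF rT])
  note sT = representationD(2)[OF rT] and sR = representationD(2)[OF R]
  have zT: "0 \<in> rep_space T" by (rule T.subspace_0[OF sT])
  have act0: "rep_act R g 0 = 0" "rep_act T g 0 = 0" if "g \<in> carrier G" for g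
    using rep_act_sum[OF R that, of "{}"] rep_act_sum[OF rT that, of "{}"] by simp_all
  {
    assume "occurs_in G T R"
    then obtain \<W> W where dec: "irreducible_decomposition G R \<W>" and W\<W>: "W \<in> \<W>"
      and eqv: "equivalent_reps G T (subrep R W)"
      unfolding occurs_in_def by blast
    have W: "W \<subseteq> rep_space R"
      using dec W\<W> by (simp add: irreducible_decomposition_def invariant_subspace_def)
    obtain \<phi> where \<phi>: "bij_betw \<phi> (rep_space T) W" "rep_hom G T (subrep R W) \<phi>"
      using eqv by (auto simp: equivalent_reps_def rep_hom_def bij_betw_def)
    then have \<phi>R: "rep_hom G T R \<phi>" using W by (auto simp: rep_hom_def)
    obtain v where v: "v \<in> rep_space T" "v \<noteq> 0" using T zT by (auto simp: irreducible_rep_def)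
    have "\<phi> v \<noteq> \<phi> 0" using \<phi>(1) v zT by (auto simp: bij_betw_def inj_on_def)
    then have "\<phi> v \<noteq> 0" using rep_hom_zero[OF rT R \<phi>R] by simp
    then show "\<exists>\<phi>. rep_hom G T R \<phi> \<and> (\<exists>v\<in>rep_space T. \<phi> v \<noteq> 0)" using \<phi>R v by blast
  next
    assume "\<exists>\<phi>. rep_hom G T R \<phi> \<and> (\<exists>v\<in>rep_space T. \<phi> v \<noteq> 0)"
    then obtain \<phi> v0 where \<phi>: "rep_hom G T R \<phi>" and v0: "v0 \<in> rep_space T" "\<phi> v0 \<noteq> 0" by blast
    note \<phi>0 = rep_hom_zero[OF rT R \<phi>]
    define W where "W = \<phi> ` rep_space T"
    \<comment> \<open>Used with \<open>X = {0}\<close> for the kernel and with subspaces of the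
      image for its irreducibility.\<close>
    have pre: "invariant_subspace G T {v \<in> rep_space T. \<phi> v \<in> X}"
      if "V.subspace X" "\<And>g w. g \<in> carrier G \<Longrightarrow> w \<in> X \<Longrightarrow> rep_act R g w \<in> X" for X
      using that zT T.subspace_add[OF sT] T.subspace_scale[OF sT] representationD(3)[OF rT]
        V.subspace_0[OF that(1)] V.subspace_add[OF that(1)] V.subspace_scale[OF that(1)]
      by (auto simp: invariant_subspace_def T.subspace_def rep_homD[OF \<phi>] \<phi>0)
    have "{v \<in> rep_space T. \<phi> v \<in> {0}} = {0}"
    proof -
      have "{v \<in> rep_space T. \<phi> v \<in> {0}} \<noteq> rep_space T" using v0 by auto
      then show ?thesis using pre[of "{0}"] T act0 unfolding irreducible_rep_def by auto
    qed
    then have ker: "v = 0" if "v \<in> rep_space T" "\<phi> v = 0" for v using that by blast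
    have inj: "inj_on \<phi> (rep_space T)"
    proof (rule inj_onI)
      fix v w assume vw: "v \<in> rep_space T" "w \<in> rep_space T" "\<phi> v = \<phi> w"
      have d: "v - w \<in> rep_space T" by (rule T.subspace_diff[OF sT vw(1,2)])
      from rep_homD(2)[OF \<phi> d vw(2)] have "\<phi> (v - w) = 0" using vw(3) by simp
      then show "v = w" using ker[OF d] by simp
    qed
    have invW: "invariant_subspace G R W"
      unfolding invariant_subspace_def V.subspace_def W_def
    proof (intro conjI ballI allI)
      show "0 \<in> \<phi> ` rep_space T" using zT \<phi>0 by (metis imageI)
      show "\<phi> ` rep_space T \<subseteq> rep_space R" using rep_homD(1)[OF \<phi>] by auto
    next
      fix x y assume "x \<in> \<phi> ` rep_space T" "y \<in> \<phi> ` rep_space T"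
      then show "x + y \<in> \<phi> ` rep_space T"
        using rep_homD(2)[OF \<phi>, symmetric] T.subspace_add[OF sT] by auto
    next
      fix c x assume "x \<in> \<phi> ` rep_space T"
      then show "rep_scale R c x \<in> \<phi> ` rep_space T"
        using rep_homD(3)[OF \<phi>, symmetric] T.subspace_scale[OF sT] by auto
    next
      fix g x assume "g \<in> carrier G" "x \<in> \<phi> ` rep_space T"
      then show "rep_act R g x \<in> \<phi> ` rep_space T"
        using rep_homD(4)[OF \<phi>, symmetric] representationD(3)[OF rT] by auto
    qed
    have irr: "irreducible_rep G (subrep R W)"
      unfolding irreducible_rep_def
    proof (intro conjI allI impI)
      show "representation G (subrep R W)" by (rule representation_subrep[OF R invW])
      show "rep_space (subrep R W) \<noteq> {0}" using v0 by (auto simp: W_def)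
      fix X assume X: "invariant_subspace G (subrep R W) X"
      then have "{v \<in> rep_space T. \<phi> v \<in> X} = {0} \<or> {v \<in> rep_space T. \<phi> v \<in> X} = rep_space T"
        using T pre[of X] by (auto simp: irreducible_rep_def invariant_subspace_def)
      moreover have "X = \<phi> ` {v \<in> rep_space T. \<phi> v \<in> X}"
        using X by (auto simp: invariant_subspace_def W_def)
      ultimately show "X = {0} \<or> X = rep_space (subrep R W)" using \<phi>0 by (auto simp: W_def)
    qed
    obtain W' where W': "invariant_subspace G R W'" "W \<inter> W' = {0}"
      "\<And>v. v \<in> rep_space R \<Longrightarrow> \<exists>w\<in>W. \<exists>w'\<in>W'. v = w + w'"
      by (rule invariant_complement[OF G R invW]) blast
    obtain \<W> where \<W>: "irreducible_decomposition G (subrep R W') \<W>"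
      using irreducible_decomposition_exists[OF G R B W'(1)] by blast
    have whole: "invariant_subspace G R (rep_space R)"
      using sR representationD(3)[OF R] by (simp add: invariant_subspace_def)
    have sub: "W \<subseteq> rep_space R" "W' \<subseteq> rep_space R" using invW W'(1) by (auto simp: invariant_subspace_def)
    have "irreducible_decomposition G (subrep R (rep_space R)) (insert W \<W>)"
      by (rule irreducible_decomposition_insert[OF R whole invW sub(1) irr W'(1) sub(2) \<W> W'(2,3)])
    moreover have "equivalent_reps G T (subrep R W)"
      unfolding equivalent_reps_def
      by (rule exI[of _ \<phi>]) (use inj in \<open>auto simp: bij_betw_def W_def rep_homD[OF \<phi>]\<close>)
    ultimately show "occurs_in G T R" by (auto simp: occurs_in_def)
  }
qed

section \<open>Induced representations\<close>

lemma vector_space_pointwise: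
  assumes "vector_space s"
  shows "vector_space (\<lambda>c (f :: 'a \<Rightarrow> 'v::ab_group_add) x. s c (f x))"
proof -
  interpret vector_space s by fact
  show ?thesis by unfold_locales (auto simp: fun_eq_iff scale_right_distrib scale_left_distrib)
qed

lemma sum_fun_apply: "(sum f A) x = (\<Sum>i\<in>A. f i x)"
  by (induction A rule: infinite_finite_induct) simp_all

text \<open>Point masses with values in \<open>B\<close> span all functions. This provides the
  finite spanning set of the whole ambient type that the dimension argument requires.\<close>

lemma finite_spanning_pointwise:
  assumes s: "vector_space s" and B: "finite B" "module.span s B = UNIV"
  shows "\<exists>B'. finite B' \<and> module.span (\<lambda>c (f :: 'a::finite \<Rightarrow> 'v::ab_group_add) x. s c (f x)) B' = UNIV"
proof -
  interpret s: vector_space s by fact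
  interpret p: vector_space "\<lambda>c (f :: 'a \<Rightarrow> 'v) x. s c (f x)" by (rule vector_space_pointwise[OF s])
  define \<delta> where "\<delta> x v = (\<lambda>y. if y = x then v else 0)" for x :: 'a and v :: 'v
  define B' where "B' = (\<lambda>(x, b). \<delta> x b) ` (UNIV \<times> B)"
  have "\<delta> x v \<in> p.span B'" for x v
  proof -
    have "v \<in> s.span B" using B(2) by simp
    then show ?thesis
    proof (induction rule: s.span_induct_alt)
      case base
      have "\<delta> x 0 = 0" by (auto simp: \<delta>_def)
      then show ?case by (metis p.span_zero)
    next
      case (step c b v)
      have "\<delta> x (s c b + v) = (\<lambda>y. s c (\<delta> x b y)) + \<delta> x v" by (auto simp: \<delta>_def fun_eq_iff)
      moreover have "\<delta> x b \<in> p.span B'" using step(1) by (intro p.span_base) (auto simp: B'_def)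
      ultimately show ?case using step(2) by (simp only: p.span_add p.span_scale)
    qed
  qed
  then have "(\<Sum>x\<in>UNIV. \<delta> x (f x)) \<in> p.span B'" for f by (rule p.span_sum)
  moreover have "(\<Sum>x\<in>UNIV. \<delta> x (f x)) = f" for f :: "'a \<Rightarrow> 'v"
    by (auto simp: fun_eq_iff sum_fun_apply \<delta>_def)
  ultimately have "f \<in> p.span B'" for f by simp
  then show ?thesis using B(1) by (intro exI[of _ B']) (auto simp: B'_def)
qed

lemma ind_simps:
  "rep_scale (ind R H G) = (\<lambda>c f x. rep_scale R c (f x))"
  "rep_act (ind R H G) = (\<lambda>g f x. if x \<in> carrier G then f (x \<otimes>\<^bsub>G\<^esub> g) else 0)"
  "f \<in> rep_space (ind R H G) \<longleftrightarrow> (\<forall>g\<in>carrier G. f g \<in> rep_space R) \<and> (\<forall>g. g \<notin> carrier G \<longrightarrow> f g = 0) \<and>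
     (\<forall>h\<in>H. \<forall>g\<in>carrier G. f (h \<otimes>\<^bsub>G\<^esub> g) = rep_act R h (f g))"
  by (simp_all add: ind_def)

lemma representation_ind:
  assumes G: "group G" and H: "subgroup H G" and R: "representation (G\<lparr>carrier := H\<rparr>) R"
  shows "representation G (ind R H G)"
proof -
  interpret G: group G by fact
  interpret R: vector_space "rep_scale R" by (rule representationD(1)[OF R])
  interpret I: vector_space "rep_scale (ind R H G)"
    unfolding ind_simps by (rule vector_space_pointwise) unfold_locales
  note sR = representationD(2)[OF R]
  have HG: "h \<in> carrier G" if "h \<in> H" for h using that subgroup.mem_carrier[OF H] by auto
  have act0: "rep_act R h 0 = 0" if "h \<in> H" for h
    using rep_act_sum[OF R, of h "{}"] that by simp
  have actlin: "rep_act R h (v + w) = rep_act R h v + rep_act R h w"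
    "rep_act R h (rep_scale R c v) = rep_scale R c (rep_act R h v)"
    if "h \<in> H" "v \<in> rep_space R" "w \<in> rep_space R" for h v w c
    using that representationD(4,5)[OF R] by auto
  have "I.subspace (rep_space (ind R H G))"
    unfolding I.subspace_def
    using R.subspace_0[OF sR] R.subspace_add[OF sR] R.subspace_scale[OF sR]
    by (auto simp: ind_simps act0 actlin)
  then show ?thesis
    unfolding representation_def using I.vector_space_axioms
    by (auto simp: ind_simps fun_eq_iff G.m_assoc HG)
qed

lemma representation_one_dim:
  assumes "\<And>g h. g \<in> carrier G \<Longrightarrow> h \<in> carrier G \<Longrightarrow> \<xi> (g \<otimes>\<^bsub>G\<^esub> h) = \<xi> g * \<xi> h" "\<xi> \<one>\<^bsub>G\<^esub> = 1"
  shows "representation G (one_dim_rep \<xi>)"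
proof -
  have V: "vector_space ((*) :: complex \<Rightarrow> complex \<Rightarrow> complex)"
    by unfold_locales (auto simp: algebra_simps)
  then interpret V: vector_space "(*) :: complex \<Rightarrow> complex \<Rightarrow> complex" .
  show ?thesis
    unfolding representation_def one_dim_rep_def
    using V assms by (auto simp: algebra_simps)
qed

lemma one_dim_simps [simp]:
  "rep_space (one_dim_rep \<xi>) = UNIV" "rep_scale (one_dim_rep \<xi>) = (*)"
  "rep_act (one_dim_rep \<xi>) = (\<lambda>g z. \<xi> g * z)"
  by (simp_all add: one_dim_rep_def)

section \<open>Homomorphisms between representations induced from characters\<close>

locale finite_group = group G for G (structure) +
  assumes finite_carrier: "finite (carrier G)"

locale subgroup_character = finite_group +
  fixes P :: "'a set" and \<xi> :: "'a \<Rightarrow> complex"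
  assumes subgroup: "subgroup P G"
    and char_mult: "\<And>s t. s \<in> P \<Longrightarrow> t \<in> P \<Longrightarrow> \<xi> (s \<otimes> t) = \<xi> s * \<xi> t"
    and char_nz: "\<And>s. s \<in> P \<Longrightarrow> \<xi> s \<noteq> 0"
begin

abbreviation I :: "('a, 'a \<Rightarrow> complex) rep" where "I \<equiv> ind (one_dim_rep \<xi>) P G"

lemma P_closed [simp]:
  "s \<in> P \<Longrightarrow> s \<in> carrier G" "\<one> \<in> P" "s \<in> P \<Longrightarrow> t \<in> P \<Longrightarrow> s \<otimes> t \<in> P" "s \<in> P \<Longrightarrow> inv s \<in> P"
  using subgroup by (auto simp: subgroup_def)

lemma char_one: "\<xi> \<one> = 1"
  using char_mult[of \<one> \<one>] char_nz[of \<one>] by simp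

lemma char_inv: "s \<in> P \<Longrightarrow> \<xi> (inv s) = inverse (\<xi> s)"
  using char_mult[of s "inv s"] by (simp add: char_one inverse_unique)

lemma rep_I: "representation G I"
proof (rule representation_ind[OF is_group subgroup])
  show "representation (G\<lparr>carrier := P\<rparr>) (one_dim_rep \<xi>)"
    by (rule representation_one_dim) (simp_all add: char_mult char_one)
qed

lemma I_space: "f \<in> rep_space I \<longleftrightarrow>
    (\<forall>g. g \<notin> carrier G \<longrightarrow> f g = 0) \<and> (\<forall>s\<in>P. \<forall>g\<in>carrier G. f (s \<otimes> g) = \<xi> s * f g)"
  by (simp add: ind_simps)

text \<open>The cyclic vector of \<open>I\<close>. Homomorphisms out of \<open>I\<close> are
  determined by its image, as in Frobenius reciprocity.\<close>

definition \<delta> :: "'a \<Rightarrow> complex" where "\<delta> x = (if x \<in> P then \<xi> x else 0)"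

lemma mult_P_iff: "s \<in> P \<Longrightarrow> g \<in> carrier G \<Longrightarrow> s \<otimes> g \<in> P \<longleftrightarrow> g \<in> P"
  "s \<in> P \<Longrightarrow> g \<in> carrier G \<Longrightarrow> g \<otimes> s \<in> P \<longleftrightarrow> g \<in> P"
proof -
  assume sg: "s \<in> P" "g \<in> carrier G"
  have "inv s \<otimes> (s \<otimes> g) = g" "(g \<otimes> s) \<otimes> inv s = g" using sg by (simp_all add: m_assoc[symmetric]) (simp add: m_assoc)
  then show "s \<otimes> g \<in> P \<longleftrightarrow> g \<in> P" "g \<otimes> s \<in> P \<longleftrightarrow> g \<in> P" using sg P_closed(3,4) by metis+
qed

lemma \<delta>_space: "\<delta> \<in> rep_space I"
  by (auto simp: I_space \<delta>_def mult_P_iff char_mult)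

lemma \<delta>_act: "s \<in> P \<Longrightarrow> rep_act I s \<delta> = rep_scale I (\<xi> s) \<delta>"
  by (auto simp: ind_simps \<delta>_def mult_P_iff char_mult fun_eq_iff)

text \<open>At \<open>x\<close> only the \<open>g\<close> in the coset \<open>P x\<close>
  contribute. Each contributes \<open>f x\<close>, since the character in \<open>f\<close> cancels
  that in \<open>\<delta>\<close>; this explains the factor \<open>1 / card P\<close>.\<close>

lemma \<delta>_expand:
  assumes f: "f \<in> rep_space I"
  shows "f = rep_scale I (inverse (of_nat (card P)))
    (\<Sum>g\<in>carrier G. rep_scale I (f g) (rep_act I (inv g) \<delta>))"
proof
  fix x
  have fin: "finite P" using finite_carrier by (rule finite_subset[rotated]) auto
  then have card: "card P > 0" using P_closed(2) card_gt_0_iff by blast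
  show "f x = rep_scale I (inverse (of_nat (card P)))
    (\<Sum>g\<in>carrier G. rep_scale I (f g) (rep_act I (inv g) \<delta>)) x"
  proof (cases "x \<in> carrier G")
    case False
    then show ?thesis using f by (simp add: ind_simps sum_fun_apply)
  next
    case x: True
    have "(\<Sum>g\<in>carrier G. f g * \<delta> (x \<otimes> inv g)) = (\<Sum>g\<in>(\<lambda>s. inv s \<otimes> x) ` P. f g * \<delta> (x \<otimes> inv g))"
    proof (rule sum.mono_neutral_right)
      show "\<forall>g\<in>carrier G - (\<lambda>s. inv s \<otimes> x) ` P. f g * \<delta> (x \<otimes> inv g) = 0"
      proof
        fix g assume g: "g \<in> carrier G - (\<lambda>s. inv s \<otimes> x) ` P"
        have "inv (x \<otimes> inv g) \<otimes> x = g" using x g by (simp add: inv_mult_group m_assoc)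
        then have "x \<otimes> inv g \<notin> P" using g by (metis DiffD2 imageI)
        then show "f g * \<delta> (x \<otimes> inv g) = 0" by (simp add: \<delta>_def)
      qed
    qed (use x finite_carrier in auto)
    also have "\<dots> = (\<Sum>s\<in>P. f (inv s \<otimes> x) * \<delta> (x \<otimes> inv (inv s \<otimes> x)))"
    proof (rule sum.reindex_cong[OF _ refl refl])
      show "inj_on (\<lambda>s. inv s \<otimes> x) P"
        using x by (auto simp: inj_on_def) (metis P_closed(1) inv_inv)
    qed
    also have "\<dots> = (\<Sum>s\<in>P. f x)"
    proof (rule sum.cong[OF refl])
      fix s assume s: "s \<in> P"
      have "x \<otimes> inv (inv s \<otimes> x) = s"
        using s x by (simp add: inv_mult_group m_assoc[symmetric])
      moreover have "f (inv s \<otimes> x) = inverse (\<xi> s) * f x"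
        using f s x unfolding I_space by (metis P_closed(4) char_inv)
      ultimately show "f (inv s \<otimes> x) * \<delta> (x \<otimes> inv (inv s \<otimes> x)) = f x"
        using s char_nz[OF s] by (simp add: \<delta>_def)
    qed
    finally show ?thesis using card x by (simp add: ind_simps sum_fun_apply)
  qed
qed

lemma rep_hom_I_expand:
  assumes S: "representation G S" and \<phi>: "rep_hom G I S \<phi>" and f: "f \<in> rep_space I"
  shows "\<phi> f = rep_scale S (inverse (of_nat (card P)))
    (\<Sum>g\<in>carrier G. rep_scale S (f g) (rep_act S (inv g) (\<phi> \<delta>)))"
proof -
  interpret V: vector_space "rep_scale I" by (rule representationD(1)[OF rep_I])
  note sI = representationD(2)[OF rep_I]
  have mem: "rep_scale I (f g) (rep_act I (inv g) \<delta>) \<in> rep_space I" if "g \<in> carrier G" for g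
    using that by (intro V.subspace_scale[OF sI] representationD(3)[OF rep_I] \<delta>_space) auto
  have "\<phi> f = rep_scale S (inverse (of_nat (card P)))
      (\<phi> (\<Sum>g\<in>carrier G. rep_scale I (f g) (rep_act I (inv g) \<delta>)))"
    by (subst \<delta>_expand[OF f]) (intro rep_homD(3)[OF \<phi>] V.subspace_sum[OF sI] mem)
  also have "\<phi> (\<Sum>g\<in>carrier G. rep_scale I (f g) (rep_act I (inv g) \<delta>))
      = (\<Sum>g\<in>carrier G. \<phi> (rep_scale I (f g) (rep_act I (inv g) \<delta>)))"
    by (rule rep_hom_sum[OF rep_I S \<phi> mem])
  also have "\<dots> = (\<Sum>g\<in>carrier G. rep_scale S (f g) (rep_act S (inv g) (\<phi> \<delta>)))"
    using \<delta>_space representationD(3)[OF rep_I]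
    by (intro sum.cong refl) (simp add: rep_homD(3,4)[OF \<phi>])
  finally show ?thesis .
qed

end

locale two_characters = p: subgroup_character G P \<xi> + q: subgroup_character G Q \<eta>
  for G :: "('a, 'b) monoid_scheme" (structure) and P \<xi> Q \<eta>
begin

text \<open>The image of \<open>\<delta>\<close> transforms by \<open>\<eta>\<close> under
  \<open>Q\<close> on the left and by \<open>\<xi>\<close> under \<open>P\<close> on the right. Its
  nonzero value at \<open>x\<close> can be compared along \<open>r x = x s\<close>.\<close>

lemma hom_kernel_compatible:
  assumes \<phi>: "rep_hom G p.I q.I \<phi>" and x: "x \<in> carrier G" "\<phi> p.\<delta> x \<noteq> 0"
    and rs: "r \<in> Q" "s \<in> P" "r \<otimes> x = x \<otimes> s"
  shows "\<eta> r = \<xi> s"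
proof -
  have "\<phi> p.\<delta> \<in> rep_space q.I" by (rule rep_homD(1)[OF \<phi> p.\<delta>_space])
  then have "\<phi> p.\<delta> (r \<otimes> x) = \<eta> r * \<phi> p.\<delta> x" using x rs unfolding q.I_space by blast
  moreover have "rep_act q.I s (\<phi> p.\<delta>) = rep_scale q.I (\<xi> s) (\<phi> p.\<delta>)"
    using rep_homD(4)[OF \<phi> p.P_closed(1)[OF rs(2)] p.\<delta>_space] p.\<delta>_act[OF rs(2)]
      rep_homD(3)[OF \<phi> p.\<delta>_space] by simp
  then have "rep_act q.I s (\<phi> p.\<delta>) x = rep_scale q.I (\<xi> s) (\<phi> p.\<delta>) x" by simp
  then have "\<phi> p.\<delta> (x \<otimes> s) = \<xi> s * \<phi> p.\<delta> x" using x by (simp add: ind_simps)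
  ultimately show ?thesis using x rs by simp
qed

text \<open>A nonzero homomorphism cannot kill the cyclic vector, and any point in the support of
  its image is a suitable \<open>x\<close>.\<close>

theorem nonzero_hom_iff:
  "(\<exists>\<phi>. rep_hom G p.I q.I \<phi> \<and> (\<exists>v\<in>rep_space p.I. \<phi> v \<noteq> 0)) \<longleftrightarrow>
    (\<exists>x\<in>carrier G. \<forall>s\<in>P. \<forall>r\<in>Q. r \<otimes> x = x \<otimes> s \<longrightarrow> \<eta> r = \<xi> s)"
proof
  assume "\<exists>\<phi>. rep_hom G p.I q.I \<phi> \<and> (\<exists>v\<in>rep_space p.I. \<phi> v \<noteq> 0)"
  then obtain \<phi> v where \<phi>: "rep_hom G p.I q.I \<phi>" and v: "v \<in> rep_space p.I" "\<phi> v \<noteq> 0" by blast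
  have "\<phi> p.\<delta> \<noteq> 0"
  proof
    assume "\<phi> p.\<delta> = 0"
    then have "\<phi> v = 0"
      by (subst p.rep_hom_I_expand[OF q.rep_I \<phi> v(1)]) (auto simp: ind_simps fun_eq_iff sum_fun_apply intro!: sum.neutral)
    then show False using v by simp
  qed
  then obtain x where x: "\<phi> p.\<delta> x \<noteq> 0" by (auto simp: fun_eq_iff)
  moreover have "x \<in> carrier G"
    using x rep_homD(1)[OF \<phi> p.\<delta>_space] by (auto simp: q.I_space)
  ultimately show "\<exists>x\<in>carrier G. \<forall>s\<in>P. \<forall>r\<in>Q. r \<otimes> x = x \<otimes> s \<longrightarrow> \<eta> r = \<xi> s"
    using hom_kernel_compatible[OF \<phi>] by blast
next
  assume "\<exists>x\<in>carrier G. \<forall>s\<in>P. \<forall>r\<in>Q. r \<otimes> x = x \<otimes> s \<longrightarrow> \<eta> r = \<xi> s"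
  then obtain x where x: "x \<in> carrier G"
    and comp: "\<And>s r. s \<in> P \<Longrightarrow> r \<in> Q \<Longrightarrow> r \<otimes> x = x \<otimes> s \<Longrightarrow> \<eta> r = \<xi> s" by blast
  \<comment> \<open>the Hecke operator of the double coset \<open>Q x P\<close>\<close>
  define \<phi> where "\<phi> f y = (if y \<in> carrier G then \<Sum>r\<in>Q. inverse (\<eta> r) * f (inv x \<otimes> (r \<otimes> y)) else 0)"
    for f y
  have fin: "finite Q" using p.finite_carrier by (rule finite_subset[rotated]) auto
  have "rep_hom G p.I q.I \<phi>"
    unfolding rep_hom_def
  proof (intro conjI ballI allI)
    fix f assume f: "f \<in> rep_space p.I"
    show "\<phi> f \<in> rep_space q.I"
      unfolding q.I_space
    proof (intro conjI allI impI ballI)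
      fix t y assume t: "t \<in> Q" and y: "y \<in> carrier G"
      have "bij_betw (\<lambda>r. r \<otimes> t) Q Q"
        by (rule bij_betwI[of _ _ _ "\<lambda>r. r \<otimes> inv t"]) (use t in \<open>auto simp: p.m_assoc\<close>)
      then have "(\<Sum>r\<in>Q. inverse (\<eta> r) * f (inv x \<otimes> (r \<otimes> y)))
          = (\<Sum>r\<in>Q. inverse (\<eta> (r \<otimes> t)) * f (inv x \<otimes> ((r \<otimes> t) \<otimes> y)))"
        by (rule sum.reindex_bij_betw[symmetric])
      also have "\<dots> = (\<Sum>r\<in>Q. inverse (\<eta> t) * (inverse (\<eta> r) * f (inv x \<otimes> (r \<otimes> (t \<otimes> y)))))"
        using t y by (intro sum.cong refl) (simp add: q.char_mult p.m_assoc)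
      finally show "\<phi> f (t \<otimes> y) = \<eta> t * \<phi> f y"
        using t y q.char_nz[OF t] by (simp add: \<phi>_def sum_distrib_left[symmetric])
    qed (simp add: \<phi>_def)
  next
    fix f f' assume "f \<in> rep_space p.I" "f' \<in> rep_space p.I"
    show "\<phi> (f + f') = \<phi> f + \<phi> f'"
      by (auto simp: fun_eq_iff \<phi>_def sum.distrib ring_distribs)
  next
    fix c f assume "f \<in> rep_space p.I"
    show "\<phi> (rep_scale p.I c f) = rep_scale q.I c (\<phi> f)"
      by (auto simp: fun_eq_iff \<phi>_def ind_simps sum_distrib_left mult.left_commute)
  next
    fix g f assume "g \<in> carrier G" "f \<in> rep_space p.I"
    then show "\<phi> (rep_act p.I g f) = rep_act q.I g (\<phi> f)"
      using x by (auto simp: fun_eq_iff \<phi>_def ind_simps p.m_assoc intro!: sum.cong)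
  qed
  moreover have "\<phi> p.\<delta> x \<noteq> 0"
  proof -
    let ?S = "{r \<in> Q. inv x \<otimes> (r \<otimes> x) \<in> P}"
    \<comment> \<open>Compatibility makes all nonzero terms equal to 1, so nothing cancels, and
      \<open>r = 1\<close> contributes.\<close>
    have "\<phi> p.\<delta> x = (\<Sum>r\<in>Q. if r \<in> ?S then 1 else 0)"
      unfolding \<phi>_def if_P[OF x]
    proof (rule sum.cong[OF refl])
      fix r assume r: "r \<in> Q"
      have "\<eta> r = \<xi> (inv x \<otimes> (r \<otimes> x))" if "inv x \<otimes> (r \<otimes> x) \<in> P"
        by (rule comp[OF that r]) (use r x in \<open>simp add: p.m_assoc[symmetric]\<close>)
      then show "inverse (\<eta> r) * p.\<delta> (inv x \<otimes> (r \<otimes> x)) = (if r \<in> ?S then 1 else 0)"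
        using r q.char_nz[OF r] by (auto simp: p.\<delta>_def)
    qed
    also have "\<dots> = of_nat (card ?S)" using fin by (simp add: sum.If_cases Int_def)
    finally have *: "\<phi> p.\<delta> x = of_nat (card ?S)" .
    have "\<one> \<in> ?S" using x by simp
    moreover have "finite ?S" using fin by simp
    ultimately have "card ?S \<noteq> 0" using card_0_eq by blast
    then show ?thesis unfolding * by (simp only: of_nat_eq_0_iff not_False_eq_True)
  qed
  ultimately show "\<exists>\<phi>. rep_hom G p.I q.I \<phi> \<and> (\<exists>v\<in>rep_space p.I. \<phi> v \<noteq> 0)"
    using p.\<delta>_space by (auto simp: fun_eq_iff)
qed

end

context subgroup_character
begin

text \<open>The projection onto an invariant \<open>W\<close> is an endomorphism. By hypothesis it
  sends \<open>\<delta>\<close> to a function supported on \<open>P\<close>, a multiple of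
  \<open>\<delta>\<close>, and is therefore a scalar. The scalar is 1 as soon as \<open>W\<close>
  contains a nonzero vector, and then \<open>W\<close> is everything.\<close>

theorem irreducible_I:
  assumes comp: "\<And>x. x \<in> carrier G \<Longrightarrow> \<forall>s\<in>P. \<forall>r\<in>P. r \<otimes> x = x \<otimes> s \<longrightarrow> \<xi> r = \<xi> s \<Longrightarrow> x \<in> P"
  shows "irreducible_rep G I"
  unfolding irreducible_rep_def
proof (intro conjI allI impI)
  interpret two_characters G P \<xi> P \<xi> ..
  interpret V: vector_space "rep_scale I" by (rule representationD(1)[OF rep_I])
  show "representation G I" by (rule rep_I)
  have "\<delta> \<one> \<noteq> 0" by (simp add: \<delta>_def char_one)
  then have "\<delta> \<noteq> 0" by (metis zero_fun_apply)
  then show "rep_space I \<noteq> {0}" using \<delta>_space by auto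
  fix W assume W: "invariant_subspace G I W"
  have sW: "V.subspace W" "W \<subseteq> rep_space I" using W by (auto simp: invariant_subspace_def)
  obtain \<pi> where \<pi>: "rep_hom G I I \<pi>" "\<And>v. v \<in> rep_space I \<Longrightarrow> \<pi> v \<in> W" "\<And>w. w \<in> W \<Longrightarrow> \<pi> w = w"
    by (rule averaged_projection[OF is_group finite_carrier rep_I W]) blast
  have F: "\<pi> \<delta> \<in> rep_space I" by (rule rep_homD(1)[OF \<pi>(1) \<delta>_space])
  have pt: "\<pi> \<delta> x = \<pi> \<delta> \<one> * \<delta> x" for x
  proof (cases "x \<in> P")
    case True
    then have "\<pi> \<delta> (x \<otimes> \<one>) = \<xi> x * \<pi> \<delta> \<one>" using F unfolding I_space by blast
    then show ?thesis using True by (simp add: \<delta>_def)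
  next
    case False
    then have "\<pi> \<delta> x = 0"
      using comp[of x] hom_kernel_compatible[OF \<pi>(1)] F by (auto simp: I_space)
    then show ?thesis using False by (simp add: \<delta>_def)
  qed
  define c where "c = \<pi> \<delta> \<one>"
  have \<pi>\<delta>: "\<pi> \<delta> = rep_scale I c \<delta>"
    unfolding ind_simps one_dim_simps c_def by (rule ext) (rule pt)
  have scalar: "\<pi> f = rep_scale I c f" if f: "f \<in> rep_space I" for f
  proof -
    have "rep_act I (inv g) (\<pi> \<delta>) = rep_scale I c (rep_act I (inv g) \<delta>)" if "g \<in> carrier G" for g
      unfolding \<pi>\<delta> using that by (intro representationD(5)[OF rep_I] \<delta>_space) auto
    then have "\<pi> f = rep_scale I c (rep_scale I (inverse (of_nat (card P)))
        (\<Sum>g\<in>carrier G. rep_scale I (f g) (rep_act I (inv g) \<delta>)))"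
      by (subst rep_hom_I_expand[OF rep_I \<pi>(1) f]) (simp add: V.scale_sum_right ac_simps)
    then show ?thesis by (simp only: \<delta>_expand[OF f, symmetric])
  qed
  show "W = {0} \<or> W = rep_space I"
  proof (cases "W = {0}")
    case False
    then obtain w where w: "w \<in> W" "w \<noteq> 0" using V.subspace_0[OF sW(1)] by blast
    then have "rep_scale I c w = w" using scalar[of w] \<pi>(3)[of w] sW(2) by auto
    then have "rep_scale I (c - 1) w = 0" by (simp add: V.scale_left_diff_distrib)
    then have "c = 1" using w(2) by simp
    then have "\<pi> f = f" if "f \<in> rep_space I" for f using scalar[OF that] by simp
    then show ?thesis using \<pi>(2) sW(2) by (metis subset_antisym subsetI)
  qed simp
qed

end

text \<open>In one direction a function with values in \<open>t\<close> is evaluated at the identity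
  of \<open>H\<close>; in the other, \<open>f\<close> becomes the function sending \<open>g\<close>
  to \<open>x \<mapsto> f (x g)\<close> on \<open>H\<close>. Both passages keep homomorphisms
  nonzero.\<close>

lemma nonzero_hom_ind_stages:
  fixes G :: "('g, 'm) monoid_scheme" and \<eta> :: "'g \<Rightarrow> complex"
    and T :: "('g, 'v::ab_group_add) rep"
  assumes G: "group G" and H: "subgroup H G" and Q: "Q \<subseteq> H"
  defines "t \<equiv> ind (one_dim_rep \<eta>) Q (G\<lparr>carrier := H\<rparr>)"
  shows "(\<exists>\<phi>. rep_hom G T (ind t H G) \<phi> \<and> (\<exists>v\<in>rep_space T. \<phi> v \<noteq> 0)) \<longleftrightarrow>
    (\<exists>\<phi>. rep_hom G T (ind (one_dim_rep \<eta>) Q G) \<phi> \<and> (\<exists>v\<in>rep_space T. \<phi> v \<noteq> 0))"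
proof
  interpret G: group G by fact
  have HG: "h \<in> carrier G" if "h \<in> H" for h using that subgroup.mem_carrier[OF H] by auto
  have Hc: "\<one>\<^bsub>G\<^esub> \<in> H" "\<And>h k. h \<in> H \<Longrightarrow> k \<in> H \<Longrightarrow> h \<otimes>\<^bsub>G\<^esub> k \<in> H" using H by (auto simp: subgroup_def)
  have t_space: "f \<in> rep_space t \<longleftrightarrow> (\<forall>g. g \<notin> H \<longrightarrow> f g = 0) \<and> (\<forall>r\<in>Q. \<forall>g\<in>H. f (r \<otimes>\<^bsub>G\<^esub> g) = \<eta> r * f g)"
    and t_act: "rep_act t h f x = (if x \<in> H then f (x \<otimes>\<^bsub>G\<^esub> h) else 0)"
    and t_scale: "rep_scale t c f x = c * f x" for f h x c
    by (simp_all add: t_def ind_simps)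
  {
    assume "\<exists>\<phi>. rep_hom G T (ind t H G) \<phi> \<and> (\<exists>v\<in>rep_space T. \<phi> v \<noteq> 0)"
    then obtain \<phi> v where \<phi>: "rep_hom G T (ind t H G) \<phi>" and v: "v \<in> rep_space T" "\<phi> v \<noteq> 0" by blast
    define \<psi> where "\<psi> f g = \<phi> f g \<one>\<^bsub>G\<^esub>" for f g
    have sp: "\<phi> f \<in> rep_space (ind t H G)" if "f \<in> rep_space T" for f by (rule rep_homD(1)[OF \<phi> that])
    have shift: "\<phi> f (h \<otimes>\<^bsub>G\<^esub> g) \<one>\<^bsub>G\<^esub> = \<phi> f g h" if "f \<in> rep_space T" "h \<in> H" "g \<in> carrier G" for f h g
      using sp[OF that(1)] that(2,3) Hc(1) HG by (simp add: ind_simps t_act)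
    have "rep_hom G T (ind (one_dim_rep \<eta>) Q G) \<psi>"
      unfolding rep_hom_def
    proof (intro conjI ballI allI)
      fix f assume f: "f \<in> rep_space T"
      have "\<psi> f (r \<otimes>\<^bsub>G\<^esub> g) = \<eta> r * \<psi> f g" if "r \<in> Q" "g \<in> carrier G" for r g
      proof -
        have "\<phi> f g \<in> rep_space t" using sp[OF f] that by (simp add: ind_simps)
        then have "\<phi> f g (r \<otimes>\<^bsub>G\<^esub> \<one>\<^bsub>G\<^esub>) = \<eta> r * \<phi> f g \<one>\<^bsub>G\<^esub>" using that Hc(1) unfolding t_space by blast
        moreover have "r \<in> H" using that Q by auto
        ultimately show ?thesis using shift[OF f _ that(2), of r] HG by (simp add: \<psi>_def)
      qed
      then show "\<psi> f \<in> rep_space (ind (one_dim_rep \<eta>) Q G)"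
        using sp[OF f] by (auto simp: ind_simps \<psi>_def)
    next
      fix f f' assume "f \<in> rep_space T" "f' \<in> rep_space T"
      then show "\<psi> (f + f') = \<psi> f + \<psi> f'" by (auto simp: \<psi>_def fun_eq_iff rep_homD(2)[OF \<phi>])
    next
      fix c f assume "f \<in> rep_space T"
      then show "\<psi> (rep_scale T c f) = rep_scale (ind (one_dim_rep \<eta>) Q G) c (\<psi> f)"
        by (auto simp: \<psi>_def fun_eq_iff rep_homD(3)[OF \<phi>] ind_simps t_scale)
    next
      fix g f assume "g \<in> carrier G" "f \<in> rep_space T"
      then show "\<psi> (rep_act T g f) = rep_act (ind (one_dim_rep \<eta>) Q G) g (\<psi> f)"
        by (auto simp: \<psi>_def fun_eq_iff rep_homD(4)[OF \<phi>] ind_simps)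
    qed
    moreover have "\<psi> v \<noteq> 0"
    proof
      assume z: "\<psi> v = 0"
      have "\<phi> v g h = 0" for g h
      proof (cases "g \<in> carrier G \<and> h \<in> H")
        case True
        then have "\<phi> v g h = \<psi> v (h \<otimes>\<^bsub>G\<^esub> g)" using shift[OF v(1)] by (simp add: \<psi>_def)
        then show ?thesis using z by simp
      next
        case False
        then show ?thesis using sp[OF v(1)] by (auto simp: ind_simps t_space)
      qed
      then have "\<phi> v = 0" by (auto simp: fun_eq_iff)
      then show False using v by simp
    qed
    ultimately show "\<exists>\<phi>. rep_hom G T (ind (one_dim_rep \<eta>) Q G) \<phi> \<and> (\<exists>v\<in>rep_space T. \<phi> v \<noteq> 0)"
      using v(1) by blast
  next
    assume "\<exists>\<phi>. rep_hom G T (ind (one_dim_rep \<eta>) Q G) \<phi> \<and> (\<exists>v\<in>rep_space T. \<phi> v \<noteq> 0)"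
    then obtain \<psi> v where \<psi>: "rep_hom G T (ind (one_dim_rep \<eta>) Q G) \<psi>" and v: "v \<in> rep_space T" "\<psi> v \<noteq> 0"
      by blast
    have sp: "\<psi> f \<in> rep_space (ind (one_dim_rep \<eta>) Q G)" if "f \<in> rep_space T" for f
      by (rule rep_homD(1)[OF \<psi> that])
    define \<phi> where "\<phi> f g x = (if g \<in> carrier G \<and> x \<in> H then \<psi> f (x \<otimes>\<^bsub>G\<^esub> g) else 0)" for f g x
    have "rep_hom G T (ind t H G) \<phi>"
      unfolding rep_hom_def
    proof (intro conjI ballI allI)
      fix f assume f: "f \<in> rep_space T"
      show "\<phi> f \<in> rep_space (ind t H G)"
        unfolding ind_simps(3)[of _ t]
      proof (intro conjI ballI allI impI)
        fix g assume g: "g \<in> carrier G"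
        have "\<psi> f (r \<otimes>\<^bsub>G\<^esub> x \<otimes>\<^bsub>G\<^esub> g) = \<eta> r * \<psi> f (x \<otimes>\<^bsub>G\<^esub> g)" if "r \<in> Q" "x \<in> H" for r x
        proof -
          have rx: "r \<in> carrier G" "x \<in> carrier G" using that Q HG by auto
          then have "\<psi> f (r \<otimes>\<^bsub>G\<^esub> (x \<otimes>\<^bsub>G\<^esub> g)) = \<eta> r * \<psi> f (x \<otimes>\<^bsub>G\<^esub> g)"
            using sp[OF f] that g by (simp add: ind_simps)
          then show ?thesis using rx g by (simp add: G.m_assoc)
        qed
        then show "\<phi> f g \<in> rep_space t" using g Q Hc(2) by (auto simp: t_space \<phi>_def)
        fix h assume h: "h \<in> H"
        show "\<phi> f (h \<otimes>\<^bsub>G\<^esub> g) = rep_act t h (\<phi> f g)"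
          using g h HG Hc(2) by (auto simp: fun_eq_iff t_act \<phi>_def G.m_assoc)
      qed (auto simp: \<phi>_def fun_eq_iff)
    next
      fix f f' assume "f \<in> rep_space T" "f' \<in> rep_space T"
      then show "\<phi> (f + f') = \<phi> f + \<phi> f'" by (auto simp: \<phi>_def fun_eq_iff rep_homD(2)[OF \<psi>])
    next
      fix c f assume "f \<in> rep_space T"
      then show "\<phi> (rep_scale T c f) = rep_scale (ind t H G) c (\<phi> f)"
        by (auto simp: \<phi>_def fun_eq_iff rep_homD(3)[OF \<psi>] ind_simps t_scale)
    next
      fix g f assume "g \<in> carrier G" "f \<in> rep_space T"
      then show "\<phi> (rep_act T g f) = rep_act (ind t H G) g (\<phi> f)"
        using HG by (auto simp: \<phi>_def fun_eq_iff rep_homD(4)[OF \<psi>] ind_simps G.m_assoc)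
    qed
    moreover have "\<phi> v \<noteq> 0"
    proof -
      obtain g where g: "\<psi> v g \<noteq> 0" using v(2) by (auto simp: fun_eq_iff)
      then have "g \<in> carrier G" using sp[OF v(1)] by (auto simp: ind_simps)
      then have "\<phi> v g \<one>\<^bsub>G\<^esub> \<noteq> 0" using g Hc(1) by (simp add: \<phi>_def)
      then show ?thesis by auto
    qed
    ultimately show "\<exists>\<phi>. rep_hom G T (ind t H G) \<phi> \<and> (\<exists>v\<in>rep_space T. \<phi> v \<noteq> 0)"
      using v(1) by blast
  }
qed

section \<open>Kirillov representations\<close>

lemma coadjoint_orbits_dual:
  assumes "CHAR('k::{field,finite}) \<ge> CARD('n::{finite,linorder})"
    and "lie_subalgebra (\<gg> :: ('k, 'n) sqmat set)" "\<gg> \<subseteq> ut" "\<Omega> \<in> coadjoint_orbits \<gg>" "l \<in> \<Omega>"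
  shows "l \<in> dual_space \<gg>"
  using assms coadjoint_dual[OF assms(1-3)]
  by (auto simp: coadjoint_orbits_def coadjoint_orbit_def)

lemma subgroup_exp:
  assumes char: "CHAR('k::{field,finite}) \<ge> CARD('n::{finite,linorder})"
    and g: "lie_subalgebra (\<gg> :: ('k, 'n) sqmat set)" "\<gg> \<subseteq> ut" and V: "lie_subalgebra V" "V \<subseteq> \<gg>"
  shows "subgroup (mexp ` V) (exp_group \<gg>)"
proof -
  have Vut: "V \<subseteq> ut" using g V by auto
  have Vg: "mexp ` V \<subseteq> mexp ` \<gg>" using V by auto
  show ?thesis
  proof (rule subgroup.intro)
    show "mexp ` V \<subseteq> carrier (exp_group \<gg>)" using Vg by simp
    show "x \<otimes>\<^bsub>exp_group \<gg>\<^esub> y \<in> mexp ` V" if "x \<in> mexp ` V" "y \<in> mexp ` V" for x y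
      using mexp_image_mult[OF char V(1) Vut that] by simp
    show "\<one>\<^bsub>exp_group \<gg>\<^esub> \<in> mexp ` V" using mexp_image_one[OF char V(1) Vut] by simp
    show "inv\<^bsub>exp_group \<gg>\<^esub> x \<in> mexp ` V" if "x \<in> mexp ` V" for x
      using inv_exp_group[OF char g, of x] mexp_image_inv(1)[OF char V(1) Vut that] that Vg by auto
  qed
qed

text \<open>The polarization belongs to \<open>\<hh>\<close> while the ambient group is that of
  \<open>\<gg>\<close>, so one statement covers \<open>P\<close> in \<open>G\<close>,
  \<open>Q\<close> in \<open>G\<close> and \<open>Q\<close> in \<open>H\<close>.\<close>

lemma subgroup_character_polarization:
  assumes char: "CHAR('k::{field,finite}) \<ge> CARD('n::{finite,linorder})"
    and e: "nontrivial_additive_character (e :: 'k \<Rightarrow> complex)"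
    and g: "lie_subalgebra (\<gg> :: ('k, 'n) sqmat set)" "\<gg> \<subseteq> ut"
    and h: "lie_subalgebra \<hh>" "\<hh> \<subseteq> \<gg>"
    and m: "m \<in> dual_space \<hh>" "polarization \<hh> m \<qq>"
  shows "subgroup_character (exp_group \<gg>) (mexp ` \<qq>) (polarization_character e m \<qq>)"
proof -
  have hut: "\<hh> \<subseteq> ut" using g h by auto
  note q = pol_lie[OF char h(1) hut m]
  show ?thesis
  proof (intro subgroup_character.intro finite_group.intro finite_group_axioms.intro
      subgroup_character_axioms.intro group_exp_group[OF char g])
    show "finite (carrier (exp_group \<gg>))" by simp
    show "subgroup (mexp ` \<qq>) (exp_group \<gg>)"
      using q(3) h(2) by (intro subgroup_exp char g q(1)) auto
    show "polarization_character e m \<qq> (s \<otimes>\<^bsub>exp_group \<gg>\<^esub> t)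
        = polarization_character e m \<qq> s * polarization_character e m \<qq> t"
      if "s \<in> mexp ` \<qq>" "t \<in> mexp ` \<qq>" for s t
      using polarization_character_mult[OF char h(1) hut m e that] by simp
    show "polarization_character e m \<qq> s \<noteq> 0" for s
      using e by (simp add: polarization_character_def nontrivial_additive_character_def)
  qed
qed

lemma irreducible_kirillov_rep:
  assumes char: "CHAR('k::{field,finite}) \<ge> CARD('n::{finite,linorder})"
    and e: "nontrivial_additive_character (e :: 'k \<Rightarrow> complex)"
    and g: "lie_subalgebra (\<gg> :: ('k, 'n) sqmat set)" "\<gg> \<subseteq> ut"
    and l: "l \<in> dual_space \<gg>" "polarization \<gg> l \<pp>"
  shows "irreducible_rep (exp_group \<gg>) (kirillov_rep e \<gg> l \<pp>)"
proof -
  interpret subgroup_character "exp_group \<gg>" "mexp ` \<pp>" "polarization_character e l \<pp>"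
    by (rule subgroup_character_polarization[OF char e g g(1) order_refl l])
  show ?thesis
    unfolding kirillov_rep_def
  proof (rule irreducible_I)
    fix x assume "x \<in> carrier (exp_group \<gg>)"
      and "\<forall>s\<in>mexp ` \<pp>. \<forall>r\<in>mexp ` \<pp>. r \<otimes>\<^bsub>exp_group \<gg>\<^esub> x = x \<otimes>\<^bsub>exp_group \<gg>\<^esub> s \<longrightarrow>
        polarization_character e l \<pp> r = polarization_character e l \<pp> s"
    then have x: "x \<in> mexp ` \<gg>" and
      comp: "\<forall>s\<in>mexp ` \<pp>. \<forall>r\<in>mexp ` \<pp>. r ** x = x ** s \<longrightarrow>
        polarization_character e l \<pp> r = polarization_character e l \<pp> s"
      by simp_all
    from compatible_characters_iff[OF char e g g(1) order_refl l l x] comp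
    show "x \<in> mexp ` \<pp>" using compatible_self[OF char e g l x] by blast
  qed
qed

theorem corollary10:
  fixes \<gg> \<hh> :: "('k::{field,finite}, 'n::{finite,linorder}) sqmat set"
    and e :: "'k \<Rightarrow> complex"
    and \<Omega> \<omega> :: "(('k, 'n) sqmat \<Rightarrow> 'k) set"
    and T t :: "(('k, 'n) sqmat, ('k, 'n) sqmat \<Rightarrow> complex) rep"
  assumes "CHAR('k) \<ge> CARD('n)"
    and "nontrivial_additive_character e"
    and "lie_subalgebra \<gg>" and "\<gg> \<subseteq> ut"
    and "lie_subalgebra \<hh>" and "\<hh> \<subseteq> \<gg>"
    and "\<Omega> \<in> coadjoint_orbits \<gg>" and "\<omega> \<in> coadjoint_orbits \<hh>"
    and "T \<in> orbit_reps e \<gg> \<Omega>" and "t \<in> orbit_reps e \<hh> \<omega>"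
  shows "occurs_in (exp_group \<gg>) T (ind t (carrier (exp_group \<hh>)) (exp_group \<gg>))
     \<longleftrightarrow> \<Omega> \<inter> dual_proj \<hh> -` \<omega> \<noteq> {}"
proof -
  note char = assms(1) and e = assms(2) and g = assms(3,4) and h = assms(5,6)
  have hut: "\<hh> \<subseteq> ut" using g h by auto
  obtain l \<pp> where l: "l \<in> \<Omega>" "polarization \<gg> l \<pp>" and T: "T = kirillov_rep e \<gg> l \<pp>"
    using assms(9) by (auto simp: orbit_reps_def)
  obtain m \<qq> where m: "m \<in> \<omega>" "polarization \<hh> m \<qq>" and t: "t = kirillov_rep e \<hh> m \<qq>"
    using assms(10) by (auto simp: orbit_reps_def)
  have ld: "l \<in> dual_space \<gg>" by (rule coadjoint_orbits_dual[OF char g assms(7) l(1)])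
  have md: "m \<in> dual_space \<hh>" by (rule coadjoint_orbits_dual[OF char h(1) hut assms(8) m(1)])
  let ?G = "exp_group \<gg>" and ?H = "mexp ` \<hh>"
  let ?\<xi> = "polarization_character e l \<pp>" and ?\<eta> = "polarization_character e m \<qq>"
  \<comment> \<open>The group of \<open>\<hh>\<close> is literally a restriction of that of
    \<open>\<gg>\<close>, the form in which induction expects a representation of a
    subgroup.\<close>
  have H: "exp_group \<hh> = ?G\<lparr>carrier := ?H\<rparr>" by (simp add: exp_group_def)
  interpret p: subgroup_character ?G "mexp ` \<pp>" ?\<xi>
    by (rule subgroup_character_polarization[OF char e g g(1) order_refl ld l(2)])
  interpret q: subgroup_character ?G "mexp ` \<qq>" ?\<eta>
    by (rule subgroup_character_polarization[OF char e g h md m(2)])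
  interpret two_characters ?G "mexp ` \<pp>" ?\<xi> "mexp ` \<qq>" ?\<eta> ..
  interpret h: subgroup_character "exp_group \<hh>" "mexp ` \<qq>" ?\<eta>
    by (rule subgroup_character_polarization[OF char e h(1) hut h(1) order_refl md m(2)])
  have t_eq: "t = ind (one_dim_rep ?\<eta>) (mexp ` \<qq>) (?G\<lparr>carrier := ?H\<rparr>)"
    by (simp add: t kirillov_rep_def H)
  have sH: "subgroup ?H ?G" by (rule subgroup_exp[OF char g h])
  have "representation (?G\<lparr>carrier := ?H\<rparr>) t" using h.rep_I by (simp add: t_eq H)
  then have R: "representation ?G (ind t ?H ?G)" by (rule representation_ind[OF p.is_group sH])
  have C: "vector_space ((*) :: complex \<Rightarrow> complex \<Rightarrow> complex)"
    by unfold_locales (auto simp: algebra_simps)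
  \<comment> \<open>Vectors of the induced representation are functions with values in functions, so
    the spanning set {1} of the complex numbers is lifted twice.\<close>
  have "module.span ((*) :: complex \<Rightarrow> complex \<Rightarrow> complex) {1} = UNIV"
    by (simp add: module.span_singleton[OF C[folded module_iff_vector_space]])
  from finite_spanning_pointwise[OF C _ this]
  obtain B1 :: "(('k, 'n) sqmat \<Rightarrow> complex) set"
    where B1: "finite B1" "module.span (\<lambda>c f x. c * f x) B1 = UNIV" by auto
  obtain B :: "(('k, 'n) sqmat \<Rightarrow> ('k, 'n) sqmat \<Rightarrow> complex) set"
    where B: "finite B" "module.span (rep_scale (ind t ?H ?G)) B = UNIV"
    using finite_spanning_pointwise[OF vector_space_pointwise[OF C] B1]
    by (auto simp: t_eq ind_simps)
  have irr: "irreducible_rep ?G T"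
    unfolding T by (rule irreducible_kirillov_rep[OF char e g ld l(2)])
  have Q: "mexp ` \<qq> \<subseteq> ?H" using pol_lie(3)[OF char h(1) hut md m(2)] by auto
  have "occurs_in ?G T (ind t ?H ?G) \<longleftrightarrow>
      (\<exists>\<phi>. rep_hom ?G T (ind t ?H ?G) \<phi> \<and> (\<exists>v\<in>rep_space T. \<phi> v \<noteq> 0))"
    by (rule occurs_in_iff_rep_hom[OF p.is_group p.finite_carrier R B irr])
  also have "\<dots> \<longleftrightarrow> (\<exists>\<phi>. rep_hom ?G T q.I \<phi> \<and> (\<exists>v\<in>rep_space T. \<phi> v \<noteq> 0))"
    unfolding t_eq by (rule nonzero_hom_ind_stages[OF p.is_group sH Q])
  also have "\<dots> \<longleftrightarrow> (\<exists>u\<in>mexp ` \<gg>. \<forall>s\<in>mexp ` \<pp>. \<forall>r\<in>mexp ` \<qq>. r ** u = u ** s \<longrightarrow> ?\<eta> r = ?\<xi> s)"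
    using nonzero_hom_iff by (simp add: T kirillov_rep_def)
  also have "\<dots> \<longleftrightarrow> (\<exists>u\<in>mexp ` \<gg>. compatible_at u l \<pp> m \<qq>)"
    by (rule bex_cong[OF refl compatible_characters_iff[OF char e g h ld l(2) md m(2)]])
  also have "\<dots> \<longleftrightarrow> \<Omega> \<inter> dual_proj \<hh> -` \<omega> \<noteq> {}"
    by (rule compatible_orbits_iff[OF char e g h ld l(2) md m(2) assms(7) l(1) assms(8) m(1)])
  finally show ?thesis by simp
qed

end
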